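(* Let $n\ge 3$, let $\Omega\subset\mathbb{R}^n$ be a bounded smooth domain with Euclidean metric $g_0$, and let $g=e^{2\rho}g_0$ with $\rho\in C^\infty(\overline\Omega)$. For $1\le k\le n$ let $w_k$ and $\widetilde w_k$ be the solutions of the $\sigma_k$-Ricci problem on $\Omega$ with background metric $g_0$ and $g$ respectively, and let $c_j^k$ and $\widetilde c_j^k$ ($j=1,\dots,n-1$) be the coefficients (functions on $\partial\Omega$) of $d^j$ in their boundary expansions, where $d$ is the Euclidean distance to $\partial\Omega$ in both expansions. Then for every $1\le k\le n$ and every $j=1,\dots,n-1$, $c_j^k-c_j^1$ is conformally invariant; namely, $$c_j^k-c_j^1=\widetilde c_j^k-\widetilde c_j^1\quad\text{on }\partial\Omega.$$
   Context: For a metric $g$ smooth on $\overline\Omega$, the $\sigma_k$-Ricci problem with background metric $g$ is: find $w\in C^\infty(\Omega)$ with $$\sigma_k\left[-g^{-1}\mathrm{Ric}(e^{2w}g)\right]=(n-1)^k\binom{n}{k}e^{2kw}\ \text{in }\Omega,\qquad w=\infty\ \text{on }\partial\Omega,$$ and $-\mathrm{Ric}(e^{2w}g)\in\Gamma_k^+$ (that is, $-g^{-1}\mathrm{Ric}(e^{2w}g)\in\Gamma_k^+$). Here $\sigma_k$ is the $k$-th elementary symmetric polynomial of the eigenvalues, $\Gamma_k^+$ is the connected component of $\{\sigma_k>0\}$ containing the positive definite cone, and $w=\infty$ on $\partial\Omega$ means $w(x)\to+\infty$ as $x\to\partial\Omega$. It is known (Gursky–Streets–Warren) that this problem has a unique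 solution. Near $\partial\Omega$, points are written as $(x',d)$, with $d$ the Euclidean distance to $\partial\Omega$ and $x'\in\partial\Omega$ the nearest boundary point; functions on $\partial\Omega$ are regarded as functions of $x'$. The solutions have expansions as $d\to0$ with coefficients smooth functions on $\partial\Omega$: $$w_k=-\log d+c_1^kd+c_2^kd^2+\cdots+c_{n-1}^kd^{n-1}+c_{n,1}^kd^n\log d+O(d^n),$$ $$\widetilde w_k=-\log d+\widetilde c_0^{\,k}+\widetilde c_1^{\,k}d+\widetilde c_2^{\,k}d^2+\cdots+\widetilde c_{n-1}^{\,k}d^{n-1}+\widetilde c_{n,1}^{\,k}d^n\log d+O(d^n).$$ *)

theory Defs
  imports "HOL-Analysis.Analysis"
begin

subsection \<open>Smooth functions and smooth domains\<close>

text \<open>\<open>Ck_on m U f\<close> is meant for open \<open>U\<close>: all directional derivatives of \<open>f\<close> of order at most \<open>m\<close>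
  exist and are continuous on \<open>U\<close>.\<close>

primrec Ck_on :: "nat \<Rightarrow> 'a::euclidean_space set \<Rightarrow> ('a \<Rightarrow> real) \<Rightarrow> bool" where
  "Ck_on 0 U f \<longleftrightarrow> continuous_on U f"
| "Ck_on (Suc m) U f \<longleftrightarrow>
     (\<forall>x\<in>U. f differentiable (at x)) \<and> (\<forall>v. Ck_on m U (\<lambda>x. frechet_derivative f (at x) v))"

text \<open>Smoothness on an arbitrary set \<open>S\<close>: locally the restriction of a \<open>C\<^sup>\<infinity>\<close> function on an open set.
  For open \<open>S\<close> this is the usual notion; for \<open>S = closure \<Omega>\<close> it is smoothness up to
  the boundary; for \<open>S = frontier \<Omega>\<close>, with \<open>\<Omega>\<close> a smooth domain, it is smoothness on the
  embedded hypersurface \<open>\<partial>\<Omega>\<close>.\<close>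

definition smooth_on :: "'a::euclidean_space set \<Rightarrow> ('a \<Rightarrow> real) \<Rightarrow> bool" where
  "smooth_on S f \<longleftrightarrow>
     (\<forall>x\<in>S. \<exists>U F. open U \<and> x \<in> U \<and> (\<forall>m. Ck_on m U F) \<and> (\<forall>y\<in>S \<inter> U. F y = f y))"

text \<open>The boundary is locally the regular zero level of a smooth function,
  with \<open>\<Omega>\<close> on one side of it.\<close>

definition bounded_smooth_domain :: "'a::euclidean_space set \<Rightarrow> bool" where
  "bounded_smooth_domain \<Omega> \<longleftrightarrow>
     open \<Omega> \<and> connected \<Omega> \<and> bounded \<Omega> \<and> \<Omega> \<noteq> {} \<and>
     (\<forall>p\<in>frontier \<Omega>. \<exists>U \<phi>. open U \<and> p \<in> U \<and> smooth_on U \<phi> \<and>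
        (\<forall>x\<in>U. \<exists>v. frechet_derivative \<phi> (at x) v \<noteq> 0) \<and>
        \<Omega> \<inter> U = {x\<in>U. \<phi> x < 0} \<and> frontier \<Omega> \<inter> U = {x\<in>U. \<phi> x = 0})"

subsection \<open>Ricci curvature\<close>

text \<open>A metric is given by its matrix of components \<open>G x $ i $ j\<close> in Cartesian coordinates.\<close>

definition partial :: "'n::finite \<Rightarrow> (real^'n \<Rightarrow> real) \<Rightarrow> real^'n \<Rightarrow> real" where
  "partial i f x = frechet_derivative f (at x) (axis i 1)"

text \<open>\<open>christoffel G l i j\<close> is \<open>\<Gamma>\<^sup>l\<^sub>i\<^sub>j\<close>.\<close>

definition christoffel ::
  "(real^'n \<Rightarrow> real^'n^'n) \<Rightarrow> 'n::finite \<Rightarrow> 'n \<Rightarrow> 'n \<Rightarrow> real^'n \<Rightarrow> real" where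
  "christoffel G l i j x =
     (\<Sum>m\<in>UNIV. matrix_inv (G x) $ l $ m *
        (partial i (\<lambda>y. G y $ j $ m) x + partial j (\<lambda>y. G y $ i $ m) x
           - partial m (\<lambda>y. G y $ i $ j) x)) / 2"

definition ricci :: "(real^'n \<Rightarrow> real^'n^'n) \<Rightarrow> real^'n::finite \<Rightarrow> real^'n^'n" where
  "ricci G x = (\<chi> i j.
     (\<Sum>l\<in>UNIV. partial l (christoffel G l i j) x - partial j (christoffel G l i l) x)
     + (\<Sum>l\<in>UNIV. \<Sum>m\<in>UNIV. christoffel G l l m x * christoffel G m i j x
                       - christoffel G l j m x * christoffel G m i l x))"

definition flat_metric :: "real^'n \<Rightarrow> real^'n^'n::finite" where
  "flat_metric x = mat 1"

definition conformal_metric ::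
  "(real^'n \<Rightarrow> real) \<Rightarrow> (real^'n \<Rightarrow> real^'n^'n) \<Rightarrow> real^'n \<Rightarrow> real^'n^'n::finite" where
  "conformal_metric w G x = exp (2 * w x) *\<^sub>R G x"

subsection \<open>Elementary symmetric functions of the eigenvalues\<close>

definition elem_sym :: "nat \<Rightarrow> ('n::finite \<Rightarrow> real) \<Rightarrow> real" where
  "elem_sym k l = (\<Sum>I | card I = k. \<Prod>i\<in>I. l i)"

text \<open>\<open>l\<close> enumerates the eigenvalues of \<open>A\<close> with algebraic multiplicity.  Such an \<open>l\<close> exists
  when \<open>A\<close> is self-adjoint for some inner product, and it is unique up to a permutation of the indices,
  to which \<open>elem_sym k\<close> is insensitive.\<close>

definition is_eigenvalues :: "real^'n^'n \<Rightarrow> ('n::finite \<Rightarrow> real) \<Rightarrow> bool" where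
  "is_eigenvalues A l \<longleftrightarrow> (\<forall>t. det (mat t - A) = (\<Prod>i\<in>UNIV. t - l i))"

definition sigma :: "nat \<Rightarrow> real^'n^'n::finite \<Rightarrow> real" where
  "sigma k A = elem_sym k (SOME l. is_eigenvalues A l)"

text \<open>Endomorphisms that are self-adjoint (respectively self-adjoint and positive definite) for the
  inner product with Gram matrix \<open>H\<close>.  For \<open>H = mat 1\<close> these are the symmetric (respectively
  symmetric positive definite) matrices.\<close>

definition self_adjoint_wrt :: "real^'n^'n \<Rightarrow> (real^'n^'n::finite) set" where
  "self_adjoint_wrt H = {A. transpose (H ** A) = H ** A}"

definition positive_cone :: "real^'n^'n \<Rightarrow> (real^'n^'n::finite) set" where
  "positive_cone H = {A \<in> self_adjoint_wrt H. \<forall>v. v \<noteq> 0 \<longrightarrow> 0 < v \<bullet> ((H ** A) *v v)}"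

text \<open>\<open>\<Gamma>\<^sub>k\<^sup>+\<close>: the union below has exactly one member, since the positive cone is nonempty and
  connected and distinct components are disjoint.\<close>

definition Gamma_plus :: "nat \<Rightarrow> real^'n^'n \<Rightarrow> (real^'n^'n::finite) set" where
  "Gamma_plus k H =
     \<Union>{C \<in> components {A \<in> self_adjoint_wrt H. 0 < sigma k A}. positive_cone H \<subseteq> C}"

subsection \<open>The sigma_k-Ricci problem\<close>

definition neg_ricci_endo ::
  "(real^'n \<Rightarrow> real^'n^'n) \<Rightarrow> (real^'n \<Rightarrow> real) \<Rightarrow> real^'n::finite \<Rightarrow> real^'n^'n" where
  "neg_ricci_endo G w x = - (matrix_inv (G x) ** ricci (conformal_metric w G) x)"

definition sigma_ricci_solution ::
  "(real^'n) set \<Rightarrow> (real^'n \<Rightarrow> real^'n^'n) \<Rightarrow> nat \<Rightarrow> (real^'n::finite \<Rightarrow> real) \<Rightarrow> bool" where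
  "sigma_ricci_solution \<Omega> G k w \<longleftrightarrow>
     smooth_on \<Omega> w \<and>
     (\<forall>x\<in>\<Omega>. sigma k (neg_ricci_endo G w x) =
        (real CARD('n) - 1) ^ k * real (CARD('n) choose k) * exp (2 * real k * w x)) \<and>
     (\<forall>x\<in>\<Omega>. neg_ricci_endo G w x \<in> Gamma_plus k (G x)) \<and>
     (\<forall>p\<in>frontier \<Omega>. filterlim w at_top (at p within \<Omega>))"

subsection \<open>Boundary expansions\<close>

text \<open>\<open>w = - log d + c\<^sub>0 + c\<^sub>1 d + \<dots> + c\<^sub>n\<^sub>-\<^sub>1 d\<^sup>n\<^sup>-\<^sup>1 + e d\<^sup>n log d + O(d\<^sup>n)\<close>, uniformly as \<open>d \<rightarrow> 0\<close>,
  where \<open>d\<close> is the Euclidean distance to the boundary and the smooth coefficients \<open>c\<^sub>j\<close>, \<open>e\<close> are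
  evaluated at the nearest boundary point \<open>p\<close>, which is unique for small \<open>d\<close>.\<close>

definition boundary_expansion ::
  "(real^'n) set \<Rightarrow> (real^'n \<Rightarrow> real) \<Rightarrow> (nat \<Rightarrow> real^'n \<Rightarrow> real) \<Rightarrow> (real^'n::finite \<Rightarrow> real) \<Rightarrow> bool"
where
  "boundary_expansion \<Omega> w c e \<longleftrightarrow>
     (\<forall>j<CARD('n). smooth_on (frontier \<Omega>) (c j)) \<and> smooth_on (frontier \<Omega>) e \<and>
     (\<exists>C. \<exists>\<delta>>0. \<forall>x\<in>\<Omega>. \<forall>p\<in>frontier \<Omega>.
        let d = infdist x (frontier \<Omega>) in
        dist x p = d \<and> d < \<delta> \<longrightarrow>
        \<bar>w x - (- ln d + (\<Sum>j<CARD('n). c j p * d ^ j) + e p * d ^ CARD('n) * ln d)\<bar>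
          \<le> C * d ^ CARD('n))"

end

theory Submission
  imports Defs "HOL-Computational_Algebra.Fundamental_Theorem_Algebra"
begin

text \<open>The metrics \<open>e\<^bsup>2w\<^esup>g\<close> with \<open>g = e\<^bsup>2\<rho>\<^esup>g\<^sub>0\<close> and \<open>e\<^bsup>2(w+\<rho>)\<^esup>g\<^sub>0\<close> are the same, so if \<open>w'\<^sub>k\<close> solves the
  \<open>\<sigma>\<^sub>k\<close>-Ricci problem with background \<open>g\<close>, then \<open>w'\<^sub>k + \<rho>\<close> solves it with background \<open>g\<^sub>0\<close>.  Once
  solutions are known to be unique, \<open>w\<^sub>k = w'\<^sub>k + \<rho>\<close> in \<open>\<Omega>\<close>, the conformal factor cancels in
  \<open>w\<^sub>k - w\<^sub>1 = w'\<^sub>k - w'\<^sub>1\<close>, and the coefficients of such a difference can be read off along the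
  inner normal at each boundary point (\<open>log_expansion_coefficients_eq_0\<close>).

  Uniqueness rests on \<open>comparison_principle\<close>.  Where \<open>w - v\<close> is largest, the gradients of \<open>w\<close> and
  \<open>v\<close> agree and \<open>v - w\<close> has a nonnegative Hessian; the formula for the Ricci curvature of a
  conformally flat metric (\<open>ricci_conformal\<close>) then says that \<open>-Ric\<close> of the metric of \<open>v\<close> exceeds that
  of \<open>w\<close> by a positive semidefinite matrix.  As \<open>\<sigma>\<^sub>k\<close> does not decrease in such directions on
  \<open>\<Gamma>\<^sub>k\<^sup>+\<close>, the two equations give \<open>e\<^bsup>2kw\<^esup> \<le> e\<^bsup>2kv\<^esup>\<close> there.  What the principle needs in addition is
  \<open>w - v \<rightarrow> 0\<close> at the boundary.  By the expansions this is a statement about the terms of order zero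
  only: that of \<open>w'\<^sub>k\<close> has to be \<open>-\<rho>\<close>.  Every boundary point has an interior and an exterior tangent
  ball, and the hyperbolic metrics of the ball and of the complement of a ball are explicit solutions
  (\<open>ball_potential_sigma_ricci_on\<close>); comparison with them yields \<open>v + log d \<rightarrow> 0\<close> along the normal
  for every solution \<open>v\<close> with background \<open>g\<^sub>0\<close> (\<open>boundary_asymptotics\<close>).

  The algebraic core is the monotonicity of \<open>\<sigma>\<^sub>k\<close> (\<open>sigma_mono_garding_cone\<close>).  By the spectral
  theorem a positive semidefinite matrix is a sum of matrices \<open>u u\<^sup>T\<close>.  In an orthonormal eigenbasis
  \<open>f\<^sub>i\<close> of a symmetric \<open>A\<close> with eigenvalues \<open>\<lambda>\<^sub>i\<close>, adding \<open>u u\<^sup>T\<close> changes \<open>\<sigma>\<^sub>k\<close> by exactly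
  \<open>\<Sum>\<^sub>i (u \<bullet> f\<^sub>i)\<^sup>2 \<sigma>\<^sub>k\<^sub>-\<^sub>1(\<lambda> without \<lambda>\<^sub>i)\<close>, and the numbers \<open>\<sigma>\<^sub>k\<^sub>-\<^sub>1(\<lambda> without \<lambda>\<^sub>i)\<close> are positive as soon as
  \<open>\<sigma>\<^sub>1, \<dots>, \<sigma>\<^sub>k\<close> are positive at \<open>\<lambda>\<close> (\<open>esym_remove_pos\<close>).  That all of \<open>\<sigma>\<^sub>1, \<dots>, \<sigma>\<^sub>k\<close> are positive on
  \<open>\<Gamma>\<^sub>k\<^sup>+\<close> follows by connectedness.  Both facts come from Newton's inequalities, that is,
  from Laguerre's inequality for the real-rooted polynomial \<open>\<Prod>\<^sub>i (1 + \<lambda>\<^sub>i t)\<close> and its derivatives.\<close>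

section \<open>Newton's inequalities for elementary symmetric functions\<close>

text \<open>The zero polynomial belongs to this class (\<open>c = 0\<close>), so that it is closed under differentiation.\<close>

definition splits :: "real poly \<Rightarrow> bool" where
  "splits p \<longleftrightarrow> (\<exists>c M. p = smult c (\<Prod>a\<in>#M. [:-a, 1:]))"

abbreviation cpoly :: "real poly \<Rightarrow> complex poly" where
  "cpoly \<equiv> map_poly complex_of_real"

lemma cpoly_mult: "cpoly (p * q) = cpoly p * cpoly q"
  by (rule poly_eqI) (simp add: coeff_map_poly coeff_mult)

lemma cpoly_smult: "cpoly (smult c p) = smult (of_real c) (cpoly p)"
  by (rule poly_eqI) (simp add: coeff_map_poly)

lemma cpoly_linear: "cpoly [:-a, 1:] = [:- of_real a, 1:]"
  by (simp add: map_poly_pCons)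

lemma cpoly_pderiv: "cpoly (pderiv p) = pderiv (cpoly p)"
  by (rule poly_eqI) (simp add: coeff_map_poly coeff_pderiv)

lemma poly_cpoly_of_real: "poly (cpoly p) (of_real x) = of_real (poly p x)"
  by (induction p) (simp_all add: map_poly_pCons)

lemma splits_if_only_real_roots:
  assumes "\<And>z. poly (cpoly p) z = 0 \<Longrightarrow> Im z = 0"
  shows "splits p"
  using assms
proof (induction "degree p" arbitrary: p rule: less_induct)
  case less
  show ?case
  proof (cases "degree p = 0")
    case True
    then obtain c where "p = [:c:]" by (metis degree_eq_zeroE)
    then have "p = smult c (\<Prod>a\<in>#{#}. [:-a, 1:])" by simp
    then show ?thesis unfolding splits_def by blast
  next
    case False
    then have "degree (cpoly p) \<noteq> 0" by (simp add: degree_map_poly)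
    then have "\<not> constant (poly (cpoly p))" by (simp add: constant_degree)
    then obtain z where z: "poly (cpoly p) z = 0"
      using fundamental_theorem_of_algebra by blast
    with less.prems have "Im z = 0" by blast
    then obtain a where a: "z = of_real a" by (intro that[of "Re z"]) (simp add: complex_eq_iff)
    with z have "poly p a = 0" by (simp add: poly_cpoly_of_real)
    then obtain q where q: "p = [:-a, 1:] * q" by (auto simp: poly_eq_0_iff_dvd dvd_def)
    with False have "q \<noteq> 0" by auto
    then have deg: "degree q < degree p" unfolding q by (subst degree_mult_eq) auto
    have "splits q"
    proof (rule less.hyps[OF deg])
      show "Im z = 0" if "poly (cpoly q) z = 0" for z
        by (rule less.prems) (simp add: q cpoly_mult that del: mult_pCons_left)
    qed
    then obtain c M where "q = smult c (\<Prod>a\<in>#M. [:-a, 1:])" unfolding splits_def by blast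
    then have "p = smult c (\<Prod>a\<in>#add_mset a M. [:-a, 1:])"
      by (simp add: q del: mult_pCons_left)
    then show ?thesis unfolding splits_def by blast
  qed
qed

text \<open>This is the computation behind the theorem of Gauss and Lucas: \<open>P'/P\<close> is the sum of the terms
  \<open>1 / (z - a)\<close>, each of which lies on the other side of the real axis than \<open>z\<close>.  Hence a derivative
  of a real-rooted polynomial cannot vanish off the real axis.\<close>

lemma logarithmic_derivative_sign:
  fixes M :: "real multiset"
  assumes z: "Im z \<noteq> 0"
  defines "P \<equiv> cpoly (\<Prod>a\<in>#M. [:-a, 1:])"
  shows "poly P z \<noteq> 0 \<and> Im z * Im (poly (pderiv P) z / poly P z) \<le> 0
    \<and> (M \<noteq> {#} \<longrightarrow> Im z * Im (poly (pderiv P) z / poly P z) < 0)"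
  unfolding P_def
proof (induction M)
  case empty
  then show ?case by simp
next
  case (add a M)
  define Q where "Q = cpoly (\<Prod>a\<in>#M. [:-a, 1:])"
  let ?R = "[:- complex_of_real a, 1:] * Q"
  have R: "cpoly (\<Prod>a\<in>#add_mset a M. [:-a, 1:]) = ?R"
    by (simp add: cpoly_mult cpoly_linear Q_def del: mult_pCons_left)
  have za: "z - of_real a \<noteq> 0" using z by (auto simp: complex_eq_iff)
  have Q0: "poly Q z \<noteq> 0" and Q1: "Im z * Im (poly (pderiv Q) z / poly Q z) \<le> 0"
    using add.IH unfolding Q_def by auto
  have "poly ?R z = (z - of_real a) * poly Q z"
    by (simp add: algebra_simps)
  moreover have "poly (pderiv ?R) z = poly Q z + (z - of_real a) * poly (pderiv Q) z"
    by (simp add: pderiv_mult pderiv_pCons algebra_simps del: mult_pCons_left mult_pCons_right)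
  ultimately have eq: "poly ?R z \<noteq> 0"
    "poly (pderiv ?R) z / poly ?R z = 1 / (z - of_real a) + poly (pderiv Q) z / poly Q z"
    using Q0 za by (auto simp: field_simps)
  have "Im z * Im (1 / (z - of_real a)) = - ((Im z)\<^sup>2 / (cmod (z - of_real a))\<^sup>2)"
    by (simp add: Im_divide cmod_power2) (simp add: power2_eq_square)
  moreover have "(Im z)\<^sup>2 / (cmod (z - of_real a))\<^sup>2 > 0"
    using z za by simp
  ultimately have "Im z * Im (1 / (z - of_real a)) < 0" by linarith
  then have "Im z * Im (poly (pderiv ?R) z / poly ?R z) < 0"
    using Q1 unfolding eq(2) by (simp add: algebra_simps)
  then show ?case unfolding R using eq(1) by auto
qed

lemma splits_pderiv:
  assumes "splits p"
  shows "splits (pderiv p)"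
proof (cases "pderiv p = 0")
  case True
  then have "pderiv p = smult 0 (\<Prod>a\<in>#{#}. [:-a, 1:])" by simp
  then show ?thesis unfolding splits_def by blast
next
  case False
  obtain c M where p: "p = smult c (\<Prod>a\<in>#M. [:-a, 1:])" using assms unfolding splits_def by blast
  have c: "c \<noteq> 0" and M: "M \<noteq> {#}" using False unfolding p by (auto simp: pderiv_smult)
  show ?thesis
  proof (rule splits_if_only_real_roots, rule ccontr)
    fix z assume z: "poly (cpoly (pderiv p)) z = 0" and Im: "Im z \<noteq> 0"
    have "poly (pderiv (cpoly (\<Prod>a\<in>#M. [:-a, 1:]))) z = 0"
      using z c unfolding p by (simp add: pderiv_smult cpoly_smult cpoly_pderiv)
    then show False using logarithmic_derivative_sign[OF Im, of M] M by simp
  qed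
qed

text \<open>Multiplication of \<open>q\<close> by a factor \<open>x - a\<close> turns \<open>D(q) = q'\<^sup>2 - q q''\<close> into \<open>q\<^sup>2 + (x - a)\<^sup>2 D(q)\<close>, so
  \<open>D\<close> stays nonnegative when linear factors are added one at a time, and becomes positive with
  the first factor at points that are not roots.\<close>

lemma laguerre_inequality:
  assumes "splits p"
  shows "poly p x * poly (pderiv (pderiv p)) x \<le> (poly (pderiv p) x)\<^sup>2"
    and "poly p x \<noteq> 0 \<Longrightarrow> degree p > 0 \<Longrightarrow>
      poly p x * poly (pderiv (pderiv p)) x < (poly (pderiv p) x)\<^sup>2"
proof -
  obtain c M where p: "p = smult c (\<Prod>a\<in>#M. [:-a, 1:])" using assms unfolding splits_def by blast
  let ?D = "\<lambda>p. (poly (pderiv p) x)\<^sup>2 - poly p x * poly (pderiv (pderiv p)) x"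
  have step: "?D ([:-a, 1:] * q) = (poly q x)\<^sup>2 + (x - a)\<^sup>2 * ?D q" for a :: real and q
    by (simp add: pderiv_mult pderiv_add pderiv_pCons power2_eq_square algebra_simps
        del: mult_pCons_left mult_pCons_right)
  have D: "?D (\<Prod>a\<in>#M. [:-a, 1:]) \<ge> 0 \<and>
      (poly (\<Prod>a\<in>#M. [:-a, 1:]) x \<noteq> 0 \<and> M \<noteq> {#} \<longrightarrow> ?D (\<Prod>a\<in>#M. [:-a, 1:]) > 0)"
  proof (induction M)
    case empty
    then show ?case by (simp add: pderiv_1)
  next
    case (add a M)
    let ?q = "\<Prod>a\<in>#M. [:-a, 1:]"
    have "?D (\<Prod>a\<in>#add_mset a M. [:-a, 1:]) = (poly ?q x)\<^sup>2 + (x - a)\<^sup>2 * ?D ?q"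
      using step[of a ?q] by (simp del: mult_pCons_left)
    moreover have "(x - a)\<^sup>2 * ?D ?q \<ge> 0" using add.IH by simp
    moreover have "poly ?q x \<noteq> 0 \<Longrightarrow> (poly ?q x)\<^sup>2 > 0" by simp
    moreover have "(poly ?q x)\<^sup>2 \<ge> 0" by simp
    ultimately have "?D (\<Prod>a\<in>#add_mset a M. [:-a, 1:]) \<ge> 0"
      "poly ?q x \<noteq> 0 \<Longrightarrow> ?D (\<Prod>a\<in>#add_mset a M. [:-a, 1:]) > 0" by linarith+
    moreover have "poly (\<Prod>a\<in>#add_mset a M. [:-a, 1:]) x = (x - a) * poly ?q x"
      by (simp add: algebra_simps)
    ultimately show ?case by force
  qed
  have c2: "?D p = c\<^sup>2 * ?D (\<Prod>a\<in>#M. [:-a, 1:])"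
    unfolding p by (simp add: pderiv_smult power2_eq_square algebra_simps)
  show "poly p x * poly (pderiv (pderiv p)) x \<le> (poly (pderiv p) x)\<^sup>2"
    using c2 D by (smt (verit) mult_nonneg_nonneg zero_le_power2)
  assume "poly p x \<noteq> 0" "degree p > 0"
  then have "c \<noteq> 0" "poly (\<Prod>a\<in>#M. [:-a, 1:]) x \<noteq> 0" "M \<noteq> {#}" unfolding p by auto
  then show "poly p x * poly (pderiv (pderiv p)) x < (poly (pderiv p) x)\<^sup>2"
    using c2 D by (smt (verit) mult_pos_pos zero_less_power2)
qed

text \<open>The generating polynomial \<open>\<Sum>\<^sub>k \<sigma>\<^sub>k t\<^sup>k\<close>.  Putting \<open>1\<close> rather than \<open>t\<close> next to \<open>l\<^sub>i\<close> makes \<open>\<sigma>\<^sub>k\<close> the coefficient of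
  \<open>t\<^sup>k\<close> whatever the number of variables is.\<close>

definition esym_gen :: "'a set \<Rightarrow> ('a \<Rightarrow> real) \<Rightarrow> real poly" where
  "esym_gen S l = (\<Prod>i\<in>S. [:1, l i:])"

definition esym :: "'a set \<Rightarrow> nat \<Rightarrow> ('a \<Rightarrow> real) \<Rightarrow> real" where
  "esym S k l = coeff (esym_gen S l) k"

lemma esym_0 [simp]: "esym S 0 l = 1"
  by (cases "finite S") (simp_all add: esym_def esym_gen_def poly_prod flip: poly_0_coeff_0)

lemma esym_insert:
  assumes "finite S" "a \<notin> S"
  shows "esym (insert a S) (Suc k) l = esym S (Suc k) l + l a * esym S k l"
  using assms by (simp add: esym_def esym_gen_def)

lemma elem_sym_eq_esym: "elem_sym k l = esym UNIV k l"
proof -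
  have "esym_gen UNIV l = (\<Prod>i\<in>UNIV. monom (l i) 1 + 1)"
    unfolding esym_gen_def by (intro prod.cong) (simp_all add: monom_altdef one_pCons)
  also have "\<dots> = (\<Sum>X\<in>Pow UNIV. (\<Prod>i\<in>X. monom (l i) 1) * (\<Prod>i\<in>UNIV-X. 1))"
    by (rule prod_add) simp
  also have "\<dots> = (\<Sum>X\<in>UNIV. monom (\<Prod>i\<in>X. l i) (card X))"
  proof (intro sum.cong)
    fix X :: "'a set"
    have "finite X" by simp
    then have "(\<Prod>i\<in>X. monom (l i) 1) = monom (\<Prod>i\<in>X. l i) (card X)"
      by (induction X) (simp_all add: mult_monom one_pCons monom_0)
    then show "(\<Prod>i\<in>X. monom (l i) 1) * (\<Prod>i\<in>UNIV-X. 1) = monom (\<Prod>i\<in>X. l i) (card X)" by simp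
  qed simp
  finally have "esym UNIV k l = (\<Sum>X\<in>UNIV. coeff (monom (\<Prod>i\<in>X. l i) (card X)) k)"
    by (simp add: esym_def coeff_sum)
  also have "\<dots> = (\<Sum>X\<in>UNIV. if card X = k then \<Prod>i\<in>X. l i else 0)"
    by (intro sum.cong) auto
  also have "\<dots> = elem_sym k l"
    unfolding elem_sym_def by (subst sum.If_cases) simp_all
  finally show ?thesis ..
qed

lemma splits_esym_gen: "finite S \<Longrightarrow> splits (esym_gen S l)"
proof -
  assume "finite S"
  then have "\<exists>c M. esym_gen S l = smult c (\<Prod>a\<in>#M. [:-a, 1:])"
  proof (induction S)
    case empty
    have "esym_gen {} l = smult 1 (\<Prod>a\<in>#{#}. [:-a, 1:])" by (simp add: esym_gen_def)
    then show ?case by blast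
  next
    case (insert i S)
    then obtain c M where IH: "esym_gen S l = smult c (\<Prod>a\<in>#M. [:-a, 1:])" by blast
    have ins: "esym_gen (insert i S) l = [:1, l i:] * esym_gen S l"
      using insert.hyps by (simp add: esym_gen_def del: mult_pCons_left)
    show ?case
    proof (cases "l i = 0")
      case True
      then have "esym_gen (insert i S) l = smult c (\<Prod>a\<in>#M. [:-a, 1:])" using ins IH by simp
      then show ?thesis by blast
    next
      case False
      then have e: "[:1, l i:] = smult (l i) [:- (- (1 / l i)), 1:]" by simp
      have "esym_gen (insert i S) l
          = smult (l i * c) (\<Prod>a\<in>#add_mset (- (1 / l i)) M. [:-a, 1:])"
        unfolding ins IH e image_mset_add_mset prod_mset.add_mset
        by (simp only: mult_smult_left mult_smult_right smult_smult mult.commute)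
      then show ?thesis by blast
    qed
  qed
  then show ?thesis by (simp add: splits_def)
qed

lemma splits_higher_pderiv: "splits p \<Longrightarrow> splits ((pderiv ^^ m) p)"
  by (induction m) (simp_all add: splits_pderiv)

text \<open>Laguerre's inequality at \<open>0\<close> for the \<open>m\<close>-th derivative of the generating polynomial: the three lowest
  coefficients of that derivative are multiples of \<open>\<sigma>\<^sub>m\<close>, \<open>\<sigma>\<^sub>m\<^sub>+\<^sub>1\<close>, \<open>\<sigma>\<^sub>m\<^sub>+\<^sub>2\<close>.  A nonzero \<open>\<sigma>\<^sub>k\<close> with \<open>k > m\<close> keeps it
  from being constant, which is what strictness requires.\<close>

lemma newton_inequality:
  assumes "finite S"
  shows "real (Suc (Suc m)) * (esym S m l * esym S (Suc (Suc m)) l)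
      \<le> real (Suc m) * (esym S (Suc m) l)\<^sup>2"
    and "esym S m l \<noteq> 0 \<Longrightarrow> k > m \<Longrightarrow> esym S k l \<noteq> 0 \<Longrightarrow>
      real (Suc (Suc m)) * (esym S m l * esym S (Suc (Suc m)) l)
      < real (Suc m) * (esym S (Suc m) l)\<^sup>2"
proof -
  \<comment> \<open>The lowest coefficients of \<open>q\<close> are \<open>m! \<sigma>\<^sub>m\<close>, \<open>(m+1)! \<sigma>\<^sub>m\<^sub>+\<^sub>1\<close> and \<open>(m+2)! \<sigma>\<^sub>m\<^sub>+\<^sub>2 / 2\<close>.\<close>
  define q where "q = (pderiv ^^ m) (esym_gen S l)"
  have q: "splits q" unfolding q_def using assms by (intro splits_higher_pderiv splits_esym_gen)
  have cq: "coeff q i = pochhammer (real (Suc i)) m * esym S (i + m) l" for i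
    unfolding q_def coeff_higher_pderiv esym_def by (simp add: add.commute)
  have f: "pochhammer (1::real) m = fact m" by (simp add: pochhammer_fact)
  have f1: "pochhammer (2::real) m = fact (Suc m)"
    using pochhammer_rec[of "1::real" m] by (simp add: pochhammer_fact)
  have f2: "2 * pochhammer (3::real) m = fact (Suc (Suc m))"
    using pochhammer_rec[of "2::real" m] pochhammer_rec[of "1::real" "Suc m"]
    by (simp add: pochhammer_fact)
  have c0: "poly q 0 = fact m * esym S m l"
    using cq[of 0] f by (simp add: poly_0_coeff_0)
  have c1: "poly (pderiv q) 0 = fact (Suc m) * esym S (Suc m) l"
    using cq[of 1] f1 by (simp add: poly_0_coeff_0 coeff_pderiv)
  have c2: "poly (pderiv (pderiv q)) 0 = fact (Suc (Suc m)) * esym S (Suc (Suc m)) l"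
    using cq[of 2] f2 by (simp add: poly_0_coeff_0 coeff_pderiv eval_nat_numeral)
  have L: "poly q 0 * poly (pderiv (pderiv q)) 0
      = fact m * fact (Suc m) * (real (Suc (Suc m)) * (esym S m l * esym S (Suc (Suc m)) l))"
    unfolding c0 c2 fact_Suc[of "Suc m"] by (simp only: mult_ac)
  have R: "(poly (pderiv q) 0)\<^sup>2 = fact m * fact (Suc m) * (real (Suc m) * (esym S (Suc m) l)\<^sup>2)"
    unfolding c1 power2_eq_square by (subst (1) fact_Suc) (simp only: mult_ac)
  have pos: "(fact m * fact (Suc m) :: real) > 0" by simp
  show "real (Suc (Suc m)) * (esym S m l * esym S (Suc (Suc m)) l)
      \<le> real (Suc m) * (esym S (Suc m) l)\<^sup>2"
    using laguerre_inequality(1)[OF q, of 0] unfolding L R mult_le_cancel_left_pos[OF pos] .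
  assume ne: "esym S m l \<noteq> 0" "k > m" "esym S k l \<noteq> 0"
  have "coeff q (k - m) \<noteq> 0"
    unfolding cq using ne by (auto simp: pochhammer_eq_0_iff)
  then have "degree q \<ge> k - m" by (rule le_degree)
  then have "degree q > 0" using ne by linarith
  moreover have "poly q 0 \<noteq> 0" unfolding c0 using ne by simp
  ultimately show "real (Suc (Suc m)) * (esym S m l * esym S (Suc (Suc m)) l)
      < real (Suc m) * (esym S (Suc m) l)\<^sup>2"
    using laguerre_inequality(2)[OF q, of 0] unfolding L R mult_less_cancel_left_pos[OF pos] by blast
qed

text \<open>If \<open>\<sigma>\<^sub>m\<^sub>+\<^sub>1\<close> were the first of these to vanish, the strict Newton inequality would make
  \<open>\<sigma>\<^sub>m \<sigma>\<^sub>m\<^sub>+\<^sub>2\<close> negative.  The lemma shows that the set \<open>\<sigma>\<^sub>1, \<dots>, \<sigma>\<^sub>k > 0\<close> is relatively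
  closed in \<open>\<sigma>\<^sub>k > 0\<close>.\<close>

lemma esym_pos_if_nonneg:
  assumes S: "finite S" and nonneg: "\<And>j. j < k \<Longrightarrow> 0 \<le> esym S j l" and pos: "0 < esym S k l"
    and "j \<le> k"
  shows "0 < esym S j l"
  using \<open>j \<le> k\<close>
proof (induction j)
  case 0
  then show ?case by simp
next
  case (Suc m)
  show ?case
  proof (rule ccontr)
    assume "\<not> ?case"
    then have ne: "Suc m \<noteq> k" and le0: "esym S (Suc m) l \<le> 0" using pos by auto
    then have Sk: "Suc m < k" using Suc.prems by simp
    then have z: "esym S (Suc m) l = 0" using nonneg le0 by force
    have m: "esym S m l > 0" using Suc by simp
    have m2: "esym S (Suc (Suc m)) l \<ge> 0"
      using nonneg[of "Suc (Suc m)"] pos Sk by (cases "Suc (Suc m) = k") auto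
    have "real (Suc (Suc m)) * (esym S m l * esym S (Suc (Suc m)) l) < 0"
      using newton_inequality(2)[OF S, of m l k] m Sk pos unfolding z by simp
    moreover have "real (Suc (Suc m)) * (esym S m l * esym S (Suc (Suc m)) l) \<ge> 0"
      using m m2 by (intro mult_nonneg_nonneg) auto
    ultimately show False by linarith
  qed
qed

text \<open>The partial derivatives of \<open>\<sigma>\<^sub>k\<^sub>+\<^sub>1\<close> are positive where \<open>\<sigma>\<^sub>1, \<dots>, \<sigma>\<^sub>k\<^sub>+\<^sub>1\<close> are.  Write \<open>x, y, z\<close> for three consecutive
  elementary symmetric functions without the variable \<open>l\<^sub>i\<close>.  If \<open>x > 0 \<ge> y\<close>, then positivity of
  \<open>y + l\<^sub>i x\<close> and \<open>z + l\<^sub>i y\<close> forces \<open>x z > y\<^sup>2\<close>, against Newton.\<close>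

lemma esym_remove_pos:
  assumes "finite S" "i \<in> S" and "\<And>j. j \<le> Suc k \<Longrightarrow> 0 < esym S j l"
  shows "0 < esym (S - {i}) k l"
  using assms(3)
proof (induction k)
  case 0
  then show ?case by simp
next
  case (Suc k)
  let ?T = "S - {i}"
  have S: "S = insert i ?T" using assms(2) by blast
  have rec: "esym S (Suc j) l = esym ?T (Suc j) l + l i * esym ?T j l" for j
    by (subst S, rule esym_insert) (use assms(1) in auto)
  have a: "esym ?T k l > 0" using Suc by simp
  have b: "esym ?T (Suc k) l + l i * esym ?T k l > 0"
    and c: "esym ?T (Suc (Suc k)) l + l i * esym ?T (Suc k) l > 0"
    using Suc.prems[of "Suc k"] Suc.prems[of "Suc (Suc k)"] rec by auto
  let ?x = "esym ?T k l" and ?y = "esym ?T (Suc k) l" and ?z = "esym ?T (Suc (Suc k)) l"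
  show ?case
  proof (rule ccontr)
    assume "\<not> ?thesis"
    then have y: "?y \<le> 0" by simp
    have "?x * (?z + l i * ?y) > 0" using a c by simp
    moreover have "?y * (?y + l i * ?x) \<le> 0" using y b by (simp add: mult_nonpos_nonneg)
    ultimately have lt: "?x * ?z > ?y\<^sup>2" by (simp add: algebra_simps power2_eq_square)
    then have xz: "?x * ?z > 0" by (smt (verit) zero_le_power2)
    have "real (Suc (Suc k)) * (?x * ?z) \<le> real (Suc k) * ?y\<^sup>2"
      using newton_inequality(1)[of ?T k l] assms(1) by simp
    also have "\<dots> \<le> real (Suc k) * (?x * ?z)" using lt by (intro mult_left_mono) auto
    finally have "?x * ?z \<le> 0" by (simp add: algebra_simps)
    with xz show False by simp
  qed
qed

section \<open>The spectral theorem\<close>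

lemma symmetric_matrix_inner:
  fixes A :: "real^'n^'n"
  assumes "transpose A = A"
  shows "x \<bullet> (A *v y) = (A *v x) \<bullet> y"
  by (metis assms dot_lmul_matrix transpose_matrix_vector)

text \<open>First-order condition for a quadratic minimum; it replaces differentiation of the Rayleigh quotient.\<close>

lemma linear_coefficient_eq_0:
  fixes a c :: real
  assumes "\<And>t. 0 \<le> t * a + t\<^sup>2 * c"
  shows "a = 0"
proof (rule ccontr)
  assume a: "a \<noteq> 0"
  \<comment> \<open>At \<open>t = - a / m\<close> the linear term is \<open>- a\<^sup>2 / m\<close> and outweighs the quadratic one because \<open>c < m\<close>.\<close>
  define m where "m = \<bar>c\<bar> + 1"
  have m: "m > 0" "c < m" unfolding m_def by linarith+
  have "(- a / m) * a + (- a / m)\<^sup>2 * c = (a\<^sup>2 / m\<^sup>2) * (c - m)"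
    using m by (simp add: field_simps power2_eq_square)
  also have "\<dots> < 0" using a m by (intro mult_pos_neg) auto
  finally show False using assms[of "- a / m"] by linarith
qed

text \<open>A maximizer \<open>x\<close> of \<open>y \<bullet> A y\<close> on the unit sphere of \<open>S\<close>, with maximum \<open>\<mu>\<close>, is an eigenvector: the form
  \<open>\<mu> \<bar>y\<bar>\<^sup>2 - y \<bullet> A y\<close> is nonnegative on \<open>S\<close> and vanishes at \<open>x\<close>, hence is stationary there.  The orthogonal
  complement of \<open>x\<close> in \<open>S\<close> is invariant again and has smaller dimension.\<close>

lemma invariant_subspace_orthonormal_eigenvectors:
  fixes A :: "real^'n^'n"
  assumes A: "transpose A = A"
    and "subspace S" "\<And>x. x \<in> S \<Longrightarrow> A *v x \<in> S"
  shows "\<exists>B. finite B \<and> card B = dim S \<and> B \<subseteq> S \<and> pairwise orthogonal B \<and>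
    (\<forall>b\<in>B. norm b = 1 \<and> (\<exists>\<mu>. A *v b = \<mu> *\<^sub>R b))"
  using assms(2,3)
proof (induction "dim S" arbitrary: S)
  case 0
  then show ?case by (intro exI[of _ "{}"]) simp
next
  case (Suc m)
  let ?K = "S \<inter> sphere 0 1"
  have "compact ?K"
    using Suc.prems(1) by (intro closed_Int_compact closed_subspace) simp_all
  moreover have "?K \<noteq> {}"
  proof -
    have "\<not> S \<subseteq> {0}" using Suc.hyps(2) by (metis dim_eq_0 nat.distinct(1))
    then obtain y where "y \<in> S" "y \<noteq> 0" by blast
    then have "(1 / norm y) *\<^sub>R y \<in> ?K" using Suc.prems(1) by (simp add: subspace_scale)
    then show ?thesis by blast
  qed
  moreover have "continuous_on ?K (\<lambda>x. x \<bullet> (A *v x))"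
    by (intro continuous_intros matrix_vector_mult_linear_continuous_on)
  ultimately obtain x where x: "x \<in> ?K" and max: "\<And>y. y \<in> ?K \<Longrightarrow> y \<bullet> (A *v y) \<le> x \<bullet> (A *v x)"
    using continuous_attains_sup[of ?K "\<lambda>x. x \<bullet> (A *v x)"] by blast
  define \<mu> where "\<mu> = x \<bullet> (A *v x)"
  have xS: "x \<in> S" and nx: "norm x = 1" using x by auto
  then have xx: "x \<bullet> x = 1" by (simp add: dot_square_norm)
  define r where "r = \<mu> *\<^sub>R x - A *v x"
  have rS: "r \<in> S" unfolding r_def using xS Suc.prems by (simp add: subspace_diff subspace_scale)
  have quad: "0 \<le> \<mu> * (y \<bullet> y) - y \<bullet> (A *v y)" if "y \<in> S" for y
  proof (cases "y = 0")
    case False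
    let ?z = "(1 / norm y) *\<^sub>R y"
    have "?z \<in> ?K" using that False Suc.prems(1) by (simp add: subspace_scale)
    from max[OF this] have "(1 / norm y)\<^sup>2 * (y \<bullet> (A *v y)) \<le> \<mu>"
      by (simp add: \<mu>_def matrix_vector_mult_scaleR power2_eq_square)
    then show ?thesis using False
      by (simp add: field_simps power2_norm_eq_inner[symmetric])
  qed simp
  have "r = 0"
  proof -
    have poly: "0 \<le> t * (2 * (r \<bullet> r)) + t\<^sup>2 * (\<mu> * (r \<bullet> r) - r \<bullet> (A *v r))" for t
    proof -
      have "x + t *\<^sub>R r \<in> S" using xS rS Suc.prems(1) by (simp add: subspace_add subspace_scale)
      note q = quad[OF this]
      have sym: "x \<bullet> (A *v r) = r \<bullet> (A *v x)"
        using symmetric_matrix_inner[OF A, of x r] by (simp add: inner_commute)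
      have 1: "(x + t *\<^sub>R r) \<bullet> (x + t *\<^sub>R r) = 1 + 2 * t * (r \<bullet> x) + t\<^sup>2 * (r \<bullet> r)"
        using xx by (simp add: inner_add_left inner_add_right inner_commute power2_eq_square)
      have "A *v (x + t *\<^sub>R r) = A *v x + t *\<^sub>R (A *v r)"
        by (simp add: matrix_vector_right_distrib matrix_vector_mult_scaleR)
      then have 2: "(x + t *\<^sub>R r) \<bullet> (A *v (x + t *\<^sub>R r))
          = \<mu> + 2 * t * (r \<bullet> (A *v x)) + t\<^sup>2 * (r \<bullet> (A *v r))"
        by (simp add: inner_add_left inner_add_right sym \<mu>_def power2_eq_square algebra_simps)
      have 3: "r \<bullet> r = \<mu> * (r \<bullet> x) - r \<bullet> (A *v x)"
        by (subst (2) r_def) (simp add: inner_diff_right)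
      have "\<mu> * (1 + 2 * t * (r \<bullet> x) + t\<^sup>2 * (r \<bullet> r))
          - (\<mu> + 2 * t * (r \<bullet> (A *v x)) + t\<^sup>2 * (r \<bullet> (A *v r)))
        = t * (2 * (\<mu> * (r \<bullet> x) - r \<bullet> (A *v x))) + t\<^sup>2 * (\<mu> * (r \<bullet> r) - r \<bullet> (A *v r))"
        by (simp add: algebra_simps)
      then show ?thesis using q unfolding 1 2 3[symmetric] by simp
    qed
    have "2 * (r \<bullet> r) = 0"
      by (rule linear_coefficient_eq_0) (use poly in blast)
    then show ?thesis by simp
  qed
  then have eig: "A *v x = \<mu> *\<^sub>R x" by (simp add: r_def)
  define S' where "S' = {y \<in> S. \<forall>z\<in>span {x}. orthogonal z y}"
  have S'_iff: "y \<in> S' \<longleftrightarrow> y \<in> S \<and> orthogonal x y" for y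
    unfolding S'_def by (auto simp: span_singleton orthogonal_def dest: spec[of _ "1::real"])
  have "span {x} \<subseteq> S" using xS Suc.prems(1) by (simp add: span_minimal)
  then have "dim S' + dim (span {x}) = dim S"
    unfolding S'_def by (intro dim_subspace_orthogonal_to_vectors Suc.prems(1) subspace_span)
  moreover have "dim (span {x}) = 1" using nx by (subst dim_span) (auto simp: dim_singleton)
  ultimately have dim: "m = dim S'" using Suc.hyps(2) by simp
  have sub: "subspace S'"
    using Suc.prems(1) by (auto simp: subspace_def S'_iff orthogonal_clauses)
  have inv: "A *v y \<in> S'" if "y \<in> S'" for y
    using that Suc.prems(2) eig symmetric_matrix_inner[OF A, of x y]
    by (auto simp: S'_iff orthogonal_def)
  obtain B where B: "finite B" "card B = dim S'" "B \<subseteq> S'" "pairwise orthogonal B"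
    "\<forall>b\<in>B. norm b = 1 \<and> (\<exists>\<mu>. A *v b = \<mu> *\<^sub>R b)"
    using Suc.hyps(1)[OF dim sub inv] by blast
  have xB: "x \<notin> B"
  proof
    assume "x \<in> B"
    then have "x \<bullet> x = 0" using B(3) S'_iff orthogonal_def by blast
    with xx show False by simp
  qed
  show ?case
  proof (intro exI[of _ "insert x B"] conjI)
    show "pairwise orthogonal (insert x B)"
      using B(3,4) S'_iff by (auto simp: pairwise_insert orthogonal_commute)
    show "insert x B \<subseteq> S" using B(3) xS S'_iff by auto
    show "card (insert x B) = dim S" using B(1,2) xB dim Suc.hyps(2) by simp
  qed (use B nx eig in auto)
qed

definition orthonormal :: "('n::finite \<Rightarrow> real^'n) \<Rightarrow> bool" where
  "orthonormal f \<longleftrightarrow> (\<forall>i j. f i \<bullet> f j = (if i = j then 1 else 0))"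

theorem spectral_theorem:
  fixes A :: "real^'n^'n"
  assumes A: "transpose A = A"
  obtains f d where "orthonormal f" "\<And>i. A *v f i = d i *\<^sub>R f i"
proof -
  obtain B :: "(real^'n) set" where B: "finite B" "card B = dim (UNIV :: (real^'n) set)"
    "pairwise orthogonal B" "\<forall>b\<in>B. norm b = 1 \<and> (\<exists>\<mu>. A *v b = \<mu> *\<^sub>R b)"
    using invariant_subspace_orthonormal_eigenvectors[OF A, of UNIV] by auto
  then have "card B = card (UNIV :: 'n set)" by (simp add: dim_UNIV)
  then obtain f :: "'n \<Rightarrow> real^'n" where f: "bij_betw f UNIV B"
    using B(1) by (metis finite_class.finite_UNIV finite_same_card_bij)
  obtain g where g: "\<forall>b\<in>B. A *v b = g b *\<^sub>R b" using B(4) by metis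
  have fB: "f i \<in> B" for i using f by (auto simp: bij_betw_def)
  have "orthonormal f"
    unfolding orthonormal_def
  proof (intro allI)
    fix i j
    show "f i \<bullet> f j = (if i = j then 1 else 0)"
    proof (cases "i = j")
      case True
      then show ?thesis using B(4) fB by (simp add: dot_square_norm)
    next
      case False
      then have "f i \<noteq> f j" using f by (auto simp: bij_betw_def inj_on_def)
      then show ?thesis using False B(3) fB by (auto simp: pairwise_def orthogonal_def)
    qed
  qed
  then show thesis using that[of f "g \<circ> f"] g fB by simp
qed

lemma orthonormal_matrix:
  fixes f :: "'n::finite \<Rightarrow> real^'n"
  assumes "orthonormal f"
  defines "Q \<equiv> \<chi> i j. f j $ i"
  shows "transpose Q ** Q = mat 1" "Q ** transpose Q = mat 1"
    "\<And>M. transpose Q ** M ** Q = (\<chi> i j. f i \<bullet> (M *v f j))"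
proof -
  have entry: "(transpose Q ** M ** Q) $ i $ j = f i \<bullet> (M *v f j)" for M i j
    unfolding matrix_mul_assoc[symmetric]
    by (simp only: matrix_matrix_mult_def matrix_vector_mult_def transpose_def Q_def inner_vec_def
        vec_lambda_beta inner_real_def)
  then show "transpose Q ** M ** Q = (\<chi> i j. f i \<bullet> (M *v f j))" for M
    by (simp add: vec_eq_iff)
  have "(transpose Q ** Q) $ i $ j = mat 1 $ i $ j" for i j
  proof -
    have "(transpose Q ** Q) $ i $ j = f i \<bullet> f j" using entry[of "mat 1" i j] by simp
    then show ?thesis using assms(1) unfolding orthonormal_def by (simp add: mat_def)
  qed
  then show 1: "transpose Q ** Q = mat 1" by (simp only: vec_eq_iff) blast
  then show "Q ** transpose Q = mat 1" using matrix_left_right_inverse by blast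
qed

lemma det_orthonormal_basis:
  fixes f :: "'n::finite \<Rightarrow> real^'n"
  assumes "orthonormal f"
  shows "det M = det (\<chi> i j. f i \<bullet> (M *v f j))"
proof -
  let ?Q = "(\<chi> i j. f j $ i) :: real^'n^'n"
  have "det (transpose ?Q) * det ?Q = 1"
    using orthonormal_matrix(1)[OF assms] by (metis det_I det_mul)
  then have "det (transpose ?Q ** M ** ?Q) = det M"
    by (simp add: det_mul mult.commute mult.left_commute mult.assoc[symmetric])
  then show ?thesis using orthonormal_matrix(3)[OF assms, of M] by simp
qed

section \<open>Rank-one perturbations and the monotonicity of sigma_k\<close>

lemma det_diagonal_entries:
  "det ((\<chi> i j. if i = j then d i else 0) :: real^'n^'n) = (\<Prod>i\<in>UNIV. d i)"
  by (subst det_diagonal) auto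

text \<open>A permutation that fixes every index other than \<open>a\<close> is the identity, so a single term of the Leibniz formula survives.\<close>

lemma det_diagonal_with_row:
  fixes v :: "real^'n"
  shows "det (\<chi> i. if i = a then v else axis i (d i)) = v $ a * (\<Prod>j\<in>UNIV-{a}. d j)"
proof -
  let ?N = "(\<chi> i. if i = a then v else axis i (d i)) :: real^'n^'n"
  have "det ?N = (\<Sum>p\<in>{p. p permutes (UNIV :: 'n set)}.
      of_int (sign p) * (\<Prod>i\<in>UNIV. ?N $ i $ p i))"
    by (simp add: det_def)
  also have "\<dots> = (\<Sum>p\<in>{id}. of_int (sign p) * (\<Prod>i\<in>UNIV. ?N $ i $ p i))"
  proof (rule sum.mono_neutral_right)
    show "\<forall>p\<in>{p. p permutes UNIV} - {id}. of_int (sign p) * (\<Prod>i\<in>UNIV. ?N $ i $ p i) = 0"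
    proof
      fix p assume p: "p \<in> {p. p permutes (UNIV :: 'n set)} - {id}"
      have "\<exists>i. i \<noteq> a \<and> p i \<noteq> i"
      proof (rule ccontr)
        assume "\<not> ?thesis"
        then have fixed: "p i = i" if "i \<noteq> a" for i using that by blast
        have "inj p" using p by (auto simp: permutes_inj)
        then have "p a = a" using fixed by (metis injD)
        then have "p = id" using fixed by (intro ext) (metis id_apply)
        then show False using p by simp
      qed
      then obtain i where "i \<noteq> a" "p i \<noteq> i" by blast
      then have "?N $ i $ p i = 0" by (simp add: axis_def)
      then have "(\<Prod>i\<in>UNIV. ?N $ i $ p i) = 0"
        by (intro prod_zero bexI[of _ i] finite UNIV_I)
      then show "of_int (sign p) * (\<Prod>i\<in>UNIV. ?N $ i $ p i) = 0" by simp
    qed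
  qed (auto simp: permutes_id finite_permutations)
  also have "\<dots> = (\<Prod>i\<in>UNIV. ?N $ i $ i)" by (simp add: sign_id)
  also have "\<dots> = v $ a * (\<Prod>i\<in>UNIV-{a}. ?N $ i $ i)"
    by (subst prod.remove[of _ a]) auto
  also have "(\<Prod>i\<in>UNIV-{a}. ?N $ i $ i) = (\<Prod>j\<in>UNIV-{a}. d j)"
    by (intro prod.cong) (auto simp: axis_def)
  finally show ?thesis .
qed

text \<open>Subtracting multiples of row \<open>a\<close> removes the rank-one part from all other rows.\<close>

lemma det_diagonal_rank_one_with_row:
  fixes v :: "real^'n"
  assumes "finite S" "a \<notin> S"
  shows "det (\<chi> i. if i = a then v else axis i (d i) + (if i \<in> S then u i *s v else 0))
    = v $ a * (\<Prod>j\<in>UNIV-{a}. d j)"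
  using assms
proof (induction S)
  case empty
  then show ?case using det_diagonal_with_row[of a v d] by (simp cong: if_cong)
next
  case (insert b S)
  let ?N = "\<lambda>S. (\<chi> i. if i = a then v else axis i (d i) + (if i \<in> S then u i *s v else 0)) :: real^'n^'n"
  have ab: "a \<noteq> b" using insert by auto
  have "?N (insert b S) = (\<chi> k. if k = b then row b (?N S) + u b *s row a (?N S) else row k (?N S))"
    using insert.hyps ab by (auto simp: vec_eq_iff row_def)
  then have "det (?N (insert b S)) = det (?N S)" using det_row_operation[of b a "?N S" "u b"] ab by simp
  then show ?case using insert by simp
qed

lemma det_diagonal_rank_one_aux:
  fixes v :: "real^'n"
  assumes "finite S"
  shows "det (\<chi> i. axis i (d i) + (if i \<in> S then u i *s v else 0))
    = (\<Prod>i\<in>UNIV. d i) + (\<Sum>i\<in>S. u i * v $ i * (\<Prod>j\<in>UNIV-{i}. d j))"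
  using assms
proof (induction S)
  case empty
  have "(\<chi> i. axis i (d i)) = ((\<chi> i j. if i = j then d i else 0) :: real^'n^'n)"
    by (auto simp: vec_eq_iff axis_def)
  then show ?case using det_diagonal_entries[of d] by simp
next
  case (insert a S)
  let ?N = "\<lambda>S. (\<chi> i. axis i (d i) + (if i \<in> S then u i *s v else 0)) :: real^'n^'n"
  let ?c = "\<lambda>i. axis i (d i) + (if i \<in> S then u i *s v else 0)"
  have "?N (insert a S) = (\<chi> i. if i = a then axis i (d i) + u i *s v else ?c i)"
    by (auto simp: vec_eq_iff)
  then have "det (?N (insert a S)) = det (\<chi> i. if i = a then axis i (d i) else ?c i)
      + det (\<chi> i. if i = a then u i *s v else ?c i)"
    by (simp only: det_row_add)
  also have "(\<chi> i. if i = a then axis i (d i) else ?c i) = ?N S"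
    using insert.hyps by (auto simp: vec_eq_iff)
  also have "det (\<chi> i. if i = a then u i *s v else ?c i) = u a * det (\<chi> i. if i = a then v else ?c i)"
    using det_row_mul[of a "u a" "\<lambda>_. v" ?c] by (simp cong: if_cong)
  also have "det (\<chi> i. if i = a then v else ?c i) = v $ a * (\<Prod>j\<in>UNIV-{a}. d j)"
    using det_diagonal_rank_one_with_row[OF insert.hyps] .
  finally show ?case using insert by simp
qed

text \<open>The matrix determinant lemma, in a form that does not divide by the diagonal entries.  The rank-one
  part is inserted row by row; by multilinearity each row contributes one summand.\<close>

lemma det_diagonal_rank_one:
  "det ((\<chi> i j. (if i = j then d i else 0) + u i * v j) :: real^'n^'n)
    = (\<Prod>i\<in>UNIV. d i) + (\<Sum>i\<in>UNIV. u i * v i * (\<Prod>j\<in>UNIV-{i}. d j))"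
proof -
  have "((\<chi> i j. (if i = j then d i else 0) + u i * v j) :: real^'n^'n)
      = (\<chi> i. axis i (d i) + (if i \<in> UNIV then u i *s (\<chi> j. v j) else 0))"
    by (auto simp: vec_eq_iff axis_def)
  then show ?thesis using det_diagonal_rank_one_aux[of UNIV d u "\<chi> j. v j"] by simp
qed

lemma poly_esym_gen: "poly (esym_gen S l) s = (\<Prod>i\<in>S. 1 + s * l i)"
  by (simp add: esym_gen_def poly_prod)

lemma det_one_plus_eigenvalues:
  fixes A :: "real^'n^'n"
  assumes "is_eigenvalues A l"
  shows "det (mat 1 + s *\<^sub>R A) = poly (esym_gen UNIV l) s"
proof (cases "s = 0")
  case True
  then show ?thesis by (simp add: poly_esym_gen)
next
  case False
  have "mat 1 + s *\<^sub>R A = (\<chi> i. (- s) *s ((mat (- 1 / s) - A) $ i))"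
    using False by (auto simp: vec_eq_iff mat_def)
  then have "det (mat 1 + s *\<^sub>R A) = (\<Prod>i\<in>(UNIV :: 'n set). - s) * det (mat (- 1 / s) - A)"
    using det_rows_mul[of "\<lambda>_. - s" "\<lambda>i. (mat (- 1 / s) - A) $ i"] by (simp only: vec_lambda_eta)
  also have "\<dots> = (\<Prod>i\<in>(UNIV :: 'n set). - s) * (\<Prod>i\<in>UNIV. - 1 / s - l i)"
    using assms by (simp add: is_eigenvalues_def)
  also have "\<dots> = (\<Prod>i\<in>UNIV. 1 + s * l i)"
    unfolding prod.distrib[symmetric] using False by (intro prod.cong) (auto simp: field_simps)
  finally show ?thesis by (simp add: poly_esym_gen)
qed

lemma esym_gen_eqI:
  fixes A :: "real^'n^'n"
  assumes "is_eigenvalues A l" "\<And>s. det (mat 1 + s *\<^sub>R A) = poly p s"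
  shows "esym_gen UNIV l = p"
  using assms det_one_plus_eigenvalues[OF assms(1)]
  by (metis poly_eq_poly_eq_iff ext)

text \<open>Comparing polynomials in \<open>s\<close> makes \<open>sigma\<close> independent of the choice of an enumeration
  of the eigenvalues; it is used to identify \<open>sigma\<close> with coefficients of explicit determinants.\<close>

lemma sigma_eq_coeff:
  assumes "\<exists>l. is_eigenvalues A l" "\<And>s. det (mat 1 + s *\<^sub>R A) = poly p s"
  shows "sigma k A = coeff p k"
  using esym_gen_eqI[OF someI_ex[OF assms(1)] assms(2)]
  by (simp add: sigma_def elem_sym_eq_esym esym_def)

lemma is_eigenvalues_orthonormal:
  fixes A :: "real^'n^'n"
  assumes "orthonormal f" "\<And>i. A *v f i = d i *\<^sub>R f i"
  shows "is_eigenvalues A d"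
  unfolding is_eigenvalues_def
proof
  fix t
  have "mat t *v x = t *\<^sub>R x" for x :: "real^'n"
    by (simp add: vec_eq_iff matrix_vector_mult_def mat_def if_distrib if_distribR cong: if_cong)
  then have "f i \<bullet> ((mat t - A) *v f j) = (if i = j then t - d i else 0)" for i j
    using assms by (simp add: matrix_vector_mult_diff_rdistrib inner_diff_right orthonormal_def)
  then have "(\<chi> i j. f i \<bullet> ((mat t - A) *v f j)) = (\<chi> i j. if i = j then t - d i else 0)"
    by (simp only:)
  then show "det (mat t - A) = (\<Prod>i\<in>UNIV. t - d i)"
    unfolding det_orthonormal_basis[OF assms(1), of "mat t - A"] by (simp only: det_diagonal_entries)
qed

lemma sigma_is_eigenvalues: "is_eigenvalues A l \<Longrightarrow> sigma k A = esym UNIV k l"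
  unfolding esym_def by (rule sigma_eq_coeff) (blast intro: det_one_plus_eigenvalues)+

lemma symmetric_is_eigenvalues:
  assumes "transpose A = A" obtains l where "is_eigenvalues A l"
  using spectral_theorem[OF assms] is_eigenvalues_orthonormal by metis

definition outer :: "real^'n \<Rightarrow> real^'n^'n" where
  "outer u = (\<chi> i j. u $ i * u $ j)"

lemma transpose_outer: "transpose (outer u) = outer u"
  by (simp add: vec_eq_iff transpose_def outer_def mult.commute)

lemma outer_mult: "outer u *v x = (u \<bullet> x) *\<^sub>R u"
  by (simp add: vec_eq_iff matrix_vector_mult_def outer_def inner_vec_def sum_distrib_left mult_ac)

lemma transpose_add: "transpose (A + B) = transpose A + transpose (B :: real^'n^'m)"
  by (simp add: vec_eq_iff transpose_def)

lemma sigma_add_outer: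
  fixes A :: "real^'n^'n"
  assumes A: "transpose A = A" and f: "orthonormal f" "\<And>i. A *v f i = d i *\<^sub>R f i"
  shows "sigma (Suc k) (A + outer u)
    = sigma (Suc k) A + (\<Sum>i\<in>UNIV. (u \<bullet> f i)\<^sup>2 * esym (UNIV - {i}) k d)"
proof -
  let ?p = "esym_gen UNIV d + (\<Sum>i\<in>UNIV. pCons 0 (smult ((u \<bullet> f i)\<^sup>2) (esym_gen (UNIV - {i}) d)))"
  have "det (mat 1 + s *\<^sub>R (A + outer u)) = poly ?p s" for s
  proof -
    have "f i \<bullet> ((mat 1 + s *\<^sub>R (A + outer u)) *v f j)
        = (if i = j then 1 + s * d i else 0) + (s * (u \<bullet> f i)) * (u \<bullet> f j)" for i j
      using f unfolding orthonormal_def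
      by (auto simp: matrix_vector_mult_add_rdistrib scaleR_matrix_vector_assoc[symmetric]
          outer_mult inner_add_right inner_commute algebra_simps)
    then have "(\<chi> i j. f i \<bullet> ((mat 1 + s *\<^sub>R (A + outer u)) *v f j))
      = (\<chi> i j. (if i = j then 1 + s * d i else 0) + (s * (u \<bullet> f i)) * (u \<bullet> f j))"
      by (simp only:)
    then have "det (mat 1 + s *\<^sub>R (A + outer u)) = (\<Prod>i\<in>UNIV. 1 + s * d i)
      + (\<Sum>i\<in>UNIV. s * (u \<bullet> f i) * (u \<bullet> f i) * (\<Prod>j\<in>UNIV-{i}. 1 + s * d j))"
      unfolding det_orthonormal_basis[OF f(1), of "mat 1 + s *\<^sub>R (A + outer u)"]
      by (simp only: det_diagonal_rank_one)
    also have "\<dots> = poly ?p s"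
      by (simp add: poly_esym_gen poly_sum power2_eq_square algebra_simps)
    finally show ?thesis .
  qed
  moreover have "\<exists>l. is_eigenvalues (A + outer u) l"
    using symmetric_is_eigenvalues[of "A + outer u"] A by (metis transpose_add transpose_outer)
  ultimately have "sigma (Suc k) (A + outer u) = coeff ?p (Suc k)"
    by (intro sigma_eq_coeff) auto
  also have "\<dots> = esym UNIV (Suc k) d + (\<Sum>i\<in>UNIV. (u \<bullet> f i)\<^sup>2 * esym (UNIV - {i}) k d)"
    by (simp add: esym_def coeff_sum)
  finally show ?thesis using sigma_is_eigenvalues[OF is_eigenvalues_orthonormal[OF f]] by simp
qed

text \<open>Garding's description of \<open>\<Gamma>\<^sub>k\<^sup>+\<close>.  The index \<open>j = 0\<close> is harmless because \<open>\<sigma>\<^sub>0 = 1\<close>.\<close>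

definition garding_cone :: "nat \<Rightarrow> (real^'n^'n) set" where
  "garding_cone k = {A. transpose A = A \<and> (\<forall>j\<le>k. 0 < sigma j A)}"

lemma garding_cone_add_outer:
  fixes A :: "real^'n^'n"
  assumes "A \<in> garding_cone k"
  shows "A + outer u \<in> garding_cone k \<and> sigma k A \<le> sigma k (A + outer u)"
proof -
  have A: "transpose A = A" and pos: "\<And>j. j \<le> k \<Longrightarrow> 0 < sigma j A"
    using assms by (auto simp: garding_cone_def)
  obtain f d where f: "orthonormal f" "\<And>i. A *v f i = d i *\<^sub>R f i"
    using spectral_theorem[OF A] by blast
  have e: "sigma j A = esym UNIV j d" for j
    using sigma_is_eigenvalues[OF is_eigenvalues_orthonormal[OF f]] .
  have T: "transpose (A + outer u) = A + outer u" using A by (simp add: transpose_add transpose_outer)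
  have mono: "sigma j A \<le> sigma j (A + outer u)" if "j \<le> k" for j
  proof (cases j)
    case 0
    obtain l where "is_eigenvalues (A + outer u) l" using symmetric_is_eigenvalues[OF T] .
    then show ?thesis using 0 e sigma_is_eigenvalues[of "A + outer u" l 0] by simp
  next
    case (Suc m)
    have "0 < esym (UNIV - {i}) m d" for i
      using pos Suc that e by (intro esym_remove_pos) auto
    then have "0 \<le> (\<Sum>i\<in>UNIV. (u \<bullet> f i)\<^sup>2 * esym (UNIV - {i}) m d)"
      by (intro sum_nonneg mult_nonneg_nonneg) (auto intro: less_imp_le)
    then show ?thesis using sigma_add_outer[OF A f] Suc by simp
  qed
  then show ?thesis using T pos by (force simp: garding_cone_def)
qed

lemma psd_sum_outer:
  fixes P :: "real^'n^'n"
  assumes P: "transpose P = P" and psd: "\<And>v. 0 \<le> v \<bullet> (P *v v)"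
  obtains g :: "'n \<Rightarrow> real^'n" where "P = (\<Sum>i\<in>UNIV. outer (g i))"
proof -
  obtain f d where f: "orthonormal f" "\<And>i. P *v f i = d i *\<^sub>R f i"
    using spectral_theorem[OF P] by blast
  have d: "0 \<le> d i" for i
    using psd[of "f i"] f by (simp add: orthonormal_def)
  let ?Q = "(\<chi> i j. f j $ i) :: real^'n^'n"
  let ?D = "(\<chi> i j. if i = j then d i else 0) :: real^'n^'n"
  have D: "transpose ?Q ** P ** ?Q = ?D"
  proof -
    have "f i \<bullet> (P *v f j) = (if i = j then d i else 0)" for i j
      using f by (auto simp: orthonormal_def)
    then show ?thesis unfolding orthonormal_matrix(3)[OF f(1)] by (simp only:)
  qed
  have "?Q ** (transpose ?Q ** P ** ?Q) ** transpose ?Q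
      = (?Q ** transpose ?Q) ** P ** (?Q ** transpose ?Q)"
    by (simp only: matrix_mul_assoc)
  then have P: "P = ?Q ** ?D ** transpose ?Q"
    by (simp only: D orthonormal_matrix(2)[OF f(1)] matrix_mul_lid matrix_mul_rid)
  have "P = (\<Sum>i\<in>UNIV. outer (sqrt (d i) *\<^sub>R f i))"
  proof (intro vec_eq_iff[THEN iffD2] allI)
    fix a b
    have "P $ a $ b = (?Q ** ?D ** transpose ?Q) $ a $ b" by (simp only: P[symmetric])
    also have "(?Q ** ?D ** transpose ?Q) $ a $ b = (\<Sum>k\<in>UNIV. f k $ a * d k * f k $ b)"
      by (simp add: matrix_matrix_mult_def transpose_def if_distrib sum.delta cong: if_cong)
    also have "\<dots> = (\<Sum>i\<in>UNIV. outer (sqrt (d i) *\<^sub>R f i)) $ a $ b"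
      unfolding sum_component
    proof (rule sum.cong)
      fix k
      have "f k $ a * d k * f k $ b = (sqrt (d k) * sqrt (d k)) * (f k $ a * f k $ b)"
        using d[of k] by simp
      also have "\<dots> = outer (sqrt (d k) *\<^sub>R f k) $ a $ b"
        unfolding outer_def by (simp only: vec_lambda_beta vector_scaleR_component real_scaleR_def mult_ac)
      finally show "f k $ a * d k * f k $ b = outer (sqrt (d k) *\<^sub>R f k) $ a $ b" .
    qed simp
    finally show "P $ a $ b = (\<Sum>i\<in>UNIV. outer (sqrt (d i) *\<^sub>R f i)) $ a $ b" .
  qed
  then show thesis by (rule that)
qed

text \<open>Adding the rank-one summands of \<open>B - A\<close> one after the other never leaves the cone, and each of them does not decrease
  \<open>\<sigma>\<^sub>k\<close>.\<close>

proposition sigma_mono_garding_cone: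
  fixes A B :: "real^'n^'n"
  assumes A: "A \<in> garding_cone k" and B: "transpose B = B"
    and psd: "\<And>v. 0 \<le> v \<bullet> ((B - A) *v v)"
  shows "sigma k A \<le> sigma k B"
proof -
  have "transpose (B - A) = B - A"
    using A B by (simp add: garding_cone_def vec_eq_iff transpose_def)
  then obtain g :: "'n \<Rightarrow> real^'n" where g: "B - A = (\<Sum>i\<in>UNIV. outer (g i))"
    using psd_sum_outer psd by blast
  have "A + (\<Sum>i\<in>S. outer (g i)) \<in> garding_cone k \<and> sigma k A \<le> sigma k (A + (\<Sum>i\<in>S. outer (g i)))"
    if "finite S" for S
    using that
  proof (induction S)
    case empty
    then show ?case using A by simp
  next
    case (insert i S)
    then show ?case
      using garding_cone_add_outer[of "A + (\<Sum>i\<in>S. outer (g i))" k "g i"] by (simp add: ac_simps)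
  qed
  from this[of UNIV] show ?thesis using g[symmetric] by simp
qed

section \<open>The cone of the sigma_k-Ricci problem lies in the Garding cone\<close>

text \<open>Lagrange interpolation at \<open>0, \<dots>, n\<close>: coefficients are fixed linear combinations of values.  This is how
  continuity of \<open>\<sigma>\<^sub>k\<close> is derived from continuity of determinants.\<close>

lemma coeff_interpolation:
  "\<exists>\<alpha> :: nat \<Rightarrow> nat \<Rightarrow> real. \<forall>p. degree p \<le> n \<longrightarrow>
    (\<forall>k. coeff p k = (\<Sum>i\<le>n. \<alpha> i k * poly p (real i)))"
proof -
  define N where "N i = (\<Prod>j\<in>{..n}-{i}. [:- real j, 1:])" for i
  define L where "L i = smult (1 / poly (N i) (real i)) (N i)" for i
  have N: "poly (N i) (real m) = 0 \<longleftrightarrow> m \<noteq> i" if "m \<le> n" for i m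
    using that unfolding N_def poly_prod by auto
  have degL: "degree (L i) \<le> n" if "i \<le> n" for i
  proof -
    have "degree (N i) \<le> (\<Sum>j\<in>{..n}-{i}. degree [:- real j, 1:])"
      unfolding N_def by (intro degree_prod_sum_le[THEN order_trans]) (auto simp: o_def)
    also have "\<dots> = n" using that by simp
    finally show ?thesis unfolding L_def by simp
  qed
  have "coeff p k = (\<Sum>i\<le>n. coeff (L i) k * poly p (real i))" if p: "degree p \<le> n" for p k
  proof -
    define q where "q = (\<Sum>i\<le>n. smult (poly p (real i)) (L i))"
    have "p = q"
    proof (rule poly_eqI_degree[of "real ` {..n}"])
      fix x assume "x \<in> real ` {..n}"
      then obtain m where m: "m \<le> n" "x = real m" by auto
      have "poly q x = (\<Sum>i\<le>n. if i = m then poly p (real i) else 0)"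
        unfolding q_def poly_sum L_def using N[OF m(1)] m
        by (intro sum.cong) auto
      also have "\<dots> = poly p x" using m by simp
      finally show "poly p x = poly q x" ..
    next
      have c: "card (real ` {..n}) = Suc n" by (simp add: card_image)
      show "degree p < card (real ` {..n})" using p c by simp
      have "degree q \<le> n" unfolding q_def
        by (intro degree_sum_le) (auto intro: order_trans[OF degree_smult_le] degL)
      then show "degree q < card (real ` {..n})" using c by simp
    qed
    then have "coeff p k = coeff q k" by simp
    also have "\<dots> = (\<Sum>i\<le>n. coeff (L i) k * poly p (real i))"
      unfolding q_def by (simp add: coeff_sum mult.commute)
    finally show ?thesis .
  qed
  then show ?thesis by (intro exI[of _ "\<lambda>i k. coeff (L i) k"]) blast
qed

lemma continuous_on_sigma: "continuous_on {A :: real^'n^'n. transpose A = A} (sigma k)"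
proof -
  obtain \<alpha> :: "nat \<Rightarrow> nat \<Rightarrow> real" where
    \<alpha>: "\<And>p k. degree p \<le> CARD('n) \<Longrightarrow> coeff p k = (\<Sum>i\<le>CARD('n). \<alpha> i k * poly p (real i))"
    using coeff_interpolation by metis
  have "sigma k A = (\<Sum>i\<le>CARD('n). \<alpha> i k * det (mat 1 + real i *\<^sub>R A))"
    if A: "transpose A = A" for A :: "real^'n^'n"
  proof -
    obtain l where l: "is_eigenvalues A l" using symmetric_is_eigenvalues[OF A] .
    have "degree (esym_gen UNIV l) \<le> (\<Sum>i\<in>(UNIV :: 'n set). degree [:1, l i:])"
      unfolding esym_gen_def by (intro degree_prod_sum_le[THEN order_trans]) (auto simp: o_def)
    also have "\<dots> \<le> (\<Sum>i\<in>(UNIV :: 'n set). 1)" by (intro sum_mono) simp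
    finally have "degree (esym_gen UNIV l) \<le> CARD('n)" by simp
    from \<alpha>[OF this, of k] show ?thesis
      by (simp add: sigma_is_eigenvalues[OF l] esym_def det_one_plus_eigenvalues[OF l])
  qed
  moreover have "continuous_on S (\<lambda>A. \<Sum>i\<le>CARD('n). \<alpha> i k * det (mat 1 + real i *\<^sub>R A))"
    for S :: "(real^'n^'n) set"
    unfolding det_def by (intro continuous_intros)
  ultimately show ?thesis by (subst continuous_on_cong[OF refl]) auto
qed

lemma sigma_scaleR:
  fixes A :: "real^'n^'n"
  assumes "transpose A = A"
  shows "sigma k (c *\<^sub>R A) = c ^ k * sigma k A"
proof -
  obtain f d where f: "orthonormal f" "\<And>i. A *v f i = d i *\<^sub>R f i"
    using spectral_theorem[OF assms] by blast
  have "(c *\<^sub>R A) *v f i = (c * d i) *\<^sub>R f i" for i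
    using f(2) by (simp add: scaleR_matrix_vector_assoc[symmetric])
  then have "is_eigenvalues (c *\<^sub>R A) (\<lambda>i. c * d i)" by (intro is_eigenvalues_orthonormal[OF f(1)])
  then have "sigma k (c *\<^sub>R A) = elem_sym k (\<lambda>i. c * d i)"
    by (simp add: sigma_is_eigenvalues elem_sym_eq_esym)
  also have "\<dots> = (\<Sum>I | card I = k. c ^ k * (\<Prod>i\<in>I. d i))"
    unfolding elem_sym_def by (intro sum.cong) (auto simp: prod.distrib)
  also have "\<dots> = c ^ k * sigma k A"
    by (simp add: sigma_is_eigenvalues[OF is_eigenvalues_orthonormal[OF f]]
        elem_sym_eq_esym[symmetric] elem_sym_def sum_distrib_left)
  finally show ?thesis .
qed

lemma sigma_mat_1: "sigma k (mat 1 :: real^'n^'n) = real (CARD('n) choose k)"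
proof -
  have "is_eigenvalues (mat 1 :: real^'n^'n) (\<lambda>_. 1)"
    unfolding is_eigenvalues_def
  proof
    fix t :: real
    have "mat t - mat 1 = ((\<chi> i j. if i = j then t - 1 else 0) :: real^'n^'n)"
      by (auto simp: vec_eq_iff mat_def)
    then show "det (mat t - mat 1 :: real^'n^'n) = (\<Prod>i\<in>(UNIV :: 'n set). t - 1)"
      by (simp only: det_diagonal_entries)
  qed
  then have "sigma k (mat 1 :: real^'n^'n) = elem_sym k (\<lambda>_ :: 'n. 1)"
    by (simp add: sigma_is_eigenvalues elem_sym_eq_esym)
  also have "\<dots> = real (card {I :: 'n set. card I = k})" by (simp add: elem_sym_def)
  also have "card {I :: 'n set. card I = k} = CARD('n) choose k"
    using n_subsets[of "UNIV :: 'n set" k] by simp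
  finally show ?thesis .
qed

lemma transpose_mat_1: "transpose (c *\<^sub>R mat 1) = (c *\<^sub>R mat 1 :: real^'n^'n)"
  by (auto simp: vec_eq_iff transpose_def mat_def)

lemma sigma_scalar: "sigma k (c *\<^sub>R mat 1 :: real^'n^'n) = c ^ k * real (CARD('n) choose k)"
  using sigma_scaleR[of "mat 1 :: real^'n^'n" k c] transpose_mat_1[of 1] by (simp add: sigma_mat_1)

lemma scalar_garding_cone:
  assumes "0 < c" "k \<le> CARD('n)"
  shows "(c *\<^sub>R mat 1 :: real^'n^'n) \<in> garding_cone k"
  using assms by (simp add: garding_cone_def transpose_mat_1 sigma_scalar)

lemma garding_cone_scaleR: "A \<in> garding_cone k \<Longrightarrow> 0 < c \<Longrightarrow> c *\<^sub>R A \<in> garding_cone k"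
  by (auto simp: garding_cone_def sigma_scaleR transpose_def vec_eq_iff)

lemma garding_cone_if_sigma_nonneg:
  fixes A :: "real^'n^'n"
  assumes A: "transpose A = A" and "\<And>j. j \<le> k \<Longrightarrow> 0 \<le> sigma j A" "0 < sigma k A"
  shows "A \<in> garding_cone k"
proof -
  obtain l where l: "is_eigenvalues A l" using symmetric_is_eigenvalues[OF A] .
  have "0 < esym UNIV j l" if "j \<le> k" for j
    using assms(2,3) that unfolding sigma_is_eigenvalues[OF l]
    by - (rule esym_pos_if_nonneg[of UNIV k], auto)
  then show ?thesis using A by (simp add: garding_cone_def sigma_is_eigenvalues[OF l])
qed

text \<open>Within the component that contains the positive cone, the points of the Garding cone form a set that is open, since the
  \<open>\<sigma>\<^sub>j\<close> are continuous, and closed, since \<open>\<sigma>\<^sub>j \<ge> 0\<close> for \<open>j < k\<close> together with \<open>\<sigma>\<^sub>k > 0\<close> already forces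
  \<open>\<sigma>\<^sub>j > 0\<close> (\<open>esym_pos_if_nonneg\<close>).  It contains the identity, so it is the whole component.  The factor \<open>c\<close> in
  the Gram matrix is the conformal factor at a point; it changes neither self-adjointness nor positivity.\<close>

proposition Gamma_plus_subset_garding_cone:
  assumes c: "0 < c" and k: "k \<le> CARD('n)"
  shows "Gamma_plus k (c *\<^sub>R mat 1 :: real^'n^'n) \<subseteq> garding_cone k"
proof
  fix A :: "real^'n^'n"
  let ?H = "c *\<^sub>R mat 1 :: real^'n^'n"
  let ?S = "{A \<in> self_adjoint_wrt ?H. 0 < sigma k A}"
  assume "A \<in> Gamma_plus k ?H"
  then obtain C where C: "C \<in> components ?S" "positive_cone ?H \<subseteq> C" "A \<in> C"
    unfolding Gamma_plus_def by blast
  have HB: "?H ** B = c *\<^sub>R B" for B :: "real^'n^'n"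
    by (simp add: vec_eq_iff matrix_matrix_mult_def mat_def if_distrib if_distribR sum.delta cong: if_cong)
  have sym: "self_adjoint_wrt ?H = {B. transpose B = B}"
    using c unfolding self_adjoint_wrt_def HB by (auto simp: vec_eq_iff transpose_def)
  have CS: "C \<subseteq> {B. transpose B = B}" and Cpos: "\<And>B. B \<in> C \<Longrightarrow> 0 < sigma k B"
    using in_components_subset[OF C(1)] sym by auto
  have cont: "continuous_on C (sigma j)" for j
    using continuous_on_subset[OF continuous_on_sigma CS] .
  let ?T = "C \<inter> garding_cone k"
  have T_open: "?T = (\<Inter>j\<in>{..k}. C \<inter> sigma j -` {0<..})"
    using CS by (auto simp: garding_cone_def)
  have T_closed: "?T = (\<Inter>j\<in>{..k}. C \<inter> sigma j -` {0..})"
  proof -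
    have "B \<in> garding_cone k" if "B \<in> C" "\<And>j. j \<le> k \<Longrightarrow> 0 \<le> sigma j B" for B
      using that CS Cpos by (intro garding_cone_if_sigma_nonneg) auto
    then show ?thesis by (auto simp: garding_cone_def intro: less_imp_le)
  qed
  have "openin (top_of_set C) ?T"
    unfolding T_open
    by (rule openin_INT2) (auto intro!: continuous_openin_preimage_gen cont)
  moreover have "closedin (top_of_set C) ?T"
    unfolding T_closed
    by (intro closedin_INT continuous_closedin_preimage cont) auto
  moreover have "(mat 1 :: real^'n^'n) \<in> ?T"
  proof
    have "?H ** (mat 1 :: real^'n^'n) = ?H" by simp
    moreover have "0 < v \<bullet> (?H *v v)" if "v \<noteq> 0" for v
      using that c by (simp add: scaleR_matrix_vector_assoc[symmetric])
    ultimately have "(mat 1 :: real^'n^'n) \<in> positive_cone ?H"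
      unfolding positive_cone_def self_adjoint_wrt_def by (simp add: transpose_mat_1)
    then show "(mat 1 :: real^'n^'n) \<in> C" using C(2) by blast
    show "(mat 1 :: real^'n^'n) \<in> garding_cone k" using scalar_garding_cone[where 'n = 'n, of 1 k] k by simp
  qed
  moreover have "connected C" using in_components_connected[OF C(1)] .
  ultimately have "?T = C" unfolding connected_clopen by blast
  then show "A \<in> garding_cone k" using C(3) by blast
qed

section \<open>Partial derivatives of smooth functions\<close>

lemma partialI: "(f has_derivative D) (at x) \<Longrightarrow> partial i f x = D (axis i 1)"
  unfolding partial_def using frechet_derivative_at by metis

lemma frechet_derivative_cong_open:
  assumes "open U" "x \<in> U" "\<And>y. y \<in> U \<Longrightarrow> f y = g y"
  shows "frechet_derivative f (at x) = frechet_derivative g (at x)"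
proof -
  have "(f has_derivative D) (at x) \<longleftrightarrow> (g has_derivative D) (at x)" for D
    using has_derivative_transform_within_open[of f D x UNIV U g]
      has_derivative_transform_within_open[of g D x UNIV U f] assms by auto
  then show ?thesis unfolding frechet_derivative_def by simp
qed

lemma partial_cong_open:
  "\<lbrakk>open U; x \<in> U; \<And>y. y \<in> U \<Longrightarrow> f y = g y\<rbrakk> \<Longrightarrow> partial i f x = partial i g x"
  unfolding partial_def using frechet_derivative_cong_open by metis

lemma differentiable_cong_open:
  "\<lbrakk>f differentiable (at x); open U; x \<in> U; \<And>y. y \<in> U \<Longrightarrow> f y = g y\<rbrakk> \<Longrightarrow> g differentiable (at x)"
  unfolding differentiable_def using has_derivative_transform_within_open[of f _ x UNIV U g] by blast

text \<open>This is weaker than \<open>C\<^sup>2\<close>: the gradient has a derivative at every point, which gives a Hessian but not its continuity.\<close>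

definition twice_differentiable_on :: "(real^'n) set \<Rightarrow> (real^'n \<Rightarrow> real) \<Rightarrow> bool" where
  "twice_differentiable_on U f \<longleftrightarrow>
     (\<forall>x\<in>U. f differentiable (at x) \<and> (\<forall>i. partial i f differentiable (at x)))"

lemma smooth_on_imp_twice_differentiable_on:
  fixes f :: "real^'n \<Rightarrow> real"
  assumes "open U" "smooth_on S f" "U \<subseteq> S"
  shows "twice_differentiable_on U f"
  unfolding twice_differentiable_on_def
proof (intro ballI conjI allI)
  fix x i assume x: "x \<in> U"
  then obtain V F where V: "open V" "x \<in> V" and F: "\<And>m. Ck_on m V F"
    and eq: "\<And>y. y \<in> S \<inter> V \<Longrightarrow> F y = f y"
    using assms(2,3) unfolding smooth_on_def by (metis subsetD)
  let ?W = "U \<inter> V"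
  have W: "open ?W" "x \<in> ?W" using assms(1) V x by auto
  have eqW: "F y = f y" if "y \<in> ?W" for y using eq that assms(3) by blast
  have "F differentiable (at x)" using F[of 1] V(2) by simp
  then show "f differentiable (at x)" using differentiable_cong_open[OF _ W] eqW by blast
  have "Ck_on 1 V (\<lambda>y. frechet_derivative F (at y) (axis i 1))"
    using F[of "Suc 1"] by simp
  then have "partial i F differentiable (at x)" using V(2) by (simp add: partial_def[abs_def])
  moreover have "partial i F y = partial i f y" if "y \<in> ?W" for y
    using partial_cong_open[OF W(1) that eqW] .
  ultimately show "partial i f differentiable (at x)" using differentiable_cong_open[OF _ W] by blast
qed

lemma smooth_on_imp_continuous_on:
  assumes "smooth_on S f"
  shows "continuous_on S f"
  unfolding continuous_on_def
proof
  fix x assume x: "x \<in> S"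
  then obtain U F where U: "open U" "x \<in> U" and F: "Ck_on 0 U F" and eq: "\<And>y. y \<in> S \<inter> U \<Longrightarrow> F y = f y"
    using assms unfolding smooth_on_def by meson
  have "isCont F x" using F U by (simp add: continuous_on_eq_continuous_at)
  then have "(F \<longlongrightarrow> F x) (at x within S)"
    by (metis continuous_at_imp_continuous_at_within continuous_within)
  moreover have "F x = f x" using eq x U by blast
  moreover have "\<forall>\<^sub>F y in at x within S. F y = f y"
    using eventually_at_topological U eq by (metis (mono_tags, lifting) IntI)
  ultimately show "(f \<longlongrightarrow> f x) (at x within S)" by (metis tendsto_cong)
qed

lemma smooth_on_subset:
  assumes "smooth_on S f" "T \<subseteq> S"
  shows "smooth_on T f"
  unfolding smooth_on_def
proof
  fix x assume "x \<in> T"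
  then have "x \<in> S" using assms(2) by blast
  then obtain U F where "open U" "x \<in> U" "\<forall>m. Ck_on m U F" "\<forall>y\<in>S \<inter> U. F y = f y"
    using assms(1) unfolding smooth_on_def by meson
  then show "\<exists>U F. open U \<and> x \<in> U \<and> (\<forall>m. Ck_on m U F) \<and> (\<forall>y\<in>T \<inter> U. F y = f y)"
    using assms(2) by (intro exI[of _ U] exI[of _ F]) auto
qed

section \<open>Ricci curvature of a conformally flat metric\<close>

text \<open>The classical expression \<open>(n-2)(\<nabla>\<^sup>2w - dw \<otimes> dw) + (\<Delta>w + (n-2)\<bar>\<nabla>w\<bar>\<^sup>2) I\<close> for \<open>-Ric(e\<^bsup>2w\<^esup>g\<^sub>0)\<close>, with the two orders of
  differentiation kept apart as the Christoffel symbols produce them, so that the symmetry of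
  second derivatives is never invoked.\<close>

definition conformal_neg_ricci :: "(real^'n \<Rightarrow> real) \<Rightarrow> real^'n \<Rightarrow> real^'n^'n" where
  "conformal_neg_ricci w x = (\<chi> i j.
     (real CARD('n) - 1) * partial j (partial i w) x - partial i (partial j w) x
     - (real CARD('n) - 2) * partial i w x * partial j w x
     + (if i = j then (\<Sum>l\<in>UNIV. partial l (partial l w) x)
          + (real CARD('n) - 2) * (\<Sum>l\<in>UNIV. (partial l w x)\<^sup>2) else 0))"

text \<open>The Christoffel symbols \<open>\<Gamma>\<^sup>l\<^sub>i\<^sub>j\<close> of \<open>e\<^bsup>2w\<^esup>g\<^sub>0\<close>, as a function of the gradient \<open>a\<close> of \<open>w\<close>.\<close>

definition conformal_christoffel :: "('n \<Rightarrow> real) \<Rightarrow> 'n \<Rightarrow> 'n \<Rightarrow> 'n \<Rightarrow> real" where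
  "conformal_christoffel a l i j =
     (if l = j then a i else 0) + (if l = i then a j else 0) - (if i = j then a l else 0)"

lemma matrix_inv_scalar:
  assumes "c \<noteq> 0"
  shows "matrix_inv (c *\<^sub>R mat 1 :: real^'n^'n) = (1 / c) *\<^sub>R mat 1"
proof -
  have mult: "(a *\<^sub>R mat 1 :: real^'n^'n) ** B = a *\<^sub>R B" for a and B :: "real^'n^'n"
    by (simp add: vec_eq_iff matrix_matrix_mult_def mat_def if_distrib if_distribR cong: if_cong)
  have "(c *\<^sub>R mat 1 :: real^'n^'n) ** ((1 / c) *\<^sub>R mat 1) = mat 1"
    "((1 / c) *\<^sub>R mat 1 :: real^'n^'n) ** (c *\<^sub>R mat 1) = mat 1"
    using assms unfolding mult by simp_all
  then have "(c *\<^sub>R mat 1 :: real^'n^'n) ** matrix_inv (c *\<^sub>R mat 1) = mat 1"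
    unfolding matrix_inv_def
    using someI_ex[of "\<lambda>B. (c *\<^sub>R mat 1 :: real^'n^'n) ** B = mat 1 \<and> B ** (c *\<^sub>R mat 1) = mat 1"]
    by blast
  then have "c *\<^sub>R matrix_inv (c *\<^sub>R mat 1 :: real^'n^'n) = mat 1" unfolding mult .
  then have "(1 / c) *\<^sub>R (c *\<^sub>R matrix_inv (c *\<^sub>R mat 1 :: real^'n^'n)) = (1 / c) *\<^sub>R mat 1" by (simp only:)
  then show ?thesis using assms by simp
qed

lemma christoffel_conformal:
  fixes w :: "real^'n \<Rightarrow> real"
  assumes "w differentiable (at x)"
  shows "christoffel (conformal_metric w flat_metric) l i j x
    = conformal_christoffel (\<lambda>m. partial m w x) l i j"
proof -
  let ?G = "conformal_metric w flat_metric"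
  obtain D where D: "(w has_derivative D) (at x)" using assms by (auto simp: differentiable_def)
  have E: "((\<lambda>y. exp (2 * w y)) has_derivative (\<lambda>h. exp (2 * w x) * (2 * D h))) (at x)"
    by (auto intro!: derivative_eq_intros D)
  have G: "partial p (\<lambda>y. ?G y $ q $ r) x = (if q = r then 2 * exp (2 * w x) * partial p w x else 0)" for p q r
  proof (cases "q = r")
    case True
    then have "(\<lambda>y. ?G y $ q $ r) = (\<lambda>y. exp (2 * w y))"
      by (simp add: conformal_metric_def flat_metric_def mat_def)
    then show ?thesis using partialI[OF E, of p] partialI[OF D, of p] True by simp
  next
    case False
    then have "(\<lambda>y. ?G y $ q $ r) = (\<lambda>y. 0)"
      by (simp add: conformal_metric_def flat_metric_def mat_def)
    then show ?thesis using partialI[OF has_derivative_const, of p 0 x] False by simp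
  qed
  have inv: "matrix_inv (?G x) $ l $ m = (if m = l then 1 / exp (2 * w x) else 0)" for m
    unfolding conformal_metric_def flat_metric_def by (subst matrix_inv_scalar) (auto simp: mat_def)
  have "christoffel ?G l i j x = (1 / exp (2 * w x)) * (2 * exp (2 * w x)) *
      ((if j = l then partial i w x else 0) + (if i = l then partial j w x else 0)
        - (if i = j then partial l w x else 0)) / 2"
    unfolding christoffel_def inv G if_distrib[where f = "\<lambda>c. c * _"] mult_zero_left
    by (simp add: algebra_simps)
  then show ?thesis by (auto simp: conformal_christoffel_def)
qed

text \<open>The part of the Ricci tensor that is quadratic in the Christoffel symbols.\<close>

lemma sum_conformal_christoffel:
  fixes a :: "'n::finite \<Rightarrow> real"
  shows "(\<Sum>l\<in>UNIV. \<Sum>m\<in>UNIV. conformal_christoffel a l l m * conformal_christoffel a m i j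
      - conformal_christoffel a l j m * conformal_christoffel a m i l)
    = (real CARD('n) - 2) * (a i * a j)
      - (if i = j then (real CARD('n) - 2) * (\<Sum>l\<in>UNIV. (a l)\<^sup>2) else 0)"
proof -
  let ?S = "\<Sum>l\<in>UNIV. (a l)\<^sup>2"
  let ?\<Gamma> = "conformal_christoffel a"
  have 1: "?\<Gamma> l l m = a m" for l m by (simp add: conformal_christoffel_def)
  have ifm: "(if P then x else 0) * y = (if P then x * y else 0)" for P and x y :: real by simp
  have mif: "y * (if P then x else 0) = (if P then y * x else 0)" for P and x y :: real by simp
  have A: "(\<Sum>m\<in>UNIV. a m * ?\<Gamma> m i j) = 2 * (a i * a j) - (if i = j then ?S else 0)"
    by (simp add: conformal_christoffel_def ring_distribs sum.distrib sum_subtractf mif power2_eq_square mult.commute)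
  have inner: "(\<Sum>m\<in>UNIV. ?\<Gamma> l j m * ?\<Gamma> m i l) =
      a j * ?\<Gamma> l i l + (if l = j then (\<Sum>m\<in>UNIV. a m * ?\<Gamma> m i l) else 0) - a l * ?\<Gamma> j i l" for l
  proof -
    have "(\<Sum>m\<in>UNIV. ?\<Gamma> l j m * ?\<Gamma> m i l) = (\<Sum>m\<in>UNIV. (if m = l then a j * ?\<Gamma> m i l else 0)
        + (if l = j then a m * ?\<Gamma> m i l else 0) - (if m = j then a l * ?\<Gamma> m i l else 0))"
      by (intro sum.cong) (auto simp: conformal_christoffel_def[of a l j] algebra_simps)
    then show ?thesis by (simp add: sum.distrib sum_subtractf)
  qed
  have "(\<Sum>l\<in>UNIV. a j * ?\<Gamma> l i l) = real CARD('n) * (a i * a j)"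
  proof -
    have "?\<Gamma> l i l = a i" for l by (auto simp: conformal_christoffel_def)
    then show ?thesis by simp
  qed
  moreover have "(\<Sum>l\<in>UNIV. if l = j then (\<Sum>m\<in>UNIV. a m * ?\<Gamma> m i l) else 0)
      = 2 * (a i * a j) - (if i = j then ?S else 0)"
    by (simp add: A)
  moreover have "(\<Sum>l\<in>UNIV. a l * ?\<Gamma> j i l) = (if i = j then ?S else 0)"
  proof -
    have "(\<Sum>l\<in>UNIV. a l * ?\<Gamma> j i l) = (\<Sum>l\<in>UNIV. (if l = j then a l * a i else 0)
        + (if i = j then (a l)\<^sup>2 else 0) - (if l = i then a l * a j else 0))"
      by (intro sum.cong) (auto simp: conformal_christoffel_def[of a j i] algebra_simps power2_eq_square)
    then show ?thesis by (simp add: sum.distrib sum_subtractf)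
  qed
  ultimately have "(\<Sum>l\<in>UNIV. \<Sum>m\<in>UNIV. ?\<Gamma> l j m * ?\<Gamma> m i l)
      = real CARD('n) * (a i * a j) + (2 * (a i * a j) - (if i = j then ?S else 0)) - (if i = j then ?S else 0)"
    unfolding inner by (simp only: sum.distrib sum_subtractf)
  moreover have "(\<Sum>l\<in>(UNIV :: 'n set). \<Sum>m\<in>UNIV. ?\<Gamma> l l m * ?\<Gamma> m i j)
      = real CARD('n) * (2 * (a i * a j) - (if i = j then ?S else 0))"
    unfolding 1 A by simp
  ultimately show ?thesis
    unfolding sum_subtractf by (simp only:) (cases "i = j"; simp add: algebra_simps)
qed

proposition ricci_conformal:
  fixes w :: "real^'n \<Rightarrow> real"
  assumes U: "open U" "x \<in> U" and w: "twice_differentiable_on U w"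
  shows "ricci (conformal_metric w flat_metric) x = - conformal_neg_ricci w x"
proof -
  let ?G = "conformal_metric w flat_metric"
  have \<Gamma>: "christoffel ?G l i j y = conformal_christoffel (\<lambda>m. partial m w y) l i j" if "y \<in> U" for l i j y
    by (rule christoffel_conformal) (use w that in \<open>auto simp: twice_differentiable_on_def\<close>)
  have ifD: "((\<lambda>y. if P then f y else 0) has_derivative (\<lambda>h. if P then D h else 0)) (at x)"
    if "(f has_derivative D) (at x)" for P D and f :: "real^'n \<Rightarrow> real"
    using that by (cases P) simp_all
  have d\<Gamma>: "partial m (christoffel ?G l i j) x
      = (if l = j then partial m (partial i w) x else 0) + (if l = i then partial m (partial j w) x else 0)
        - (if i = j then partial m (partial l w) x else 0)" for m l i j
  proof -
    obtain D where D: "\<And>i. (partial i w has_derivative D i) (at x)"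
      using w U(2) unfolding twice_differentiable_on_def differentiable_def by metis
    have "partial m (christoffel ?G l i j) x
        = partial m (\<lambda>y. conformal_christoffel (\<lambda>m. partial m w y) l i j) x"
      by (rule partial_cong_open[OF U]) (rule \<Gamma>)
    also have "\<dots> = (\<lambda>h. (if l = j then D i h else 0) + (if l = i then D j h else 0)
        - (if i = j then D l h else 0)) (axis m 1)"
      unfolding conformal_christoffel_def
      by (rule partialI) (intro has_derivative_diff has_derivative_add ifD D)
    finally show ?thesis by (simp add: partialI[OF D])
  qed
  have lin: "(\<Sum>l\<in>UNIV. partial l (christoffel ?G l i j) x - partial j (christoffel ?G l i l) x)
      = partial j (partial i w) x + partial i (partial j w) x
        - (if i = j then (\<Sum>l\<in>UNIV. partial l (partial l w) x) else 0)
        - real CARD('n) * partial j (partial i w) x" for i j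
  proof -
    have a: "partial j (christoffel ?G l i l) x = partial j (partial i w) x" for l
      unfolding d\<Gamma> by auto
    show ?thesis unfolding a by (simp add: d\<Gamma> sum.distrib sum_subtractf)
  qed
  have quad: "(\<Sum>l\<in>UNIV. \<Sum>m\<in>UNIV. christoffel ?G l l m x * christoffel ?G m i j x
      - christoffel ?G l j m x * christoffel ?G m i l x)
    = (real CARD('n) - 2) * (partial i w x * partial j w x)
      - (if i = j then (real CARD('n) - 2) * (\<Sum>l\<in>UNIV. (partial l w x)\<^sup>2) else 0)" for i j
    unfolding \<Gamma>[OF U(2)] by (rule sum_conformal_christoffel)
  show ?thesis
    unfolding vec_eq_iff
  proof (intro allI)
    fix i j
    show "ricci ?G x $ i $ j = (- conformal_neg_ricci w x) $ i $ j"
      by (simp add: ricci_def conformal_neg_ricci_def lin quad) (simp add: algebra_simps)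
  qed
qed

text \<open>The background metric enters only through \<open>w + \<rho>\<close> and through the positive factor from raising an index.  This is the
  conformal covariance on which the theorem rests.\<close>

lemma neg_ricci_endo_conformal:
  fixes w \<rho> :: "real^'n \<Rightarrow> real"
  assumes U: "open U" "x \<in> U" and w: "twice_differentiable_on U (\<lambda>x. w x + \<rho> x)"
  shows "neg_ricci_endo (conformal_metric \<rho> flat_metric) w x
    = exp (- 2 * \<rho> x) *\<^sub>R conformal_neg_ricci (\<lambda>x. w x + \<rho> x) x"
proof -
  have "conformal_metric w (conformal_metric \<rho> flat_metric)
      = (conformal_metric (\<lambda>x. w x + \<rho> x) flat_metric :: real^'n \<Rightarrow> real^'n^'n)"
    by (simp add: fun_eq_iff conformal_metric_def exp_add[symmetric] algebra_simps)
  moreover have "matrix_inv (conformal_metric \<rho> flat_metric x :: real^'n^'n) = exp (- 2 * \<rho> x) *\<^sub>R mat 1"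
    unfolding conformal_metric_def flat_metric_def by (subst matrix_inv_scalar) (auto simp: exp_minus field_simps)
  moreover have "(a *\<^sub>R mat 1 :: real^'n^'n) ** B = a *\<^sub>R B" for a and B :: "real^'n^'n"
    by (simp add: vec_eq_iff matrix_matrix_mult_def mat_def if_distrib if_distribR cong: if_cong)
  ultimately show ?thesis
    unfolding neg_ricci_endo_def by (simp add: ricci_conformal[OF U w])
qed

section \<open>The comparison principle\<close>

lemma frechet_derivative_eq_sum_partial:
  fixes f :: "real^'n \<Rightarrow> real"
  assumes "f differentiable (at x)"
  shows "frechet_derivative f (at x) v = (\<Sum>i\<in>UNIV. v $ i * partial i f x)"
proof -
  have lin: "linear (frechet_derivative f (at x))" using assms by (rule linear_frechet_derivative)
  have "v = (\<Sum>i\<in>UNIV. (v $ i) *\<^sub>R axis i 1)"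
    using basis_expansion[of v] by (simp add: scalar_mult_eq_scaleR)
  then have "frechet_derivative f (at x) v
      = frechet_derivative f (at x) (\<Sum>i\<in>UNIV. (v $ i) *\<^sub>R axis i 1)" by (rule arg_cong)
  also have "\<dots> = (\<Sum>i\<in>UNIV. v $ i * partial i f x)"
    unfolding linear_sum[OF lin] partial_def by (simp add: linear_scale[OF lin])
  finally show ?thesis .
qed

lemma has_derivative_partials:
  fixes f :: "real^'n \<Rightarrow> real"
  assumes "f differentiable (at x)"
  shows "(f has_derivative (\<lambda>v. \<Sum>i\<in>UNIV. v $ i * partial i f x)) (at x)"
  using assms frechet_derivative_works frechet_derivative_eq_sum_partial[OF assms]
  by (metis (no_types, lifting) ext)

lemma line_derivative:
  fixes f :: "real^'n \<Rightarrow> real"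
  assumes "f differentiable (at (x + t *\<^sub>R v))"
  shows "((\<lambda>t. f (x + t *\<^sub>R v)) has_real_derivative
    (\<Sum>i\<in>UNIV. v $ i * partial i f (x + t *\<^sub>R v))) (at t)"
proof -
  have "((\<lambda>t. x + t *\<^sub>R v) has_derivative (\<lambda>s. s *\<^sub>R v)) (at t)"
    by (auto intro!: derivative_eq_intros)
  from has_derivative_compose[OF this has_derivative_partials[OF assms]]
  show ?thesis
    unfolding has_field_derivative_def
    by (rule has_derivative_eq_rhs) (simp add: fun_eq_iff sum_distrib_left sum_distrib_right mult_ac)
qed

lemma gradient_eq_0_at_min:
  fixes h :: "real^'n \<Rightarrow> real"
  assumes "open U" "x \<in> U" "h differentiable (at x)" "\<And>y. y \<in> U \<Longrightarrow> h x \<le> h y"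
  shows "partial i h x = 0"
proof -
  obtain D where D: "(h has_derivative D) (at x)" using assms(3) by (auto simp: differentiable_def)
  then have "D = (\<lambda>v. 0)" using differential_zero_maxmin[OF assms(2,1)] assms(4) by blast
  then show ?thesis using partialI[OF D] by simp
qed

text \<open>A negative second derivative along \<open>v\<close> would make the first derivative, which is \<open>0\<close> at the minimum, negative just after it.\<close>

lemma hessian_nonneg_at_min:
  fixes h :: "real^'n \<Rightarrow> real"
  assumes U: "open U" "x \<in> U" and h: "twice_differentiable_on U h" and min: "\<And>y. y \<in> U \<Longrightarrow> h x \<le> h y"
  shows "0 \<le> (\<Sum>i\<in>UNIV. \<Sum>j\<in>UNIV. v $ i * v $ j * partial j (partial i h) x)"
proof (rule ccontr)
  let ?Q = "\<Sum>i\<in>UNIV. \<Sum>j\<in>UNIV. v $ i * v $ j * partial j (partial i h) x"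
  define \<phi> where "\<phi> t = (\<Sum>i\<in>UNIV. v $ i * partial i h (x + t *\<^sub>R v))" for t
  assume "\<not> 0 \<le> ?Q"
  then have neg: "?Q < 0" by simp
  have "(\<phi> has_real_derivative (\<Sum>i\<in>UNIV. v $ i * (\<Sum>j\<in>UNIV. v $ j * partial j (partial i h) (x + 0 *\<^sub>R v)))) (at 0)"
    unfolding \<phi>_def
    by (intro DERIV_sum DERIV_cmult line_derivative) (use h U in \<open>auto simp: twice_differentiable_on_def\<close>)
  then have "(\<phi> has_real_derivative ?Q) (at 0)"
    by (simp add: sum_distrib_left mult_ac)
  then obtain d where d: "d > 0" "\<And>t. 0 < t \<Longrightarrow> t < d \<Longrightarrow> \<phi> t < \<phi> 0"
    using DERIV_neg_dec_right[OF _ neg] by force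
  have "\<phi> 0 = 0"
  proof -
    have "partial i h x = 0" for i
      by (rule gradient_eq_0_at_min[OF U]) (use h U(2) min in \<open>auto simp: twice_differentiable_on_def\<close>)
    then show ?thesis by (simp add: \<phi>_def)
  qed
  have "\<forall>\<^sub>F t in at 0. x + t *\<^sub>R v \<in> U"
  proof -
    have "((\<lambda>t. x + t *\<^sub>R v) \<longlongrightarrow> x + 0 *\<^sub>R v) (at 0)" by (intro tendsto_intros)
    then show ?thesis using U by (simp add: topological_tendstoD)
  qed
  then obtain e where e: "e > 0" "\<And>t. t \<noteq> 0 \<Longrightarrow> \<bar>t\<bar> < e \<Longrightarrow> x + t *\<^sub>R v \<in> U"
    unfolding eventually_at by (auto simp: dist_real_def)
  define b where "b = min d e / 2"
  have b: "0 < b" "b < d" "b < e" using d e unfolding b_def by auto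
  have inU: "x + t *\<^sub>R v \<in> U" if "0 \<le> t" "t \<le> b" for t
    using e(2)[of t] U(2) that b by (cases "t = 0") auto
  have der: "((\<lambda>t. h (x + t *\<^sub>R v)) has_real_derivative \<phi> t) (at t)" if "0 \<le> t" "t \<le> b" for t
    unfolding \<phi>_def using inU[OF that] h by (intro line_derivative) (simp add: twice_differentiable_on_def)
  have "h (x + 0 *\<^sub>R v) > h (x + b *\<^sub>R v)"
  proof (rule DERIV_neg_imp_decreasing_open[OF b(1)])
    show "\<exists>y. ((\<lambda>t. h (x + t *\<^sub>R v)) has_real_derivative y) (at t) \<and> y < 0" if "0 < t" "t < b" for t
      using der[of t] d(2)[of t] \<open>\<phi> 0 = 0\<close> that b by force
    show "continuous_on {0..b} (\<lambda>t. h (x + t *\<^sub>R v))"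
      using der DERIV_isCont by (intro continuous_at_imp_continuous_on) fastforce
  qed
  then show False using min[OF inU[of b]] b by simp
qed

text \<open>The equation of the flat background in the form that the comparison principle uses: the Garding cone instead
  of the component \<open>\<Gamma>\<^sub>k\<^sup>+\<close>, and no boundary condition.\<close>

definition sigma_ricci_on :: "nat \<Rightarrow> (real^'n) set \<Rightarrow> (real^'n \<Rightarrow> real) \<Rightarrow> bool" where
  "sigma_ricci_on k U w \<longleftrightarrow> open U \<and> twice_differentiable_on U w \<and>
     (\<forall>x\<in>U. conformal_neg_ricci w x \<in> garding_cone k \<and>
        sigma k (conformal_neg_ricci w x) =
          (real CARD('n) - 1) ^ k * real (CARD('n) choose k) * exp (2 * real k * w x))"

lemma twice_differentiable_on_diff:
  assumes "open U" "twice_differentiable_on U v" "twice_differentiable_on U w"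
  shows "twice_differentiable_on U (\<lambda>x. v x - w x)"
    and "\<And>x i. x \<in> U \<Longrightarrow> partial i (\<lambda>x. v x - w x) x = partial i v x - partial i w x"
    and "\<And>x i j. x \<in> U \<Longrightarrow>
      partial j (partial i (\<lambda>x. v x - w x)) x = partial j (partial i v) x - partial j (partial i w) x"
proof -
  have diff: "partial i (\<lambda>x. f x - g x) x = partial i f x - partial i g x"
    if "f differentiable (at x)" "g differentiable (at x)" for f g :: "real^'a \<Rightarrow> real" and i x
    using has_derivative_diff[OF has_derivative_partials[OF that(1)] has_derivative_partials[OF that(2)]]
      partialI[OF has_derivative_partials[OF that(1)], of i] partialI[OF has_derivative_partials[OF that(2)], of i]
    by (simp add: partialI)
  show 1: "partial i (\<lambda>x. v x - w x) x = partial i v x - partial i w x" if "x \<in> U" for x i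
    using assms that by (intro diff) (auto simp: twice_differentiable_on_def)
  have 2: "(\<lambda>x. partial i v x - partial i w x) differentiable (at x)" if "x \<in> U" for x i
    using assms that by (intro differentiable_diff) (auto simp: twice_differentiable_on_def)
  show "twice_differentiable_on U (\<lambda>x. v x - w x)"
    unfolding twice_differentiable_on_def
    using assms 2 1 differentiable_cong_open[OF 2 assms(1)]
    by (auto simp: twice_differentiable_on_def intro!: differentiable_diff)
  show "partial j (partial i (\<lambda>x. v x - w x)) x = partial j (partial i v) x - partial j (partial i w) x"
    if "x \<in> U" for x i j
    using partial_cong_open[OF assms(1) that 1] diff assms that
    by (simp add: twice_differentiable_on_def)
qed

text \<open>With \<open>H\<close> the Hessian of \<open>v - w\<close> at the touching point, the gradient terms cancel and the difference of the two
  curvature matrices is \<open>(n-2) H + tr(H) I\<close> as a quadratic form, which is nonnegative because \<open>H\<close> is.\<close>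

lemma touching_point_comparison:
  fixes w v :: "real^'n \<Rightarrow> real"
  assumes n: "CARD('n) \<ge> 3" and k: "1 \<le> k"
    and w: "sigma_ricci_on k U w" and v: "sigma_ricci_on k U v"
    and x: "x \<in> U" and max: "\<And>y. y \<in> U \<Longrightarrow> w y - v y \<le> w x - v x"
  shows "w x \<le> v x"
proof -
  let ?h = "\<lambda>x. v x - w x"
  have U: "open U" and dw: "twice_differentiable_on U w" and dv: "twice_differentiable_on U v"
    using w v by (auto simp: sigma_ricci_on_def)
  note h = twice_differentiable_on_diff[OF U dv dw]
  have min: "?h x \<le> ?h y" if "y \<in> U" for y using max[OF that] by simp
  have grad: "partial i v x = partial i w x" for i
  proof -
    have "partial i ?h x = 0"
      by (rule gradient_eq_0_at_min[OF U x]) (use h(1) x min in \<open>auto simp: twice_differentiable_on_def\<close>)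
    then show ?thesis using h(2)[OF x] by simp
  qed
  define H where "H i j = partial j (partial i ?h) x" for i j
  have hess: "0 \<le> (\<Sum>i\<in>UNIV. \<Sum>j\<in>UNIV. \<xi> $ i * \<xi> $ j * H i j)" for \<xi>
    unfolding H_def by (rule hessian_nonneg_at_min[OF U x h(1) min])
  have Hii: "0 \<le> H i i" for i
  proof -
    have "(\<Sum>b\<in>UNIV. axis i 1 $ a * axis i 1 $ b * H a b) = (if a = i then H i i else 0)" for a
    proof -
      have "(\<Sum>b\<in>UNIV. axis i 1 $ a * axis i 1 $ b * H a b)
          = (\<Sum>b\<in>UNIV. if b = i then (if a = i then H i i else 0) else 0)"
        by (intro sum.cong) (auto simp: axis_def)
      then show ?thesis by simp
    qed
    then have "(\<Sum>a\<in>UNIV. \<Sum>b\<in>UNIV. axis i 1 $ a * axis i 1 $ b * H a b) = H i i"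
      by simp
    then show ?thesis using hess[of "axis i 1"] by simp
  qed
  let ?A = "conformal_neg_ricci w x" and ?B = "conformal_neg_ricci v x"
  have entry: "(?B - ?A) $ i $ j = (real CARD('n) - 1) * H i j - H j i
      + (if i = j then (\<Sum>l\<in>UNIV. H l l) else 0)" for i j
    by (simp add: conformal_neg_ricci_def grad H_def h(3)[OF x] sum_subtractf algebra_simps)
  have "0 \<le> \<xi> \<bullet> ((?B - ?A) *v \<xi>)" for \<xi>
  proof -
    have "\<xi> \<bullet> ((?B - ?A) *v \<xi>) = (\<Sum>i\<in>UNIV. \<Sum>j\<in>UNIV. \<xi> $ i * \<xi> $ j * (?B - ?A) $ i $ j)"
      by (simp add: inner_vec_def matrix_vector_mult_def sum_distrib_left mult_ac)
    also have "\<dots> = (real CARD('n) - 1) * (\<Sum>i\<in>UNIV. \<Sum>j\<in>UNIV. \<xi> $ i * \<xi> $ j * H i j)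
        - (\<Sum>i\<in>UNIV. \<Sum>j\<in>UNIV. \<xi> $ i * \<xi> $ j * H j i)
        + (\<Sum>i\<in>UNIV. (\<xi> $ i)\<^sup>2) * (\<Sum>l\<in>UNIV. H l l)"
    proof -
      have "(\<Sum>i\<in>UNIV. \<Sum>j\<in>UNIV. \<xi> $ i * \<xi> $ j * (?B - ?A) $ i $ j)
        = (\<Sum>i\<in>UNIV. \<Sum>j\<in>UNIV. (real CARD('n) - 1) * (\<xi> $ i * \<xi> $ j * H i j)
          - \<xi> $ i * \<xi> $ j * H j i
          + (if i = j then \<xi> $ i * \<xi> $ j * (\<Sum>l\<in>UNIV. H l l) else 0))"
        unfolding entry by (intro sum.cong refl) (simp add: algebra_simps)
      also have "\<dots> = (\<Sum>i\<in>UNIV. \<Sum>j\<in>UNIV. (real CARD('n) - 1) * (\<xi> $ i * \<xi> $ j * H i j))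
          - (\<Sum>i\<in>UNIV. \<Sum>j\<in>UNIV. \<xi> $ i * \<xi> $ j * H j i)
          + (\<Sum>i\<in>UNIV. \<Sum>j\<in>UNIV. if i = j then \<xi> $ i * \<xi> $ j * (\<Sum>l\<in>UNIV. H l l) else 0)"
        by (simp only: sum.distrib sum_subtractf)
      finally show ?thesis
        by (simp add: sum_distrib_left[symmetric] sum_distrib_right[symmetric] power2_eq_square)
    qed
    also have "(\<Sum>i\<in>UNIV. \<Sum>j\<in>UNIV. \<xi> $ i * \<xi> $ j * H j i)
        = (\<Sum>i\<in>UNIV. \<Sum>j\<in>UNIV. \<xi> $ i * \<xi> $ j * H i j)"
      by (subst sum.swap) (simp add: mult_ac)
    also have "(real CARD('n) - 1) * (\<Sum>i\<in>UNIV. \<Sum>j\<in>UNIV. \<xi> $ i * \<xi> $ j * H i j)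
        - (\<Sum>i\<in>UNIV. \<Sum>j\<in>UNIV. \<xi> $ i * \<xi> $ j * H i j) + (\<Sum>i\<in>UNIV. (\<xi> $ i)\<^sup>2) * (\<Sum>l\<in>UNIV. H l l)
      = (real CARD('n) - 2) * (\<Sum>i\<in>UNIV. \<Sum>j\<in>UNIV. \<xi> $ i * \<xi> $ j * H i j)
        + (\<Sum>i\<in>UNIV. (\<xi> $ i)\<^sup>2) * (\<Sum>l\<in>UNIV. H l l)"
      by (simp add: left_diff_distrib)
    also have "\<dots> \<ge> 0"
      using n by (intro add_nonneg_nonneg mult_nonneg_nonneg hess) (auto intro!: sum_nonneg Hii)
    finally show ?thesis .
  qed
  then have "sigma k ?A \<le> sigma k ?B"
    using w v x by (intro sigma_mono_garding_cone) (auto simp: sigma_ricci_on_def garding_cone_def)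
  then have "(real CARD('n) - 1) ^ k * real (CARD('n) choose k) * exp (2 * real k * w x)
    \<le> (real CARD('n) - 1) ^ k * real (CARD('n) choose k) * exp (2 * real k * v x)"
    using w v x by (simp add: sigma_ricci_on_def)
  moreover have "0 < (real CARD('n) - 1) ^ k * real (CARD('n) choose k)"
  proof -
    have "?A \<in> garding_cone k" using w x by (auto simp: sigma_ricci_on_def)
    then have "0 < sigma k ?A" unfolding garding_cone_def by blast
    also have "sigma k ?A = (real CARD('n) - 1) ^ k * real (CARD('n) choose k) * exp (2 * real k * w x)"
      using w x by (auto simp: sigma_ricci_on_def)
    finally show ?thesis by (rule zero_less_mult_pos2) simp
  qed
  ultimately have "exp (2 * real k * w x) \<le> exp (2 * real k * v x)"
    by (simp only: mult_le_cancel_left_pos)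
  then show ?thesis using k by simp
qed

lemma twice_differentiable_on_continuous_on:
  "twice_differentiable_on U w \<Longrightarrow> continuous_on U w"
  unfolding twice_differentiable_on_def
  by (intro continuous_at_imp_continuous_on ballI) (auto intro: differentiable_imp_continuous_within)

text \<open>The boundary condition keeps the points where \<open>w - v\<close> is at least half of a supposed positive value inside a compact subset of
  \<open>U\<close>, so that the supremum is attained and \<open>touching_point_comparison\<close> applies.\<close>

proposition comparison_principle:
  fixes w v :: "real^'n \<Rightarrow> real"
  assumes n: "CARD('n) \<ge> 3" and k: "1 \<le> k" and "bounded U"
    and w: "sigma_ricci_on k U w" and v: "sigma_ricci_on k U v"
    and bdry: "\<And>p \<epsilon>. p \<in> frontier U \<Longrightarrow> 0 < \<epsilon> \<Longrightarrow> \<forall>\<^sub>F x in at p within U. w x - v x < \<epsilon>"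
    and "x \<in> U"
  shows "w x \<le> v x"
proof (rule ccontr)
  assume "\<not> w x \<le> v x"
  define \<eta> where "\<eta> = w x - v x"
  have \<eta>: "\<eta> > 0" using \<open>\<not> w x \<le> v x\<close> by (simp add: \<eta>_def)
  have U: "open U" using w by (simp add: sigma_ricci_on_def)
  have cont: "continuous_on U (\<lambda>y. w y - v y)"
    using w v by (intro continuous_intros twice_differentiable_on_continuous_on) (auto simp: sigma_ricci_on_def)
  let ?K = "{y \<in> U. \<eta> / 2 \<le> w y - v y}"
  have "closed ?K"
    unfolding closed_sequential_limits
  proof (intro allI impI, elim conjE)
    fix z y assume z: "\<forall>n. z n \<in> ?K" and lim: "z \<longlonglongrightarrow> y"
    have "y \<in> closure U" using z lim by (auto simp: closure_sequential)
    show "y \<in> ?K"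
    proof (cases "y \<in> U")
      case True
      then have "isCont (\<lambda>y. w y - v y) y" using cont U continuous_on_eq_continuous_at by blast
      then have "(\<lambda>n. w (z n) - v (z n)) \<longlonglongrightarrow> w y - v y"
        using isCont_tendsto_compose[OF _ lim] by blast
      then have "\<eta> / 2 \<le> w y - v y"
        by (rule LIMSEQ_le_const) (use z in auto)
      then show ?thesis using True by simp
    next
      case False
      then have fr: "y \<in> frontier U"
        using \<open>y \<in> closure U\<close> U by (simp add: frontier_def interior_open)
      have "filterlim z (at y within U) sequentially"
        unfolding filterlim_at using lim z False by (auto intro!: always_eventually)
      then have "\<forall>\<^sub>F n in sequentially. w (z n) - v (z n) < \<eta> / 2"
        by (rule eventually_compose_filterlim[rotated]) (use bdry[OF fr, of "\<eta> / 2"] \<eta> in simp)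
      then obtain n where "w (z n) - v (z n) < \<eta> / 2"
        by (meson eventually_happens trivial_limit_sequentially)
      then show ?thesis using z by (auto simp: not_le[symmetric])
    qed
  qed
  moreover have "bounded ?K" using \<open>bounded U\<close> by (rule bounded_subset) auto
  ultimately have "compact ?K" by (simp add: compact_eq_bounded_closed)
  moreover have xK: "x \<in> ?K" using \<open>x \<in> U\<close> \<eta> by (simp add: \<eta>_def)
  moreover have "continuous_on ?K (\<lambda>y. w y - v y)" by (rule continuous_on_subset[OF cont]) auto
  ultimately obtain y where y: "y \<in> ?K" "\<And>z. z \<in> ?K \<Longrightarrow> w z - v z \<le> w y - v y"
    using continuous_attains_sup[of ?K "\<lambda>y. w y - v y"] by blast
  have "w z - v z \<le> w y - v y" if "z \<in> U" for z
    using y that by (cases "z \<in> ?K") force+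
  then have "w y \<le> v y"
    using y(1) by (intro touching_point_comparison[OF n k w v]) auto
  then show False using y(1) \<eta> by simp
qed

text \<open>The function \<open>W\<close> for which \<open>e\<^bsup>2W\<^esup>g\<^sub>0\<close> is the hyperbolic metric: on the ball of radius \<open>r\<close> for \<open>s = 1\<close>, and
  on the complement of that ball, its image under inversion, for \<open>s = -1\<close>.\<close>

definition ball_potential :: "real \<Rightarrow> real \<Rightarrow> real^'n \<Rightarrow> real^'n \<Rightarrow> real" where
  "ball_potential s r a x = ln (2 * r / (s * (r\<^sup>2 - (dist x a)\<^sup>2)))"

text \<open>A hyperbolic metric satisfies \<open>-Ric = (n-1)\<close> times the metric, so the curvature endomorphism is a multiple of the identity
  and lies in every Garding cone.  Both signs are treated at once since only \<open>s\<^sup>2 = 1\<close> is used.\<close>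

proposition ball_potential_sigma_ricci_on:
  fixes a :: "real^'n"
  assumes n: "CARD('n) \<ge> 3" and k: "k \<le> CARD('n)" and r: "r > 0" and s: "s\<^sup>2 = 1"
    and U: "open U" and pos: "\<And>x. x \<in> U \<Longrightarrow> 0 < s * (r\<^sup>2 - (dist x a)\<^sup>2)"
  shows "sigma_ricci_on k U (ball_potential s r a)"
proof -
  define q where "q x = s * (r\<^sup>2 - (x - a) \<bullet> (x - a))" for x
  let ?W = "ball_potential s r a"
  have W: "?W = (\<lambda>x. ln (2 * r / q x))"
    by (simp add: fun_eq_iff ball_potential_def q_def dist_norm power2_norm_eq_inner)
  have q: "q x > 0" if "x \<in> U" for x
    using pos[OF that] by (simp add: q_def dist_norm power2_norm_eq_inner)
  have dq: "(q has_derivative (\<lambda>h. - 2 * s * ((x - a) \<bullet> h))) (at x)" for x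
    unfolding q_def[abs_def]
    by (auto intro!: derivative_eq_intros simp: fun_eq_iff inner_commute algebra_simps)
  have dW: "(?W has_derivative (\<lambda>h. 2 * s * ((x - a) \<bullet> h) / q x)) (at x)" if "x \<in> U" for x
    unfolding W using q[OF that] r
    by (auto intro!: derivative_eq_intros dq simp: fun_eq_iff field_simps)
  have pW: "partial i ?W x = 2 * s * (x - a) $ i / q x" if "x \<in> U" for i x
    using partialI[OF dW[OF that], of i] by (simp add: inner_axis)
  have dpW: "(partial i ?W has_derivative (\<lambda>h. 2 * s * h $ i / q x
      + 4 * (x - a) $ i * ((x - a) \<bullet> h) / (q x)\<^sup>2)) (at x)" if "x \<in> U" for i x
  proof (rule has_derivative_transform_within_open[OF _ U that])
    have "((\<lambda>x. 2 * s * (x - a) $ i / q x) has_derivative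
      (\<lambda>h. (2 * s * h $ i * q x - 2 * s * (x - a) $ i * (- 2 * s * ((x - a) \<bullet> h))) / (q x * q x))) (at x)"
      using q[OF that]
      by (auto intro!: derivative_eq_intros dq bounded_linear.has_derivative[OF bounded_linear_vec_nth])
    moreover have "(2 * s * h $ i * q x - 2 * s * (x - a) $ i * (- 2 * s * ((x - a) \<bullet> h))) / (q x * q x)
       = 2 * s * h $ i / q x + 4 * (x - a) $ i * ((x - a) \<bullet> h) / (q x)\<^sup>2" for h
    proof -
      have "2 * s * (x - a) $ i * (- 2 * s * ((x - a) \<bullet> h)) = - (4 * s\<^sup>2 * (x - a) $ i * ((x - a) \<bullet> h))"
        by (simp only: power2_eq_square) (simp add: mult_ac)
      then have "2 * s * (x - a) $ i * (- 2 * s * ((x - a) \<bullet> h)) = - (4 * (x - a) $ i * ((x - a) \<bullet> h))"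
        by (simp only: s mult_1_right)
      then show ?thesis using q[OF that] by (simp only:) (simp add: diff_divide_distrib add_divide_distrib power2_eq_square)
    qed
    ultimately show "((\<lambda>x. 2 * s * (x - a) $ i / q x) has_derivative
      (\<lambda>h. 2 * s * h $ i / q x + 4 * (x - a) $ i * ((x - a) \<bullet> h) / (q x)\<^sup>2)) (at x)" by simp
  qed (simp add: pW)
  have twice: "twice_differentiable_on U ?W"
    unfolding twice_differentiable_on_def differentiable_def using dW dpW by blast
  have M: "conformal_neg_ricci ?W x = ((real CARD('n) - 1) * exp (2 * ?W x)) *\<^sub>R mat 1" if x: "x \<in> U" for x
  proof -
    let ?y = "x - a" and ?n = "real CARD('n)"
    have ppW: "partial j (partial i ?W) x
        = (if i = j then 2 * s / q x else 0) + 4 * ?y $ i * ?y $ j / (q x)\<^sup>2" for i j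
      using partialI[OF dpW[OF x], of j i] by (simp add: inner_axis) (simp add: axis_def)
    have sq: "(\<Sum>l\<in>UNIV. (?y $ l)\<^sup>2) = ?y \<bullet> ?y"
      by (simp only: inner_vec_def inner_real_def power2_eq_square)
    have lap: "(\<Sum>l\<in>UNIV. partial l (partial l ?W) x) = ?n * (2 * s / q x) + 4 * (?y \<bullet> ?y) / (q x)\<^sup>2"
    proof -
      have "(\<Sum>l\<in>UNIV. partial l (partial l ?W) x) = (\<Sum>l\<in>(UNIV :: 'n set). 2 * s / q x)
          + (\<Sum>l\<in>UNIV. (4 / (q x)\<^sup>2) * (?y $ l)\<^sup>2)"
        unfolding ppW sum.distrib[symmetric] by (simp add: power2_eq_square mult.assoc del: vector_minus_component)
      then show ?thesis unfolding sum_distrib_left[symmetric] sq by simp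
    qed
    have pp: "partial i ?W x * partial j ?W x = 4 * ?y $ i * ?y $ j / (q x)\<^sup>2" for i j
    proof -
      have "partial i ?W x * partial j ?W x = 4 * s\<^sup>2 * ?y $ i * ?y $ j / (q x)\<^sup>2"
        unfolding pW[OF x] power2_eq_square by (simp add: mult_ac del: vector_minus_component)
      then show ?thesis by (simp only: s mult_1_right)
    qed
    have grad: "(\<Sum>l\<in>UNIV. (partial l ?W x)\<^sup>2) = 4 * (?y \<bullet> ?y) / (q x)\<^sup>2"
    proof -
      have "(\<Sum>l\<in>UNIV. (partial l ?W x)\<^sup>2) = (\<Sum>l\<in>UNIV. (4 / (q x)\<^sup>2) * (?y $ l)\<^sup>2)"
        by (intro sum.cong refl) (simp only: power2_eq_square[of "partial _ _ _"] pp, simp add: power2_eq_square)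
      then show ?thesis unfolding sum_distrib_left[symmetric] sq by simp
    qed
    \<comment> \<open>The diagonal entries combine to \<open>4 (n-1) (s q + \<bar>x - a\<bar>\<^sup>2) / q\<^sup>2\<close>, and \<open>s q + \<bar>x - a\<bar>\<^sup>2 = r\<^sup>2\<close>.\<close>
    have E: "exp (2 * ?W x) = 4 * r\<^sup>2 / (q x)\<^sup>2"
    proof -
      have "exp (2 * ?W x) = (exp (?W x))\<^sup>2" by (simp add: exp_double)
      also have "exp (?W x) = 2 * r / q x" unfolding W using q[OF x] r by simp
      finally show ?thesis by (simp add: power2_eq_square)
    qed
    have "s * q x = s\<^sup>2 * (r\<^sup>2 - ?y \<bullet> ?y)" by (simp add: q_def power2_eq_square)
    then have sq': "s * q x = r\<^sup>2 - ?y \<bullet> ?y" by (simp only: s) simp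
    have "(?n - 2) * (2 * s / q x) + ?n * (2 * s / q x) + 4 * (?y \<bullet> ?y) / (q x)\<^sup>2
        + (?n - 2) * (4 * (?y \<bullet> ?y) / (q x)\<^sup>2) = (?n - 1) * 4 * (s * q x + ?y \<bullet> ?y) / (q x)\<^sup>2"
      using q[OF x] by (simp add: field_simps power2_eq_square)
    also have "\<dots> = (?n - 1) * exp (2 * ?W x)" unfolding E sq' by simp
    finally have diag: "(?n - 2) * (2 * s / q x) + ?n * (2 * s / q x) + 4 * (?y \<bullet> ?y) / (q x)\<^sup>2
        + (?n - 2) * (4 * (?y \<bullet> ?y) / (q x)\<^sup>2) = (?n - 1) * exp (2 * ?W x)" .
    show ?thesis
      unfolding vec_eq_iff
    proof (intro allI)
      fix i j
      let ?P = "4 * ?y $ i * ?y $ j / (q x)\<^sup>2"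
      have P': "4 * ?y $ j * ?y $ i / (q x)\<^sup>2 = ?P" by (simp add: mult_ac del: vector_minus_component)
      have "conformal_neg_ricci ?W x $ i $ j = (?n - 1) * ((if i = j then 2 * s / q x else 0) + ?P)
          - ((if i = j then 2 * s / q x else 0) + ?P) - (?n - 2) * ?P
          + (if i = j then ?n * (2 * s / q x) + 4 * (?y \<bullet> ?y) / (q x)\<^sup>2
            + (?n - 2) * (4 * (?y \<bullet> ?y) / (q x)\<^sup>2) else 0)"
        unfolding conformal_neg_ricci_def vec_lambda_beta lap grad mult.assoc[of "?n - 2" "partial i ?W x"] pp
        unfolding ppW P' by (simp only: eq_commute[of j i])
      also have "\<dots> = (if i = j then (?n - 1) * exp (2 * ?W x) else 0)"
      proof -
        have cancel: "(N - 1) * (d + P) - (d + P) - (N - 2) * P = (N - 2) * d" for N d P :: real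
          by (simp add: algebra_simps)
        show ?thesis unfolding cancel diag[symmetric] by (cases "i = j") simp_all
      qed
      also have "\<dots> = (((?n - 1) * exp (2 * ?W x)) *\<^sub>R mat 1 :: real^'n^'n) $ i $ j"
        by (simp add: mat_def)
      finally show "conformal_neg_ricci ?W x $ i $ j = (((?n - 1) * exp (2 * ?W x)) *\<^sub>R mat 1 :: real^'n^'n) $ i $ j" .
    qed
  qed
  have "exp (2 * ?W x) ^ k = exp (2 * real k * ?W x)" for x
    by (simp add: exp_of_nat_mult[symmetric] mult_ac)
  then show ?thesis
    unfolding sigma_ricci_on_def using U twice n k
    by (auto simp: M scalar_garding_cone sigma_scalar power_mult_distrib)
qed

section \<open>Interior and exterior balls of a smooth domain\<close>

lemma differentiable_bounded_difference:
  fixes f :: "'a::real_normed_vector \<Rightarrow> real"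
  assumes "f differentiable (at p)"
  obtains B d where "0 < B" "0 < d" "\<And>y. norm (y - p) < d \<Longrightarrow> \<bar>f y - f p\<bar> \<le> B * norm (y - p)"
proof -
  obtain D where D: "(f has_derivative D) (at p)" using assms by (auto simp: differentiable_def)
  then obtain d where d: "0 < d"
    "\<And>y. norm (y - p) < d \<Longrightarrow> norm (f y - f p - D (y - p)) \<le> 1 * norm (y - p)"
    unfolding has_derivative_at_alt using zero_less_one by blast
  obtain K where K: "0 < K" "\<And>h. norm (D h) \<le> norm h * K"
    using bounded_linear.pos_bounded[OF has_derivative_bounded_linear[OF D]] by blast
  show thesis
  proof (rule that[of "K + 1" d])
    fix y assume "norm (y - p) < d"
    from d(2)[OF this] K(2)[of "y - p"] show "\<bar>f y - f p\<bar> \<le> (K + 1) * norm (y - p)"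
      by (simp add: algebra_simps)
  qed (use K d in auto)
qed

text \<open>The mean value theorem along the segment, together with a Lipschitz estimate at \<open>p\<close> for each partial derivative.\<close>

lemma second_order_taylor_bound:
  fixes \<phi> :: "real^'n \<Rightarrow> real"
  assumes U: "open U" "p \<in> U" and \<phi>: "twice_differentiable_on U \<phi>"
  obtains K d where "0 < K" "0 < d" "ball p d \<subseteq> U"
    "\<And>h. norm h < d \<Longrightarrow> \<bar>\<phi> (p + h) - \<phi> p - (\<chi> i. partial i \<phi> p) \<bullet> h\<bar> \<le> K * (norm h)\<^sup>2"
proof -
  have "\<forall>i. \<exists>B d. 0 < B \<and> 0 < d \<and>
      (\<forall>y. norm (y - p) < d \<longrightarrow> \<bar>partial i \<phi> y - partial i \<phi> p\<bar> \<le> B * norm (y - p))"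
    using \<phi> U(2) differentiable_bounded_difference
    unfolding twice_differentiable_on_def by metis
  then obtain B d where B: "\<And>i. 0 < B i" and d: "\<And>i. 0 < d i"
    and Bd: "\<And>i y. norm (y - p) < d i \<Longrightarrow> \<bar>partial i \<phi> y - partial i \<phi> p\<bar> \<le> B i * norm (y - p)"
    by metis
  obtain d0 where d0: "0 < d0" "ball p d0 \<subseteq> U" using U open_contains_ball by blast
  define \<delta> where "\<delta> = min d0 (Min (range d))"
  have \<delta>: "0 < \<delta>" "\<delta> \<le> d0" "\<delta> \<le> d i" for i
    using d0 d by (auto simp: \<delta>_def min_le_iff_disj)
  have bound: "\<bar>\<phi> (p + h) - \<phi> p - (\<chi> i. partial i \<phi> p) \<bullet> h\<bar> \<le> (\<Sum>i\<in>UNIV. B i) * (norm h)\<^sup>2"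
    if h: "norm h < \<delta>" for h
  proof -
    have near: "norm (t *\<^sub>R h) \<le> norm h" "p + t *\<^sub>R h \<in> U" if "0 \<le> t" "t \<le> 1" for t
    proof -
      show *: "norm (t *\<^sub>R h) \<le> norm h" using that by (simp add: mult_left_le_one_le)
      have "p + t *\<^sub>R h \<in> ball p d0"
        using * h \<delta>(2) by (simp add: dist_norm)
      then show "p + t *\<^sub>R h \<in> U" using d0 by blast
    qed
    have "\<exists>z::real. 0 < z \<and> z < 1 \<and> \<phi> (p + 1 *\<^sub>R h) - \<phi> (p + 0 *\<^sub>R h)
        = (1 - 0) * (\<Sum>i\<in>UNIV. h $ i * partial i \<phi> (p + z *\<^sub>R h))"
      by (rule MVT2, simp, rule line_derivative)
        (use near \<phi> in \<open>auto simp: twice_differentiable_on_def\<close>)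
    then obtain z where z: "0 < z" "z < 1"
      "\<phi> (p + h) - \<phi> p = (\<Sum>i\<in>UNIV. h $ i * partial i \<phi> (p + z *\<^sub>R h))" by auto
    have "\<phi> (p + h) - \<phi> p - (\<chi> i. partial i \<phi> p) \<bullet> h
        = (\<Sum>i\<in>UNIV. h $ i * (partial i \<phi> (p + z *\<^sub>R h) - partial i \<phi> p))"
      unfolding z(3) by (simp add: inner_vec_def right_diff_distrib sum_subtractf mult.commute)
    also have "\<bar>\<dots>\<bar> \<le> (\<Sum>i\<in>UNIV. B i * (norm h)\<^sup>2)"
    proof (intro order_trans[OF sum_abs] sum_mono)
      fix i
      have nz: "norm (z *\<^sub>R h) \<le> norm h" using near z by simp
      then have "\<bar>partial i \<phi> (p + z *\<^sub>R h) - partial i \<phi> p\<bar> \<le> B i * norm (z *\<^sub>R h)"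
        using Bd[of "p + z *\<^sub>R h" i] h \<delta>(3)[of i] by simp
      also have "\<dots> \<le> B i * norm h" using nz B[of i] by simp
      finally have 1: "\<bar>partial i \<phi> (p + z *\<^sub>R h) - partial i \<phi> p\<bar> \<le> B i * norm h" .
      have "\<bar>h $ i * (partial i \<phi> (p + z *\<^sub>R h) - partial i \<phi> p)\<bar> \<le> norm h * (B i * norm h)"
        unfolding abs_mult using component_le_norm_cart[of h i] 1 by (intro mult_mono) auto
      then show "\<bar>h $ i * (partial i \<phi> (p + z *\<^sub>R h) - partial i \<phi> p)\<bar> \<le> B i * (norm h)\<^sup>2"
        by (simp add: power2_eq_square mult_ac)
    qed
    finally show ?thesis by (simp add: sum_distrib_right)
  qed
  show thesis
  proof (rule that[of "\<Sum>i\<in>UNIV. B i" \<delta>])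
    show "0 < (\<Sum>i\<in>UNIV. B i)" using B by (intro sum_pos) auto
    show "ball p \<delta> \<subseteq> U" using d0 \<delta>(2) by (meson subset_ball subset_trans)
  qed (use \<delta> bound in auto)
qed

text \<open>A point \<open>p + h\<close> of the ball tangent to the boundary at \<open>p\<close>, on the side of \<open>\<sigma> \<nu>\<close> with \<open>\<sigma> = \<plusminus>1\<close>, satisfies \<open>\<bar>h\<bar>\<^sup>2 < 2 r \<sigma> (\<nu> \<bullet> h)\<close>.  For
  small \<open>r\<close> the linear term of the defining function therefore dominates its quadratic error, and the sign of \<open>\<phi>\<close> is constant on the ball.\<close>

lemma interior_exterior_ball:
  fixes \<Omega> :: "(real^'n) set"
  assumes \<Omega>: "bounded_smooth_domain \<Omega>" and p: "p \<in> frontier \<Omega>"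
  obtains \<nu> r where "norm \<nu> = 1" "0 < r" "ball (p - r *\<^sub>R \<nu>) r \<subseteq> \<Omega>" "ball (p + r *\<^sub>R \<nu>) r \<inter> \<Omega> = {}"
proof -
  obtain U \<phi> where U: "open U" "p \<in> U" and sm: "smooth_on U \<phi>"
    and reg: "\<And>x. x \<in> U \<Longrightarrow> \<exists>v. frechet_derivative \<phi> (at x) v \<noteq> 0"
    and in\<Omega>: "\<Omega> \<inter> U = {x\<in>U. \<phi> x < 0}" and fr: "frontier \<Omega> \<inter> U = {x\<in>U. \<phi> x = 0}"
    using \<Omega> p unfolding bounded_smooth_domain_def by meson
  have tw: "twice_differentiable_on U \<phi>"
    using smooth_on_imp_twice_differentiable_on[OF U(1) sm] by simp
  define N where "N = (\<chi> i. partial i \<phi> p)"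
  have "\<phi> p = 0" using fr p U by blast
  obtain K d where K: "0 < K" "0 < d" "ball p d \<subseteq> U"
    and taylor: "\<And>h. norm h < d \<Longrightarrow> \<bar>\<phi> (p + h) - N \<bullet> h\<bar> \<le> K * (norm h)\<^sup>2"
    using second_order_taylor_bound[OF U tw] \<open>\<phi> p = 0\<close> unfolding N_def by (metis diff_zero)
  have "N \<noteq> 0"
  proof
    assume "N = 0"
    then have "partial i \<phi> p = 0" for i by (simp add: N_def vec_eq_iff)
    then have "frechet_derivative \<phi> (at p) v = 0" for v
      using frechet_derivative_eq_sum_partial[of \<phi> p v] tw U(2)
      by (simp add: twice_differentiable_on_def)
    then show False using reg U(2) by blast
  qed
  then have nN: "norm N > 0" by simp
  define \<nu> where "\<nu> = (1 / norm N) *\<^sub>R N"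
  \<comment> \<open>The tangent ball of radius \<open>r\<close> lies within distance \<open>2 r\<close> of \<open>p\<close>, where the Taylor bound must hold;
    the second entry makes \<open>K \<bar>h\<bar>\<^sup>2\<close> smaller than the linear term.\<close>
  define r where "r = min (d / 2) (norm N / (2 * K))"
  have r: "0 < r" "2 * r \<le> d" "2 * r * K \<le> norm N"
    using K nN by (auto simp: r_def min_def field_simps)
  have n\<nu>: "norm \<nu> = 1" using nN by (simp add: \<nu>_def)
  have N\<nu>: "N = norm N *\<^sub>R \<nu>" using nN by (simp add: \<nu>_def)
  have key: "norm h < d \<and> (norm h)\<^sup>2 < 2 * r * (\<sigma> * (\<nu> \<bullet> h))"
    if "norm (h - (\<sigma> * r) *\<^sub>R \<nu>) < r" "\<bar>\<sigma>\<bar> = 1" for h \<sigma>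
  proof
    have "norm h \<le> norm (h - (\<sigma> * r) *\<^sub>R \<nu>) + norm ((\<sigma> * r) *\<^sub>R \<nu>)"
      using norm_triangle_ineq[of "h - (\<sigma> * r) *\<^sub>R \<nu>" "(\<sigma> * r) *\<^sub>R \<nu>"] by simp
    also have "norm ((\<sigma> * r) *\<^sub>R \<nu>) = r" using that n\<nu> r by (simp add: abs_mult)
    finally show "norm h < d" using that r by linarith
    have "(norm (h - (\<sigma> * r) *\<^sub>R \<nu>))\<^sup>2 < r\<^sup>2" using that r by (intro power_strict_mono) auto
    moreover have "(norm (h - (\<sigma> * r) *\<^sub>R \<nu>))\<^sup>2 = (norm h)\<^sup>2 - 2 * r * (\<sigma> * (\<nu> \<bullet> h)) + (\<sigma> * r)\<^sup>2 * (\<nu> \<bullet> \<nu>)"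
      unfolding power2_norm_eq_inner by (simp add: inner_diff_left inner_diff_right inner_commute power2_eq_square)
    moreover have "(\<sigma> * r)\<^sup>2 = r\<^sup>2" using that(2) by (metis abs_mult mult_1 power2_abs)
    moreover have "\<nu> \<bullet> \<nu> = 1" using n\<nu> by (simp add: dot_square_norm)
    ultimately show "(norm h)\<^sup>2 < 2 * r * (\<sigma> * (\<nu> \<bullet> h))" by simp
  qed
  have sign: "K * (norm h)\<^sup>2 < \<sigma> * (N \<bullet> h)"
    if "norm (h - (\<sigma> * r) *\<^sub>R \<nu>) < r" "\<bar>\<sigma>\<bar> = 1" for h \<sigma>
  proof -
    let ?s = "\<sigma> * (\<nu> \<bullet> h)"
    have 1: "(norm h)\<^sup>2 < 2 * r * ?s" using key[OF that] by simp
    then have "0 < 2 * r * ?s" by (smt (verit) zero_le_power2)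
    then have s: "0 < ?s" using r by (simp add: zero_less_mult_iff)
    have "K * (norm h)\<^sup>2 < K * (2 * r * ?s)" using 1 K by simp
    also have "\<dots> = (2 * r * K) * ?s" by simp
    also have "\<dots> \<le> norm N * ?s" using r s by (intro mult_right_mono) auto
    also have "\<dots> = \<sigma> * (N \<bullet> h)" by (subst (2) N\<nu>) simp
    finally show ?thesis .
  qed
  show thesis
  proof (rule that[OF n\<nu> r(1)])
    show "ball (p - r *\<^sub>R \<nu>) r \<subseteq> \<Omega>"
    proof
      fix x assume "x \<in> ball (p - r *\<^sub>R \<nu>) r"
      then have h: "norm ((x - p) - (- 1 * r) *\<^sub>R \<nu>) < r"
        by (simp add: dist_norm norm_minus_commute algebra_simps)
      have "norm (x - p) < d" using key[OF h] by simp
      then have xU: "x \<in> U" using K(3) by (auto simp: dist_norm norm_minus_commute)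
      have "\<phi> x < 0" using taylor[OF \<open>norm (x - p) < d\<close>] sign[OF h] by simp
      then show "x \<in> \<Omega>" using in\<Omega> xU by blast
    qed
    show "ball (p + r *\<^sub>R \<nu>) r \<inter> \<Omega> = {}"
    proof (rule ccontr)
      assume "\<not> ?thesis"
      then obtain x where x: "x \<in> ball (p + r *\<^sub>R \<nu>) r" "x \<in> \<Omega>" by blast
      then have h: "norm ((x - p) - (1 * r) *\<^sub>R \<nu>) < r"
        by (simp add: dist_norm norm_minus_commute algebra_simps)
      have "norm (x - p) < d" using key[OF h] by simp
      then have xU: "x \<in> U" using K(3) by (auto simp: dist_norm norm_minus_commute)
      have "\<phi> x > 0" using taylor[OF \<open>norm (x - p) < d\<close>] sign[OF h] by simp
      then show False using in\<Omega> xU x(2) by (metis (mono_tags, lifting) IntI less_asym mem_Collect_eq)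
    qed
  qed
qed

text \<open>The interior ball makes \<open>p\<close> a nearest boundary point of \<open>p - t \<nu>\<close>; this is what allows the expansions to be evaluated at \<open>p\<close>.\<close>

lemma infdist_along_normal:
  fixes \<Omega> :: "(real^'n) set"
  assumes "open \<Omega>" "p \<in> frontier \<Omega>" "norm \<nu> = 1" "ball (p - r *\<^sub>R \<nu>) r \<subseteq> \<Omega>" "0 < t" "t < r"
  shows "p - t *\<^sub>R \<nu> \<in> \<Omega>" "dist (p - t *\<^sub>R \<nu>) p = t" "infdist (p - t *\<^sub>R \<nu>) (frontier \<Omega>) = t"
proof -
  let ?x = "p - t *\<^sub>R \<nu>" and ?a = "p - r *\<^sub>R \<nu>"
  have "?x - ?a = (r - t) *\<^sub>R \<nu>" by (simp add: algebra_simps)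
  then have xa: "dist ?x ?a = r - t" using assms(3,6) by (simp add: dist_norm)
  then show "?x \<in> \<Omega>" using assms(4,5) by (auto simp: dist_commute)
  show xp: "dist ?x p = t" using assms(3,5) by (simp add: dist_norm)
  obtain q where q: "q \<in> frontier \<Omega>" "infdist ?x (frontier \<Omega>) = dist ?x q"
    using infdist_attains_inf[of "frontier \<Omega>" ?x] assms(2) by auto
  have "q \<notin> \<Omega>" using q(1) assms(1) by (simp add: frontier_def interior_open)
  then have "dist q ?a \<ge> r" using assms(4) by (force simp: dist_commute)
  then have "dist ?x q \<ge> t" using xa dist_triangle[of q ?a ?x] by (simp add: dist_commute)
  moreover have "infdist ?x (frontier \<Omega>) \<le> t" using infdist_le[OF assms(2), of ?x] xp by simp
  ultimately show "infdist ?x (frontier \<Omega>) = t" using q(2) by simp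
qed

section \<open>Barriers at the boundary\<close>

lemma continuous_ball_potential:
  assumes "0 < s * (r\<^sup>2 - (dist x a)\<^sup>2)" "0 < r"
  shows "isCont (ball_potential s r a) x"
  unfolding ball_potential_def[abs_def] using assms by (intro continuous_intros) auto

text \<open>The hyperbolic metric of a slightly smaller concentric ball blows up on a sphere where \<open>v\<close> is still finite, so it dominates
  \<open>v\<close> inside; then the radius increases to \<open>r\<close>.\<close>

lemma upper_barrier:
  fixes v :: "real^'n \<Rightarrow> real"
  assumes n: "CARD('n) \<ge> 3" and k: "1 \<le> k" "k \<le> CARD('n)" and v: "sigma_ricci_on k \<Omega> v"
    and r: "0 < r" and ball: "ball a r \<subseteq> \<Omega>" and x: "dist x a < r"
  shows "v x \<le> ball_potential 1 r a x"
proof -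
  have le: "v x \<le> ball_potential 1 s a x" if s: "dist x a < s" "s < r" for s
  proof (rule comparison_principle[OF n k(1), of "ball a s"])
    have s0: "0 < s" using s zero_le_dist[of x a] by linarith
    show "bounded (ball a s)" by simp
    have sub: "ball a s \<subseteq> \<Omega>" using ball s by (meson subset_ball less_imp_le subset_trans)
    then show "sigma_ricci_on k (ball a s) v"
      using v by (auto simp: sigma_ricci_on_def twice_differentiable_on_def)
    have pos: "0 < 1 * (s\<^sup>2 - (dist y a)\<^sup>2)" if "y \<in> ball a s" for y
      using that s0 by (simp add: dist_commute power_strict_mono)
    show "sigma_ricci_on k (ball a s) (ball_potential 1 s a)"
      by (rule ball_potential_sigma_ricci_on[OF n k(2) s0]) (use pos in auto)
    show "x \<in> ball a s" using s by (simp add: dist_commute)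
    fix p \<epsilon> :: real and q assume q: "q \<in> frontier (ball a s)" and \<epsilon>: "0 < \<epsilon>"
    have qs: "dist q a = s" using q s0 by (simp add: frontier_ball dist_commute)
    then have "q \<in> \<Omega>" using ball s by (auto simp: dist_commute)
    then have "isCont v q"
      using v continuous_on_eq_continuous_at twice_differentiable_on_continuous_on
      unfolding sigma_ricci_on_def by blast
    then have "(v \<longlongrightarrow> v q) (at q within ball a s)" by (metis continuous_at_imp_continuous_at_within continuous_within)
    then have ev1: "\<forall>\<^sub>F y in at q within ball a s. v y < v q + 1" by (rule order_tendstoD) simp
    have inb: "\<forall>\<^sub>F y in at q within ball a s. y \<in> ball a s"
      by (simp add: eventually_at_filter)
    have "((\<lambda>y. s\<^sup>2 - (dist y a)\<^sup>2) \<longlongrightarrow> s\<^sup>2 - (dist q a)\<^sup>2) (at q within ball a s)"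
      by (intro tendsto_intros)
    then have lim: "((\<lambda>y. 1 * (s\<^sup>2 - (dist y a)\<^sup>2)) \<longlongrightarrow> 0) (at q within ball a s)" using qs by simp
    have "filterlim (\<lambda>y. 2 * s / (1 * (s\<^sup>2 - (dist y a)\<^sup>2))) at_top (at q within ball a s)"
      by (rule LIM_at_top_divide[OF tendsto_const _ lim]) (use s0 inb pos in \<open>auto elim: eventually_mono\<close>)
    then have "filterlim (ball_potential 1 s a) at_top (at q within ball a s)"
      unfolding ball_potential_def by (rule filterlim_compose[OF ln_at_top])
    then have "\<forall>\<^sub>F y in at q within ball a s. v q + 1 \<le> ball_potential 1 s a y"
      by (simp add: filterlim_at_top)
    with ev1 show "\<forall>\<^sub>F y in at q within ball a s. v y - ball_potential 1 s a y < \<epsilon>"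
      by eventually_elim (use \<epsilon> in simp)
  qed
  have "((\<lambda>s. ball_potential 1 s a x) \<longlongrightarrow> ball_potential 1 r a x) (at_left r)"
  proof -
    have "0 < r\<^sup>2 - (dist x a)\<^sup>2" using x r by (simp add: power_strict_mono)
    then show ?thesis unfolding ball_potential_def using r by (intro tendsto_intros) auto
  qed
  then show ?thesis
  proof (rule tendsto_lowerbound)
    show "\<forall>\<^sub>F s in at_left r. v x \<le> ball_potential 1 s a x"
      using eventually_at_left_field[of _ r] le x by blast
  qed simp
qed

text \<open>The hyperbolic metric outside a slightly smaller ball is finite on the closure of \<open>\<Omega>\<close>, while \<open>v\<close> blows up on the boundary.\<close>

lemma lower_barrier:
  fixes v :: "real^'n \<Rightarrow> real"
  assumes n: "CARD('n) \<ge> 3" and k: "1 \<le> k" "k \<le> CARD('n)" and v: "sigma_ricci_on k \<Omega> v"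
    and bd: "bounded \<Omega>" and blow: "\<And>q. q \<in> frontier \<Omega> \<Longrightarrow> filterlim v at_top (at q within \<Omega>)"
    and r: "0 < r" and ball: "ball b r \<inter> \<Omega> = {}" and x: "x \<in> \<Omega>" "r < dist x b"
  shows "ball_potential (- 1) r b x \<le> v x"
proof -
  have out: "r \<le> dist y b" if "y \<in> closure \<Omega>" for y
  proof -
    have "ball b r \<inter> closure \<Omega> = {}" using ball open_Int_closure_eq_empty open_ball by blast
    then show ?thesis using that by (force simp: dist_commute)
  qed
  have le: "ball_potential (- 1) s b x \<le> v x" if s: "0 < s" "s < r" for s
  proof (rule comparison_principle[OF n k(1) bd _ v])
    have pos: "0 < (- 1) * (s\<^sup>2 - (dist y b)\<^sup>2)" if "y \<in> closure \<Omega>" for y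
      using out[OF that] s by (simp add: power_strict_mono)
    show "sigma_ricci_on k \<Omega> (ball_potential (- 1) s b)"
    proof (rule ball_potential_sigma_ricci_on[OF n k(2) s(1)])
      show "open \<Omega>" using v by (simp add: sigma_ricci_on_def)
    qed (use pos closure_subset in auto)
    fix q and \<epsilon> :: real assume q: "q \<in> frontier \<Omega>" and \<epsilon>: "0 < \<epsilon>"
    let ?W = "ball_potential (- 1) s b"
    have "q \<in> closure \<Omega>" using q by (simp add: frontier_def)
    then have "isCont ?W q" using pos s by (intro continuous_ball_potential) auto
    then have "(?W \<longlongrightarrow> ?W q) (at q within \<Omega>)" by (metis continuous_at_imp_continuous_at_within continuous_within)
    then have "\<forall>\<^sub>F y in at q within \<Omega>. ?W y < ?W q + 1" by (rule order_tendstoD) simp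
    moreover have "\<forall>\<^sub>F y in at q within \<Omega>. ?W q + 1 \<le> v y"
      using blow[OF q] by (simp add: filterlim_at_top)
    ultimately show "\<forall>\<^sub>F y in at q within \<Omega>. ?W y - v y < \<epsilon>"
      by eventually_elim (use \<epsilon> in simp)
  qed (use x in simp)
  have "((\<lambda>s. ball_potential (- 1) s b x) \<longlongrightarrow> ball_potential (- 1) r b x) (at_left r)"
  proof -
    have "0 < (- 1) * (r\<^sup>2 - (dist x b)\<^sup>2)" using x r by (simp add: power_strict_mono)
    then show ?thesis unfolding ball_potential_def using r by (intro tendsto_intros) auto
  qed
  then show ?thesis
  proof (rule tendsto_upperbound)
    show "\<forall>\<^sub>F s in at_left r. ball_potential (- 1) s b x \<le> v x"
      using eventually_at_left_field[of _ r] le r by blast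
  qed simp
qed

text \<open>At \<open>p - t \<nu>\<close> the two barriers are \<open>- ln t\<close> up to the terms \<open>ln (2r / (2r \<plusminus> t))\<close>, which tend to \<open>0\<close>.\<close>

proposition boundary_asymptotics:
  fixes v :: "real^'n \<Rightarrow> real"
  assumes n: "CARD('n) \<ge> 3" and k: "1 \<le> k" "k \<le> CARD('n)" and v: "sigma_ricci_on k \<Omega> v"
    and bd: "bounded \<Omega>" and blow: "\<And>q. q \<in> frontier \<Omega> \<Longrightarrow> filterlim v at_top (at q within \<Omega>)"
    and p: "p \<in> frontier \<Omega>" and \<nu>: "norm \<nu> = 1" and r: "0 < r"
    and int: "ball (p - r *\<^sub>R \<nu>) r \<subseteq> \<Omega>" and ext: "ball (p + r *\<^sub>R \<nu>) r \<inter> \<Omega> = {}"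
  shows "((\<lambda>t. v (p - t *\<^sub>R \<nu>) + ln t) \<longlongrightarrow> 0) (at_right 0)"
proof (rule tendsto_sandwich)
  have ev: "\<forall>\<^sub>F t in at_right 0. 0 < t \<and> t < r"
    using r eventually_at_right_field[of _ 0] by blast
  show "\<forall>\<^sub>F t in at_right 0. v (p - t *\<^sub>R \<nu>) + ln t \<le> ln (2 * r / (2 * r - t))"
    using ev
  proof eventually_elim
    case (elim t)
    have "(p - t *\<^sub>R \<nu>) - (p - r *\<^sub>R \<nu>) = (r - t) *\<^sub>R \<nu>" by (simp add: algebra_simps)
    then have d: "dist (p - t *\<^sub>R \<nu>) (p - r *\<^sub>R \<nu>) = r - t" using \<nu> elim by (simp add: dist_norm)
    have "v (p - t *\<^sub>R \<nu>) \<le> ln (2 * r / (r\<^sup>2 - (r - t)\<^sup>2))"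
      using upper_barrier[OF n k v r int, of "p - t *\<^sub>R \<nu>"] elim by (simp add: d ball_potential_def)
    also have "r\<^sup>2 - (r - t)\<^sup>2 = (2 * r - t) * t" by (simp add: power2_eq_square algebra_simps)
    also have "ln (2 * r / ((2 * r - t) * t)) = ln (2 * r / (2 * r - t)) - ln t"
      using elim r by (simp add: ln_div ln_mult)
    finally show ?case by simp
  qed
  show "\<forall>\<^sub>F t in at_right 0. ln (2 * r / (2 * r + t)) \<le> v (p - t *\<^sub>R \<nu>) + ln t"
    using ev
  proof eventually_elim
    case (elim t)
    have "(p - t *\<^sub>R \<nu>) - (p + r *\<^sub>R \<nu>) = (- (r + t)) *\<^sub>R \<nu>" by (simp add: algebra_simps)
    then have d: "dist (p - t *\<^sub>R \<nu>) (p + r *\<^sub>R \<nu>) = r + t" using \<nu> elim by (simp add: dist_norm)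
    have "open \<Omega>" using v by (simp add: sigma_ricci_on_def)
    then have "p - t *\<^sub>R \<nu> \<in> \<Omega>" using infdist_along_normal(1) p \<nu> int elim by blast
    then have "ln (2 * r / (- 1 * (r\<^sup>2 - (r + t)\<^sup>2))) \<le> v (p - t *\<^sub>R \<nu>)"
      using lower_barrier[OF n k v bd blow r ext, of "p - t *\<^sub>R \<nu>"] elim by (simp add: d ball_potential_def)
    also have "- 1 * (r\<^sup>2 - (r + t)\<^sup>2) = (2 * r + t) * t" by (simp add: power2_eq_square algebra_simps)
    also have "ln (2 * r / ((2 * r + t) * t)) = ln (2 * r / (2 * r + t)) - ln t"
      using elim r by (simp add: ln_div ln_mult)
    finally show ?case by simp
  qed
  have "((\<lambda>t. ln (2 * r / (2 * r - t))) \<longlongrightarrow> ln (2 * r / (2 * r - 0))) (at_right 0)"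
    using r by (intro tendsto_intros) auto
  then show "((\<lambda>t. ln (2 * r / (2 * r - t))) \<longlongrightarrow> 0) (at_right 0)" using r by simp
  have "((\<lambda>t. ln (2 * r / (2 * r + t))) \<longlongrightarrow> ln (2 * r / (2 * r + 0))) (at_right 0)"
    using r by (intro tendsto_intros) auto
  then show "((\<lambda>t. ln (2 * r / (2 * r + t))) \<longlongrightarrow> 0) (at_right 0)" using r by simp
qed

section \<open>Solutions and their boundary expansions\<close>

text \<open>The factor \<open>e\<^bsup>-2\<rho>\<^esup>\<close> from \<open>neg_ricci_endo_conformal\<close> enters \<open>\<sigma>\<^sub>k\<close> with the power \<open>k\<close>, and so turns the right-hand side
  \<open>e\<^bsup>2kw\<^esup>\<close> into \<open>e\<^bsup>2k(w+\<rho>)\<^esup>\<close>.\<close>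

lemma solution_imp_sigma_ricci_on:
  fixes w \<rho> :: "real^'n \<Rightarrow> real"
  assumes k: "k \<le> CARD('n)" and \<Omega>: "open \<Omega>" and \<rho>: "smooth_on \<Omega> \<rho>"
    and w: "sigma_ricci_solution \<Omega> (conformal_metric \<rho> flat_metric) k w"
  shows "sigma_ricci_on k \<Omega> (\<lambda>x. w x + \<rho> x)"
proof -
  let ?v = "\<lambda>x. w x + \<rho> x"
  let ?C = "(real CARD('n) - 1) ^ k * real (CARD('n) choose k)"
  \<comment> \<open>The sum \<open>w + \<rho>\<close> is treated as \<open>w - (0 - \<rho>)\<close>.\<close>
  have "twice_differentiable_on \<Omega> (\<lambda>_. 0)"
    by (simp add: twice_differentiable_on_def partial_def[abs_def] frechet_derivative_const)
  moreover have "twice_differentiable_on \<Omega> \<rho>" "twice_differentiable_on \<Omega> w"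
    using smooth_on_imp_twice_differentiable_on[OF \<Omega>] \<rho> w by (auto simp: sigma_ricci_solution_def)
  ultimately have "twice_differentiable_on \<Omega> (\<lambda>x. w x - (0 - \<rho> x))"
    by (intro twice_differentiable_on_diff(1) \<Omega>)
  then have tw: "twice_differentiable_on \<Omega> ?v" by simp
  have "conformal_neg_ricci ?v x \<in> garding_cone k \<and>
      sigma k (conformal_neg_ricci ?v x) = ?C * exp (2 * real k * ?v x)" if x: "x \<in> \<Omega>" for x
  proof -
    let ?M = "conformal_neg_ricci ?v x"
    have eq: "neg_ricci_endo (conformal_metric \<rho> flat_metric) w x = exp (- 2 * \<rho> x) *\<^sub>R ?M"
      by (rule neg_ricci_endo_conformal[OF \<Omega> x tw])
    have "exp (- 2 * \<rho> x) *\<^sub>R ?M \<in> Gamma_plus k (exp (2 * \<rho> x) *\<^sub>R mat 1)"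
      using w x unfolding eq[symmetric] sigma_ricci_solution_def
      by (simp add: conformal_metric_def flat_metric_def)
    then have "exp (- 2 * \<rho> x) *\<^sub>R ?M \<in> garding_cone k"
      using Gamma_plus_subset_garding_cone[OF _ k, of "exp (2 * \<rho> x)"] by auto
    from garding_cone_scaleR[OF this, of "exp (2 * \<rho> x)"]
    have M: "?M \<in> garding_cone k" by (simp add: exp_minus)
    then have sym: "transpose ?M = ?M" by (simp add: garding_cone_def)
    have scaled: "exp (- 2 * \<rho> x) ^ k * sigma k ?M = ?C * exp (2 * real k * w x)"
      unfolding sigma_scaleR[OF sym, symmetric] eq[symmetric]
      using w x by (simp add: sigma_ricci_solution_def)
    have one: "exp (2 * \<rho> x) ^ k * exp (- 2 * \<rho> x) ^ k = 1"
      by (simp add: power_mult_distrib[symmetric] exp_add[symmetric])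
    have exps: "exp (2 * \<rho> x) ^ k * exp (2 * real k * w x) = exp (2 * real k * ?v x)"
      by (simp add: exp_of_nat_mult[symmetric] exp_add[symmetric] algebra_simps)
    have "sigma k ?M = exp (2 * \<rho> x) ^ k * (exp (- 2 * \<rho> x) ^ k * sigma k ?M)"
      unfolding mult.assoc[symmetric] one by simp
    also have "\<dots> = ?C * exp (2 * real k * ?v x)"
      unfolding scaled exps[symmetric] by (simp only: mult.left_commute)
    finally have "sigma k ?M = ?C * exp (2 * real k * ?v x)" .
    then show ?thesis using M by simp
  qed
  then show ?thesis using \<Omega> tw by (simp add: sigma_ricci_on_def)
qed

lemma boundary_expansion_bound:
  fixes \<Omega> :: "(real^'n) set"
  assumes "boundary_expansion \<Omega> w c e"
  obtains C \<delta> where "0 < \<delta>" "\<And>x q d. x \<in> \<Omega> \<Longrightarrow> q \<in> frontier \<Omega> \<Longrightarrow>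
    dist x q = d \<Longrightarrow> infdist x (frontier \<Omega>) = d \<Longrightarrow> d < \<delta> \<Longrightarrow>
    \<bar>w x - (- ln d + (\<Sum>j<CARD('n). c j q * d ^ j) + e q * d ^ CARD('n) * ln d)\<bar> \<le> C * d ^ CARD('n)"
proof -
  obtain C \<delta> where "0 < \<delta>" and *: "\<forall>x\<in>\<Omega>. \<forall>p\<in>frontier \<Omega>. let d = infdist x (frontier \<Omega>) in
        dist x p = d \<and> d < \<delta> \<longrightarrow>
        \<bar>w x - (- ln d + (\<Sum>j<CARD('n). c j p * d ^ j) + e p * d ^ CARD('n) * ln d)\<bar>
          \<le> C * d ^ CARD('n)"
    using assms unfolding boundary_expansion_def by blast
  show thesis
  proof (rule that[OF \<open>0 < \<delta>\<close>, of C])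
    fix x q d
    assume a: "x \<in> \<Omega>" "q \<in> frontier \<Omega>" "dist x q = d" "infdist x (frontier \<Omega>) = d" "d < \<delta>"
    show "\<bar>w x - (- ln d + (\<Sum>j<CARD('n). c j q * d ^ j) + e q * d ^ CARD('n) * ln d)\<bar> \<le> C * d ^ CARD('n)"
      using *[THEN bspec, OF a(1), THEN bspec, OF a(2)] a(3,5) unfolding Let_def a(4) by blast
  qed
qed

text \<open>The coefficients are bounded since the boundary is compact, and \<open>d\<^sup>n \<bar>ln d\<bar> \<le> d\<^sup>n\<^sup>-\<^sup>1 \<le> d\<close> for \<open>d < 1\<close>; hence everything after the
  term of order zero is \<open>O(d)\<close> uniformly.\<close>

lemma boundary_expansion_first_order:
  fixes \<Omega> :: "(real^'n) set"
  assumes n: "CARD('n) \<ge> 2" and \<Omega>: "open \<Omega>" "bounded \<Omega>" and ex: "boundary_expansion \<Omega> w c e"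
  obtains K \<delta> where "0 < \<delta>" "0 \<le> K" "\<And>x q. x \<in> \<Omega> \<Longrightarrow> q \<in> frontier \<Omega> \<Longrightarrow>
    dist x q = infdist x (frontier \<Omega>) \<Longrightarrow> dist x q < \<delta> \<Longrightarrow>
    \<bar>w x + ln (dist x q) - c 0 q\<bar> \<le> K * dist x q"
proof -
  let ?n = "CARD('n)"
  have cpt: "compact (frontier \<Omega>)" using \<Omega>(2) by (simp add: compact_frontier_bounded)
  have bdd: "\<exists>B. \<forall>q\<in>frontier \<Omega>. \<bar>f q\<bar> \<le> B" if "smooth_on (frontier \<Omega>) f" for f :: "real^'n \<Rightarrow> real"
    using compact_imp_bounded[OF compact_continuous_image[OF smooth_on_imp_continuous_on[OF that] cpt]]
    by (auto simp: bounded_iff)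
  obtain Be where Be: "\<And>q. q \<in> frontier \<Omega> \<Longrightarrow> \<bar>e q\<bar> \<le> Be"
    using bdd[of e] ex by (auto simp: boundary_expansion_def)
  have "\<forall>j. \<exists>B. j < ?n \<longrightarrow> (\<forall>q\<in>frontier \<Omega>. \<bar>c j q\<bar> \<le> B)"
    using bdd ex by (auto simp: boundary_expansion_def)
  then obtain B where B: "\<And>j q. j < ?n \<Longrightarrow> q \<in> frontier \<Omega> \<Longrightarrow> \<bar>c j q\<bar> \<le> B j" by metis
  obtain C \<delta> where \<delta>: "0 < \<delta>" and E: "\<And>x q d. x \<in> \<Omega> \<Longrightarrow> q \<in> frontier \<Omega> \<Longrightarrow>
      dist x q = d \<Longrightarrow> infdist x (frontier \<Omega>) = d \<Longrightarrow> d < \<delta> \<Longrightarrow>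
      \<bar>w x - (- ln d + (\<Sum>j<?n. c j q * d ^ j) + e q * d ^ ?n * ln d)\<bar> \<le> C * d ^ ?n"
    by (rule boundary_expansion_bound[OF ex], rule that; blast)
  define K where "K = (\<Sum>j\<in>{1..<?n}. \<bar>B j\<bar>) + \<bar>Be\<bar> + \<bar>C\<bar>"
  show thesis
  proof (rule that[of "min \<delta> 1" K])
    show "0 < min \<delta> 1" using \<delta> by simp
    show "0 \<le> K" unfolding K_def by (intro add_nonneg_nonneg sum_nonneg) auto
    fix x q assume x: "x \<in> \<Omega>" and q: "q \<in> frontier \<Omega>"
      and d: "dist x q = infdist x (frontier \<Omega>)" "dist x q < min \<delta> 1"
    let ?d = "dist x q"
    have "q \<notin> \<Omega>" using q \<Omega>(1) by (simp add: frontier_def interior_open)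
    then have d0: "0 < ?d" using x by auto
    have pow: "?d ^ j \<le> ?d" if "1 \<le> j" for j
      using power_decreasing[of 1 j ?d] that d(2) by simp
    have "(\<Sum>j<?n. c j q * ?d ^ j) = c 0 q + (\<Sum>j\<in>{1..<?n}. c j q * ?d ^ j)"
      using sum.atLeast_Suc_lessThan[of 0 ?n "\<lambda>j. c j q * ?d ^ j"] by (simp add: atLeast0LessThan)
    moreover have "\<bar>\<Sum>j\<in>{1..<?n}. c j q * ?d ^ j\<bar> \<le> (\<Sum>j\<in>{1..<?n}. \<bar>B j\<bar>) * ?d"
      unfolding sum_distrib_right
    proof (intro order_trans[OF sum_abs] sum_mono)
      fix j assume j: "j \<in> {1..<?n}"
      have "\<bar>c j q\<bar> \<le> \<bar>B j\<bar>" using B[of j q] j q by fastforce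
      then show "\<bar>c j q * ?d ^ j\<bar> \<le> \<bar>B j\<bar> * ?d"
        unfolding abs_mult using pow[of j] j by (intro mult_mono) auto
    qed
    moreover have "\<bar>e q * ?d ^ ?n * ln ?d\<bar> \<le> \<bar>Be\<bar> * ?d"
    proof -
      have "ln (1 / ?d) \<le> 1 / ?d - 1" using d0 by (intro ln_le_minus_one) simp
      moreover have "ln ?d \<le> 0" using d0 d(2) by simp
      ultimately have "\<bar>ln ?d\<bar> \<le> 1 / ?d" using d0 by (simp add: ln_div)
      then have "?d ^ ?n * \<bar>ln ?d\<bar> \<le> ?d ^ ?n * (1 / ?d)" using d0 by (intro mult_left_mono) auto
      also have "\<dots> = ?d ^ (?n - 1)" using d0 n by (simp add: power_diff)
      also have "\<dots> \<le> ?d" using n by (intro pow) simp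
      finally have "?d ^ ?n * \<bar>ln ?d\<bar> \<le> ?d" .
      then have "\<bar>e q\<bar> * (?d ^ ?n * \<bar>ln ?d\<bar>) \<le> \<bar>Be\<bar> * ?d"
        using Be[OF q] d0 by (intro mult_mono) auto
      then show ?thesis using d0 by (simp add: abs_mult mult.assoc)
    qed
    moreover have "C * ?d ^ ?n \<le> \<bar>C\<bar> * ?d"
      using pow[of ?n] n d0 by (intro mult_mono) auto
    ultimately show "\<bar>w x + ln ?d - c 0 q\<bar> \<le> K * ?d"
      using E[OF x q refl d(1)[symmetric]] d(2) unfolding K_def by (simp add: algebra_simps)
  qed
qed

text \<open>Along the normal at \<open>p\<close> the function \<open>w + ln t\<close> tends to \<open>c\<^sub>0(p)\<close> by its expansion, and \<open>w + \<rho> + ln t\<close> tends to \<open>0\<close> by the barriers.\<close>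

lemma boundary_value_of_expansion:
  fixes w \<rho> :: "real^'n \<Rightarrow> real"
  assumes n: "CARD('n) \<ge> 3" and k: "1 \<le> k" "k \<le> CARD('n)" and \<Omega>: "bounded_smooth_domain \<Omega>"
    and \<rho>: "continuous_on (closure \<Omega>) \<rho>" and v: "sigma_ricci_on k \<Omega> (\<lambda>x. w x + \<rho> x)"
    and blow: "\<And>q. q \<in> frontier \<Omega> \<Longrightarrow> filterlim (\<lambda>x. w x + \<rho> x) at_top (at q within \<Omega>)"
    and ex: "boundary_expansion \<Omega> w c e" and p: "p \<in> frontier \<Omega>"
  shows "c 0 p = - \<rho> p"
proof -
  have n2: "CARD('n) \<ge> 2" using n by simp
  have op: "open \<Omega>" and bd: "bounded \<Omega>" using \<Omega> by (auto simp: bounded_smooth_domain_def)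
  obtain \<nu> r where \<nu>: "norm \<nu> = 1" "0 < r" "ball (p - r *\<^sub>R \<nu>) r \<subseteq> \<Omega>" "ball (p + r *\<^sub>R \<nu>) r \<inter> \<Omega> = {}"
    using interior_exterior_ball[OF \<Omega> p] .
  obtain K \<delta> where K: "0 < \<delta>" "0 \<le> K" and E: "\<And>x q. x \<in> \<Omega> \<Longrightarrow> q \<in> frontier \<Omega> \<Longrightarrow>
      dist x q = infdist x (frontier \<Omega>) \<Longrightarrow> dist x q < \<delta> \<Longrightarrow> \<bar>w x + ln (dist x q) - c 0 q\<bar> \<le> K * dist x q"
    by (rule boundary_expansion_first_order[OF n2 op bd ex], rule that; blast)
  let ?x = "\<lambda>t. p - t *\<^sub>R \<nu>"
  have ev: "\<forall>\<^sub>F t in at_right 0. 0 < t \<and> t < min r \<delta>"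
  proof -
    have "0 < min r \<delta>" using \<nu>(2) K(1) by simp
    then show ?thesis unfolding eventually_at_right_field by blast
  qed
  have A: "((\<lambda>t. w (?x t) + \<rho> (?x t) + ln t) \<longlongrightarrow> 0) (at_right 0)"
    using boundary_asymptotics[OF n k v bd blow p \<nu>] by simp
  have "((\<lambda>t. w (?x t) + ln t - c 0 p) \<longlongrightarrow> 0) (at_right 0)"
  proof (rule Lim_null_comparison)
    show "\<forall>\<^sub>F t in at_right 0. norm (w (?x t) + ln t - c 0 p) \<le> K * t"
      using ev
    proof eventually_elim
      case (elim t)
      have t: "0 < t" "t < r" using elim by auto
      show ?case
        using E[of "?x t" p] infdist_along_normal[OF op p \<nu>(1,3) t] elim p by simp
    qed
    have "((\<lambda>t. K * t) \<longlongrightarrow> K * 0) (at_right 0)" by (intro tendsto_intros)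
    then show "((\<lambda>t. K * t) \<longlongrightarrow> 0) (at_right 0)" by simp
  qed
  moreover have "((\<lambda>t. \<rho> (?x t)) \<longlongrightarrow> \<rho> p) (at_right 0)"
  proof -
    have "p \<in> closure \<Omega>" using p by (simp add: frontier_def)
    then have "(\<rho> \<longlongrightarrow> \<rho> p) (at p within closure \<Omega>)" using \<rho> by (simp add: continuous_on_def)
    moreover have "filterlim ?x (at p within closure \<Omega>) (at_right 0)"
      unfolding filterlim_at
    proof
      show "\<forall>\<^sub>F t in at_right 0. ?x t \<in> closure \<Omega> \<and> ?x t \<noteq> p"
        using ev
      proof eventually_elim
        case (elim t)
        then have t: "0 < t" "t < r" by auto
        have "?x t \<in> closure \<Omega>"
          using infdist_along_normal(1)[OF op p \<nu>(1,3) t] closure_subset by blast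
        moreover have "?x t \<noteq> p" using t \<nu>(1) by auto
        ultimately show ?case ..
      qed
      have "(?x \<longlongrightarrow> p - 0 *\<^sub>R \<nu>) (at_right 0)" by (intro tendsto_intros)
      then show "(?x \<longlongrightarrow> p) (at_right 0)" by simp
    qed
    ultimately show ?thesis by (rule filterlim_compose)
  qed
  ultimately have "((\<lambda>t. (w (?x t) + ln t - c 0 p) + \<rho> (?x t)) \<longlongrightarrow> 0 + \<rho> p) (at_right 0)"
    by (intro tendsto_add)
  from tendsto_diff[OF A this] have "((\<lambda>t. c 0 p) \<longlongrightarrow> - \<rho> p) (at_right (0::real))"
    by (simp add: algebra_simps)
  then show ?thesis using tendsto_unique[OF trivial_limit_at_right_real tendsto_const] by blast
qed

text \<open>At a nearest boundary point \<open>q\<close> of \<open>x\<close> both expansions reduce to \<open>- ln d\<close> plus their terms of order zero, and \<open>\<rho> x - \<rho> q\<close> is small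
  because \<open>q\<close> is close to \<open>p\<close> whenever \<open>x\<close> is.\<close>

lemma expansions_agree_at_boundary:
  fixes w w' \<rho> :: "real^'n \<Rightarrow> real"
  assumes n: "CARD('n) \<ge> 2" and \<Omega>: "open \<Omega>" "bounded \<Omega>" and \<rho>: "continuous_on (closure \<Omega>) \<rho>"
    and w: "boundary_expansion \<Omega> w c e" and w': "boundary_expansion \<Omega> w' c' e'"
    and c: "\<And>q. q \<in> frontier \<Omega> \<Longrightarrow> c 0 q = c' 0 q + \<rho> q"
    and p: "p \<in> frontier \<Omega>" and \<epsilon>: "0 < \<epsilon>"
  shows "\<forall>\<^sub>F x in at p within \<Omega>. \<bar>w x - (w' x + \<rho> x)\<bar> < \<epsilon>"
proof -
  obtain K \<delta> where K: "0 < \<delta>" "0 \<le> K" and E: "\<And>x q. x \<in> \<Omega> \<Longrightarrow> q \<in> frontier \<Omega> \<Longrightarrow>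
      dist x q = infdist x (frontier \<Omega>) \<Longrightarrow> dist x q < \<delta> \<Longrightarrow> \<bar>w x + ln (dist x q) - c 0 q\<bar> \<le> K * dist x q"
    by (rule boundary_expansion_first_order[OF n \<Omega> w], rule that; blast)
  obtain K' \<delta>' where K': "0 < \<delta>'" "0 \<le> K'" and E': "\<And>x q. x \<in> \<Omega> \<Longrightarrow> q \<in> frontier \<Omega> \<Longrightarrow>
      dist x q = infdist x (frontier \<Omega>) \<Longrightarrow> dist x q < \<delta>' \<Longrightarrow> \<bar>w' x + ln (dist x q) - c' 0 q\<bar> \<le> K' * dist x q"
    by (rule boundary_expansion_first_order[OF n \<Omega> w'], rule that; blast)
  have pc: "p \<in> closure \<Omega>" using p by (simp add: frontier_def)
  obtain \<eta> where \<eta>: "0 < \<eta>" "\<And>y. y \<in> closure \<Omega> \<Longrightarrow> dist y p < \<eta> \<Longrightarrow> dist (\<rho> y) (\<rho> p) < \<epsilon> / 4"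
    using \<rho>[unfolded continuous_on_iff, rule_format, OF pc, of "\<epsilon> / 4"] \<epsilon> by auto
  define m where "m = min (min \<delta> \<delta>') (min (\<eta> / 2) (\<epsilon> / (2 * (K + K' + 1))))"
  have m: "0 < m" using K K' \<eta> \<epsilon> by (simp add: m_def)
  have "\<bar>w x - (w' x + \<rho> x)\<bar> < \<epsilon>" if x: "x \<in> \<Omega>" "dist x p < m" for x
  proof -
    obtain q where q: "q \<in> frontier \<Omega>" "infdist x (frontier \<Omega>) = dist x q"
      using infdist_attains_inf[of "frontier \<Omega>" x] p by auto
    let ?d = "dist x q"
    have dp: "?d \<le> dist x p" using q(2) infdist_le[OF p, of x] by simp
    then have dm: "?d < m" using x by simp
    have "dist q p < \<eta>"
      using dist_triangle[of q p x] dp x(2) by (simp add: m_def dist_commute)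
    then have 1: "\<bar>\<rho> q - \<rho> p\<bar> < \<epsilon> / 4"
      using \<eta>(2)[of q] q(1) by (simp add: frontier_def dist_real_def)
    have "dist x p < \<eta>" using x(2) \<eta>(1) by (simp add: m_def)
    then have 2: "\<bar>\<rho> x - \<rho> p\<bar> < \<epsilon> / 4"
      using \<eta>(2)[of x] x(1) closure_subset by (auto simp: dist_real_def)
    have 3: "\<bar>w x + ln ?d - c 0 q\<bar> \<le> K * ?d"
      using E[OF x(1) q(1)] q(2) dm by (simp add: m_def)
    have 4: "\<bar>w' x + ln ?d - c' 0 q\<bar> \<le> K' * ?d"
      using E'[OF x(1) q(1)] q(2) dm by (simp add: m_def)
    have "(K + K') * ?d \<le> (K + K' + 1) * m"
      using dm m K K' by (intro mult_mono) auto
    also have "\<dots> \<le> (K + K' + 1) * (\<epsilon> / (2 * (K + K' + 1)))"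
      using K K' by (intro mult_left_mono) (auto simp: m_def)
    also have "\<dots> = \<epsilon> / 2" using K K' by (simp add: field_simps)
    finally have "K * ?d + K' * ?d \<le> \<epsilon> / 2" by (simp add: algebra_simps)
    with 1 2 3 4 c[OF q(1)] show ?thesis by linarith
  qed
  then show ?thesis unfolding eventually_at using m by blast
qed

section \<open>Comparing coefficients\<close>

text \<open>If the coefficients before \<open>A\<^sub>j\<close> vanish, then all remaining terms are \<open>O(t\<^sup>j\<^sup>+\<^sup>1 (1 + \<bar>ln t\<bar>))\<close> and hence
  \<open>O(t\<^sup>j \<surd>t)\<close>, since \<open>t \<bar>ln t\<bar> \<le> 2 \<surd>t\<close> for \<open>t < 1\<close>.\<close>

lemma log_expansion_coefficients_eq_0:
  fixes A :: "nat \<Rightarrow> real"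
  assumes \<delta>: "0 < \<delta>" and bound: "\<And>t. 0 < t \<Longrightarrow> t < \<delta> \<Longrightarrow>
      \<bar>(\<Sum>j<n. A j * t ^ j) + E * t ^ n * ln t\<bar> \<le> C * t ^ n"
    and "j < n"
  shows "A j = 0"
  using \<open>j < n\<close>
proof (induction j rule: less_induct)
  case (less j)
  define M where "M = (\<Sum>i<n. \<bar>A i\<bar>) + 2 * \<bar>E\<bar> + \<bar>C\<bar>"
  have le: "\<bar>A j\<bar> \<le> M * sqrt t" if t: "0 < t" "t < min \<delta> 1" for t
  proof -
    have st: "t \<le> sqrt t" using t by (simp add: real_le_rsqrt power_le_one_iff power2_eq_square mult_left_le)
    have pow: "t ^ i \<le> t ^ j * t" if "j < i" for i
      using power_decreasing[of "Suc j" i t] that t by (simp add: mult.commute)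
    have "(\<Sum>i<n. A i * t ^ i) = A j * t ^ j + (\<Sum>i\<in>{..<n}-{j}. A i * t ^ i)"
      using less.prems by (simp add: sum.remove)
    moreover have "\<bar>\<Sum>i\<in>{..<n}-{j}. A i * t ^ i\<bar> \<le> (\<Sum>i<n. \<bar>A i\<bar>) * (t ^ j * sqrt t)"
    proof -
      have "\<bar>\<Sum>i\<in>{..<n}-{j}. A i * t ^ i\<bar> \<le> (\<Sum>i\<in>{..<n}-{j}. \<bar>A i\<bar> * (t ^ j * sqrt t))"
      proof (intro order_trans[OF sum_abs] sum_mono)
        fix i assume i: "i \<in> {..<n} - {j}"
        show "\<bar>A i * t ^ i\<bar> \<le> \<bar>A i\<bar> * (t ^ j * sqrt t)"
        proof (cases "i < j")
          case True
          then show ?thesis using less.IH[of i] i t by simp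
        next
          case False
          then have "t ^ i \<le> t ^ j * sqrt t"
            using pow[of i] i st t by (smt (verit) DiffE insertI1 linorder_neqE_nat mult_left_mono zero_le_power)
          then show ?thesis using t by (simp add: abs_mult mult_left_mono)
        qed
      qed
      also have "\<dots> \<le> (\<Sum>i<n. \<bar>A i\<bar> * (t ^ j * sqrt t))"
        using t by (intro sum_mono2) auto
      finally show ?thesis by (simp add: sum_distrib_right)
    qed
    moreover have "\<bar>E * t ^ n * ln t\<bar> \<le> 2 * \<bar>E\<bar> * (t ^ j * sqrt t)"
    proof -
      have "ln (1 / sqrt t) \<le> 1 / sqrt t - 1" using t by (intro ln_le_minus_one) simp
      moreover have "ln t \<le> 0" using t by simp
      ultimately have "\<bar>ln t\<bar> \<le> 2 / sqrt t" using t by (simp add: ln_div ln_sqrt)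
      then have "t * \<bar>ln t\<bar> \<le> t * (2 / sqrt t)" using t by (intro mult_left_mono) auto
      also have "\<dots> = 2 * (t / sqrt t)" by simp
      also have "\<dots> = 2 * sqrt t" using t by (simp only: real_div_sqrt less_imp_le)
      finally have "t ^ j * (t * \<bar>ln t\<bar>) \<le> t ^ j * (2 * sqrt t)" using t by (intro mult_left_mono) auto
      moreover have "t ^ n * \<bar>ln t\<bar> \<le> t ^ j * t * \<bar>ln t\<bar>"
        using pow[OF less.prems] by (intro mult_right_mono) auto
      ultimately have "t ^ n * \<bar>ln t\<bar> \<le> 2 * (t ^ j * sqrt t)" by (simp add: mult_ac)
      then have "\<bar>E\<bar> * (t ^ n * \<bar>ln t\<bar>) \<le> \<bar>E\<bar> * (2 * (t ^ j * sqrt t))" by (intro mult_left_mono) auto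
      then show ?thesis using t by (simp add: abs_mult mult_ac)
    qed
    moreover have "C * t ^ n \<le> \<bar>C\<bar> * (t ^ j * sqrt t)"
    proof -
      have "t ^ n \<le> t ^ j * t" by (rule pow[OF less.prems])
      also have "\<dots> \<le> t ^ j * sqrt t" using st t by (intro mult_left_mono) auto
      finally show ?thesis using t by (intro mult_mono) auto
    qed
    ultimately have "\<bar>A j * t ^ j\<bar> \<le> M * (t ^ j * sqrt t)"
      using bound[of t] t unfolding M_def by (simp add: ring_distribs)
    then have "t ^ j * \<bar>A j\<bar> \<le> t ^ j * (M * sqrt t)" using t by (simp add: abs_mult mult_ac)
    then show ?thesis using t by (simp add: mult_le_cancel_left_pos)
  qed
  have "((\<lambda>t. M * sqrt t) \<longlongrightarrow> M * sqrt 0) (at_right 0)" by (intro tendsto_intros)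
  then have "\<bar>A j\<bar> \<le> M * sqrt 0"
  proof (rule tendsto_lowerbound)
    show "\<forall>\<^sub>F t in at_right 0. \<bar>A j\<bar> \<le> M * sqrt t"
    proof -
      have "0 < min \<delta> 1" using \<delta> by simp
      then show ?thesis unfolding eventually_at_right_field using le by blast
    qed
  qed simp
  then show ?case by simp
qed

theorem proposition1p2:
  fixes \<Omega> :: "(real^'n::finite) set"
    and \<rho> :: "real^'n \<Rightarrow> real"
    and w w' :: "nat \<Rightarrow> real^'n \<Rightarrow> real"
    and c c' :: "nat \<Rightarrow> nat \<Rightarrow> real^'n \<Rightarrow> real"
    and e e' :: "nat \<Rightarrow> real^'n \<Rightarrow> real"
    and k j :: nat
  assumes "CARD('n) \<ge> 3"
    and "bounded_smooth_domain \<Omega>"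
    and "smooth_on (closure \<Omega>) \<rho>"
    and "1 \<le> k" and "k \<le> CARD('n)"
    and "\<And>m. m \<in> {1, k} \<Longrightarrow> sigma_ricci_solution \<Omega> flat_metric m (w m)"
    and "\<And>m. m \<in> {1, k} \<Longrightarrow>
           sigma_ricci_solution \<Omega> (conformal_metric \<rho> flat_metric) m (w' m)"
    and "\<And>m. m \<in> {1, k} \<Longrightarrow> boundary_expansion \<Omega> (w m) (c m) (e m)"
    and "\<And>m p. m \<in> {1, k} \<Longrightarrow> p \<in> frontier \<Omega> \<Longrightarrow> c m 0 p = 0"
    and "\<And>m. m \<in> {1, k} \<Longrightarrow> boundary_expansion \<Omega> (w' m) (c' m) (e' m)"
    and "1 \<le> j" and "j \<le> CARD('n) - 1"
  shows "\<forall>p\<in>frontier \<Omega>. c k j p - c 1 j p = c' k j p - c' 1 j p"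
proof
  fix p assume p: "p \<in> frontier \<Omega>"
  have op: "open \<Omega>" and bd: "bounded \<Omega>" using assms(2) by (auto simp: bounded_smooth_domain_def)
  have n2: "CARD('n) \<ge> 2" using assms(1) by simp
  have \<rho>\<Omega>: "smooth_on \<Omega> \<rho>"
    using smooth_on_subset[OF assms(3) closure_subset] .
  have \<rho>c: "continuous_on (closure \<Omega>) \<rho>" using assms(3) by (rule smooth_on_imp_continuous_on)
  have flat: "conformal_metric (\<lambda>_. 0) flat_metric = (flat_metric :: real^'n \<Rightarrow> real^'n^'n)"
    by (simp add: fun_eq_iff conformal_metric_def)
  have zero: "smooth_on \<Omega> (\<lambda>_. 0)"
  proof -
    have "Ck_on m UNIV (\<lambda>_ :: real^'n. 0)" for m
      by (induction m) (simp_all add: frechet_derivative_const)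
    then show ?thesis unfolding smooth_on_def by blast
  qed
  have eq: "w m x = w' m x + \<rho> x" if m: "m \<in> {1, k}" and x: "x \<in> \<Omega>" for m x
  proof -
    have m1: "1 \<le> m" "m \<le> CARD('n)" using m assms(4,5) by auto
    have "sigma_ricci_on m \<Omega> (\<lambda>x. w m x + 0)"
      using solution_imp_sigma_ricci_on[OF m1(2) op zero] assms(6)[OF m] by (simp add: flat)
    then have sw: "sigma_ricci_on m \<Omega> (w m)" by simp
    have sv: "sigma_ricci_on m \<Omega> (\<lambda>x. w' m x + \<rho> x)"
      using solution_imp_sigma_ricci_on[OF m1(2) op \<rho>\<Omega>] assms(7)[OF m] by simp
    \<comment> \<open>The conformal factor is bounded near the boundary, so adding \<open>\<rho>\<close> keeps the boundary condition.\<close>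
    have blow: "filterlim (\<lambda>x. w' m x + \<rho> x) at_top (at q within \<Omega>)" if q: "q \<in> frontier \<Omega>" for q
    proof -
      have "q \<in> closure \<Omega>" using q by (simp add: frontier_def)
      then have "(\<rho> \<longlongrightarrow> \<rho> q) (at q within closure \<Omega>)"
        using \<rho>c by (simp add: continuous_on_def)
      then have "(\<rho> \<longlongrightarrow> \<rho> q) (at q within \<Omega>)"
        using closure_subset by (rule tendsto_within_subset)
      from filterlim_tendsto_add_at_top[OF this, of "w' m"] show ?thesis
        using assms(7)[OF m] q by (simp add: sigma_ricci_solution_def add.commute)
    qed
    have c0: "c m 0 q = c' m 0 q + \<rho> q" if q: "q \<in> frontier \<Omega>" for q
      using boundary_value_of_expansion[OF assms(1) m1 assms(2) \<rho>c sv blow assms(10)[OF m] q]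
        assms(9)[OF m q] by simp
    note agree = expansions_agree_at_boundary[OF n2 op bd \<rho>c assms(8)[OF m] assms(10)[OF m] c0]
    have "w m x \<le> w' m x + \<rho> x"
      by (rule comparison_principle[OF assms(1) m1(1) bd sw sv _ x])
        (rule eventually_mono[OF agree], auto)
    moreover have "w' m x + \<rho> x \<le> w m x"
      by (rule comparison_principle[OF assms(1) m1(1) bd sv sw _ x])
        (rule eventually_mono[OF agree], auto)
    ultimately show ?thesis by simp
  qed
  obtain \<nu> r where \<nu>: "norm \<nu> = 1" "0 < r" "ball (p - r *\<^sub>R \<nu>) r \<subseteq> \<Omega>"
    by (rule interior_exterior_ball[OF assms(2) p], rule that; blast)
  let ?n = "CARD('n)" and ?x = "\<lambda>t. p - t *\<^sub>R \<nu>"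
  have along: "\<exists>C \<delta>. 0 < \<delta> \<and> (\<forall>t. 0 < t \<and> t < \<delta> \<longrightarrow>
      \<bar>u (?x t) - (- ln t + (\<Sum>i<?n. a i p * t ^ i) + b p * t ^ ?n * ln t)\<bar> \<le> C * t ^ ?n)"
    if ex: "boundary_expansion \<Omega> u a b" for u a b
  proof -
    obtain C \<delta> where "0 < \<delta>" and E: "\<And>x q d. x \<in> \<Omega> \<Longrightarrow> q \<in> frontier \<Omega> \<Longrightarrow>
      dist x q = d \<Longrightarrow> infdist x (frontier \<Omega>) = d \<Longrightarrow> d < \<delta> \<Longrightarrow>
      \<bar>u x - (- ln d + (\<Sum>i<?n. a i q * d ^ i) + b q * d ^ ?n * ln d)\<bar> \<le> C * d ^ ?n"
      by (rule boundary_expansion_bound[OF ex], rule that; blast)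
    have "\<bar>u (?x t) - (- ln t + (\<Sum>i<?n. a i p * t ^ i) + b p * t ^ ?n * ln t)\<bar> \<le> C * t ^ ?n"
      if t: "0 < t" "t < min r \<delta>" for t
    proof -
      have "t < r" using t by simp
      note nrm = infdist_along_normal[OF op p \<nu>(1,3) t(1) this]
      show ?thesis using E[OF nrm(1) p nrm(2,3)] t by simp
    qed
    then show ?thesis using \<nu>(2) \<open>0 < \<delta>\<close> by (intro exI[of _ C] exI[of _ "min r \<delta>"]) auto
  qed
  obtain C1 \<delta>1 where 1: "0 < \<delta>1" "\<And>t. 0 < t \<Longrightarrow> t < \<delta>1 \<Longrightarrow> \<bar>w k (?x t) - (- ln t
      + (\<Sum>i<?n. c k i p * t ^ i) + e k p * t ^ ?n * ln t)\<bar> \<le> C1 * t ^ ?n"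
    using along[OF assms(8)[of k]] by auto
  obtain C2 \<delta>2 where 2: "0 < \<delta>2" "\<And>t. 0 < t \<Longrightarrow> t < \<delta>2 \<Longrightarrow> \<bar>w 1 (?x t) - (- ln t
      + (\<Sum>i<?n. c 1 i p * t ^ i) + e 1 p * t ^ ?n * ln t)\<bar> \<le> C2 * t ^ ?n"
    using along[OF assms(8)[of 1]] by auto
  obtain C3 \<delta>3 where 3: "0 < \<delta>3" "\<And>t. 0 < t \<Longrightarrow> t < \<delta>3 \<Longrightarrow> \<bar>w' k (?x t) - (- ln t
      + (\<Sum>i<?n. c' k i p * t ^ i) + e' k p * t ^ ?n * ln t)\<bar> \<le> C3 * t ^ ?n"
    using along[OF assms(10)[of k]] by auto
  obtain C4 \<delta>4 where 4: "0 < \<delta>4" "\<And>t. 0 < t \<Longrightarrow> t < \<delta>4 \<Longrightarrow> \<bar>w' 1 (?x t) - (- ln t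
      + (\<Sum>i<?n. c' 1 i p * t ^ i) + e' 1 p * t ^ ?n * ln t)\<bar> \<le> C4 * t ^ ?n"
    using along[OF assms(10)[of 1]] by auto
  \<comment> \<open>The difference of the two sides of \<open>w\<^sub>k - w\<^sub>1 = w'\<^sub>k - w'\<^sub>1\<close> has these coefficients and vanishes
    near \<open>p\<close> along the normal, where the logarithms \<open>- ln t\<close> cancel.\<close>
  define A where "A i = (c k i p - c 1 i p) - (c' k i p - c' 1 i p)" for i
  define E where "E = (e k p - e 1 p) - (e' k p - e' 1 p)"
  define \<delta> where "\<delta> = min (min r \<delta>1) (min \<delta>2 (min \<delta>3 \<delta>4))"
  have "A j = 0"
  proof (rule log_expansion_coefficients_eq_0)
    show "0 < \<delta>" using \<nu>(2) 1 2 3 4 by (simp add: \<delta>_def)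
    show "j < ?n" using assms(1,12) by simp
    fix t assume t: "0 < t" "t < \<delta>"
    have "?x t \<in> \<Omega>" using infdist_along_normal(1)[OF op p \<nu>(1,3) t(1)] t by (simp add: \<delta>_def)
    then have d: "w k (?x t) - w 1 (?x t) = w' k (?x t) - w' 1 (?x t)"
      using eq[of k] eq[of 1] by simp
    have S: "(\<Sum>i<?n. A i * t ^ i) = ((\<Sum>i<?n. c k i p * t ^ i) - (\<Sum>i<?n. c 1 i p * t ^ i))
        - ((\<Sum>i<?n. c' k i p * t ^ i) - (\<Sum>i<?n. c' 1 i p * t ^ i))"
      unfolding A_def left_diff_distrib by (simp only: sum_subtractf)
    have T: "E * t ^ ?n * ln t = (e k p * t ^ ?n * ln t - e 1 p * t ^ ?n * ln t)
        - (e' k p * t ^ ?n * ln t - e' 1 p * t ^ ?n * ln t)"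
      unfolding E_def left_diff_distrib ..
    have R: "(C1 + C2 + C3 + C4) * t ^ ?n = C1 * t ^ ?n + C2 * t ^ ?n + C3 * t ^ ?n + C4 * t ^ ?n"
      by (simp add: distrib_right)
    have abs_le: "\<bar>(s1 - s2 - (s3 - s4)) + (t1 - t2 - (t3 - t4))\<bar> \<le> b1 + b2 + b3 + b4"
      if "\<bar>u1 - (l + s1 + t1)\<bar> \<le> b1" "\<bar>u2 - (l + s2 + t2)\<bar> \<le> b2" "\<bar>u3 - (l + s3 + t3)\<bar> \<le> b3"
        "\<bar>u4 - (l + s4 + t4)\<bar> \<le> b4" "u1 - u2 = u3 - u4"
      for s1 s2 s3 s4 t1 t2 t3 t4 b1 b2 b3 b4 u1 u2 u3 u4 l :: real
      using that by linarith
    show "\<bar>(\<Sum>i<?n. A i * t ^ i) + E * t ^ ?n * ln t\<bar> \<le> (C1 + C2 + C3 + C4) * t ^ ?n"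
      unfolding S T R
    proof (rule abs_le)
      have "t < \<delta>1" "t < \<delta>2" "t < \<delta>3" "t < \<delta>4" using t(2) by (simp_all add: \<delta>_def)
      then show "\<bar>w k (?x t) - (- ln t + (\<Sum>i<?n. c k i p * t ^ i) + e k p * t ^ ?n * ln t)\<bar> \<le> C1 * t ^ ?n"
        "\<bar>w 1 (?x t) - (- ln t + (\<Sum>i<?n. c 1 i p * t ^ i) + e 1 p * t ^ ?n * ln t)\<bar> \<le> C2 * t ^ ?n"
        "\<bar>w' k (?x t) - (- ln t + (\<Sum>i<?n. c' k i p * t ^ i) + e' k p * t ^ ?n * ln t)\<bar> \<le> C3 * t ^ ?n"
        "\<bar>w' 1 (?x t) - (- ln t + (\<Sum>i<?n. c' 1 i p * t ^ i) + e' 1 p * t ^ ?n * ln t)\<bar> \<le> C4 * t ^ ?n"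
        using 1(2) 2(2) 3(2) 4(2) t(1) by blast+
    qed (rule d)
  qed
  then show "c k j p - c 1 j p = c' k j p - c' 1 j p" by (simp add: A_def)
qed

end
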